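(* Let $\mathcal{P}\subset(1,2]$ be the set of parameters $s$ for which the critical point $c_s=\frac{s-1}{s}$ is periodic under the tent map $T_s$. Given $s_1,s_2\in\mathcal{P}$, $\varprojlim T_{s_1}$ is homeomorphic to $\varprojlim T_{s_2}$ if and only if the substitutions $\chi_{s_1}$ and $\chi_{s_2}$ are weakly equivalent, $\chi_{s_1}\sim_w\chi_{s_2}$.
   Context: For $1<s\le2$ the tent map $T_s:[0,1]\to[0,1]$ is $T_s(x)=sx+2-s$ for $0\le x\le\frac{s-1}{s}$ and $T_s(x)=-sx+s$ for $\frac{s-1}{s}\le x\le1$. $\varprojlim T_s=\{(x_0,x_1,\ldots)\in[0,1]^{\mathbb{N}}: T_s(x_i)=x_{i-1}\text{ for }i\ge1\}$ with the product topology. Let $\mathcal{A}_n=\{a_1,\ldots,a_n,\bar a_1,\ldots,\bar a_n\}$, let $\mathcal{W}(\mathcal{A}_n)$ be the set of finite nonempty words in $\mathcal{A}_n$, and put $\overline{b_1\ldots b_k}=\bar b_k\ldots\bar b_1$ with $\bar{\bar b}=b$. Substitutions are extended to words by concatenation. If $s\in\mathcal{P}$ and $c_s$ has period $n+1$ under $T_s$, its orbit $\{0=x_0<\ldots<x_n=1\}$ breaks $[0,1]$ into $n$ subintervals $J_i=[x_{i-1},x_i]$, $i=1,\ldots,n$. The substitution $\chi_s:\mathcal{A}_n\to\mathcal{W}(\mathcal{A}_n)$ is defined by $\chi_s(a_i)=a_\ell a_{\ell+1}\ldots a_{\ell+k}$ if $T_s(J_i)=J_\ell\cup\ldots\cup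 J_{\ell+k}$ and $T_s$ is increasing on $J_i$; $\chi_s(a_i)=\bar a_{\ell+k}\ldots\bar a_\ell$ if $T_s(J_i)=J_\ell\cup\ldots\cup J_{\ell+k}$ and $T_s$ is decreasing on $J_i$; and $\chi_s(\bar a_i)=\overline{\chi_s(a_i)}$. Substitutions $\chi:\mathcal{A}_n\to\mathcal{W}(\mathcal{A}_n)$ and $\psi:\mathcal{A}_m\to\mathcal{W}(\mathcal{A}_m)$ with $\chi(\bar b)=\overline{\chi(b)}$, $\psi(\bar c)=\overline{\psi(c)}$ are weakly equivalent, $\chi\sim_w\psi$, if there are sequences of positive integers $\{n_i\},\{m_i\}$ and substitutions $\sigma_i:\mathcal{A}_m\to\mathcal{W}(\mathcal{A}_n)$, $\tau_i:\mathcal{A}_n\to\mathcal{W}(\mathcal{A}_m)$, $i=1,2,\ldots$, with $\sigma_i(\bar c)=\overline{\sigma_i(c)}$, $\tau_i(\bar b)=\overline{\tau_i(b)}$ for all letters, such that $\sigma_i\circ\tau_i=\chi^{n_i}$ and $\tau_i\circ\sigma_{i+1}=\psi^{m_i}$ for all $i\ge1$. *)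

theory Defs
  imports "HOL-Analysis.Analysis"
begin

subsection \<open>Tent maps and their inverse limits\<close>

definition crit :: "real \<Rightarrow> real" where
  "crit s = (s - 1) / s"

text \<open>Only the restriction of \<open>tent s\<close> to \<open>{0..1}\<close> matters; the values elsewhere are junk.\<close>

definition tent :: "real \<Rightarrow> real \<Rightarrow> real" where
  "tent s x = (if x \<le> crit s then s * x + 2 - s else - s * x + s)"

definition tent_inverse_limit :: "real \<Rightarrow> (nat \<Rightarrow> real) topology" where
  "tent_inverse_limit s =
     subtopology (product_topology (\<lambda>_. top_of_set {0..1}) UNIV)
       {x. (\<forall>i. x i \<in> {0..1}) \<and> (\<forall>i\<ge>1. tent s (x i) = x (i - 1))}"

definition periodic_params :: "real set" where
  "periodic_params = {s. 1 < s \<and> s \<le> 2 \<and> (\<exists>k>0. (tent s ^^ k) (crit s) = crit s)}"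

subsection \<open>Words and substitutions\<close>

text \<open>\<open>Plain i\<close> is the letter $a_i$ and \<open>Barred i\<close> is $\bar a_i$.\<close>

datatype letter = Plain nat | Barred nat

definition alphabet :: "nat \<Rightarrow> letter set" where
  "alphabet n = Plain ` {1..n} \<union> Barred ` {1..n}"

fun bar :: "letter \<Rightarrow> letter" where
  "bar (Plain i) = Barred i"
| "bar (Barred i) = Plain i"

definition word_bar :: "letter list \<Rightarrow> letter list" where
  "word_bar w = rev (map bar w)"

definition words :: "nat \<Rightarrow> letter list set" where
  "words n = {w. w \<noteq> [] \<and> set w \<subseteq> alphabet n}"

text \<open>A substitution with source alphabet \<open>alphabet n\<close> is a function on all letters of which only
  the values on \<open>alphabet n\<close> matter.  The second conjunct is compatibility with the bar.\<close>

definition bar_substitution :: "nat \<Rightarrow> nat \<Rightarrow> (letter \<Rightarrow> letter list) \<Rightarrow> bool" where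
  "bar_substitution n m \<phi> \<longleftrightarrow>
     (\<forall>b\<in>alphabet n. \<phi> b \<in> words m) \<and> (\<forall>b\<in>alphabet n. \<phi> (bar b) = word_bar (\<phi> b))"

definition extend :: "(letter \<Rightarrow> letter list) \<Rightarrow> letter list \<Rightarrow> letter list" where
  "extend \<phi> w = concat (map \<phi> w)"

text \<open>The index \<open>0\<close> of the sequences \<open>\<sigma>\<close>, \<open>\<tau>\<close>, \<open>p\<close>, \<open>q\<close> is not used.\<close>

definition weakly_equivalent ::
  "nat \<Rightarrow> (letter \<Rightarrow> letter list) \<Rightarrow> nat \<Rightarrow> (letter \<Rightarrow> letter list) \<Rightarrow> bool" where
  "weakly_equivalent n \<phi> m \<psi> \<longleftrightarrow>
     bar_substitution n n \<phi> \<and> bar_substitution m m \<psi> \<and>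
     (\<exists>(p :: nat \<Rightarrow> nat) (q :: nat \<Rightarrow> nat)
        (\<sigma> :: nat \<Rightarrow> letter \<Rightarrow> letter list) (\<tau> :: nat \<Rightarrow> letter \<Rightarrow> letter list).
        \<forall>i\<ge>1. 0 < p i \<and> 0 < q i \<and>
             bar_substitution m n (\<sigma> i) \<and> bar_substitution n m (\<tau> i) \<and>
             (\<forall>b\<in>alphabet n. extend (\<sigma> i) (\<tau> i b) = (extend \<phi> ^^ p i) [b]) \<and>
             (\<forall>c\<in>alphabet m. extend (\<tau> i) (\<sigma> (i + 1) c) = (extend \<psi> ^^ q i) [c]))"

subsection \<open>The substitution of a tent map with periodic critical point\<close>

text \<open>The remaining definitions are meant for \<open>s \<in> periodic_params\<close>.\<close>

definition crit_period :: "real \<Rightarrow> nat" where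
  "crit_period s = (LEAST k. 0 < k \<and> (tent s ^^ k) (crit s) = crit s)"

definition num_pieces :: "real \<Rightarrow> nat" where
  "num_pieces s = crit_period s - 1"

definition crit_orbit :: "real \<Rightarrow> real set" where
  "crit_orbit s = {(tent s ^^ k) (crit s) | k. True}"

definition orbit_point :: "real \<Rightarrow> nat \<Rightarrow> real" where
  "orbit_point s i = sorted_list_of_set (crit_orbit s) ! i"

definition piece :: "real \<Rightarrow> nat \<Rightarrow> real set" where
  "piece s i = {orbit_point s (i - 1)..orbit_point s i}"

text \<open>For \<open>i \<in> {1..num_pieces s}\<close> the pair \<open>(l, k)\<close> below exists and is unique.  Since \<open>crit s\<close> is
  one of the points \<open>orbit_point s j\<close>, the map is strictly monotone on each piece, so the
  \<open>else\<close> branch is the decreasing case.\<close>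

definition tent_image :: "real \<Rightarrow> nat \<Rightarrow> nat \<times> nat" where
  "tent_image s i = (THE (l, k). 1 \<le> l \<and> l + k \<le> num_pieces s \<and>
                        tent s ` piece s i = (\<Union>j\<in>{l..l + k}. piece s j))"

definition tent_subst_word :: "real \<Rightarrow> nat \<Rightarrow> letter list" where
  "tent_subst_word s i =
     (case tent_image s i of (l, k) \<Rightarrow>
        if strict_mono_on (piece s i) (tent s) then map Plain [l..<l + k + 1]
        else map Barred (rev [l..<l + k + 1]))"

fun tent_subst :: "real \<Rightarrow> letter \<Rightarrow> letter list" where
  "tent_subst s (Plain i) = tent_subst_word s i"
| "tent_subst s (Barred i) = word_bar (tent_subst_word s i)"

end

theory Submission
  imports Defs
begin

text \<open>
  Write \<open>X\<close> for the inverse limit of a tent map \<open>T\<close> whose critical point is periodic, and call the points of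
  the critical orbit vertices.  \<open>T\<close> permutes the vertices and turns only at one of them, so a path in \<open>X\<close>,
  seen through a fixed coordinate, changes direction only at vertices: a connected subset of \<open>X\<close> whose
  \<open>j\<close>-th coordinate avoids the vertices is mapped injectively by that coordinate
  (\<open>coordinate_inj_on_connected\<close>).  Hence the \<open>j\<close>-th coordinate of an arc in \<open>X\<close> runs through whole pieces of
  the subdivision, one after the other, and the list of pieces with their directions is a word, its
  itinerary.  Passing from the level \<open>j + 1\<close> to the level \<open>j\<close> applies the substitution of the tent map to
  the word.

  From a homeomorphism to words.  A thread all of whose coordinates are vertices is not the only common point
  of two nondegenerate continua that contain it, whereas every other thread has an arc through
  it that it cuts into two (\<open>E_no_cut\<close>, \<open>not_E_cut\<close>).  So a homeomorphism \<open>g\<close> preserves the finite set of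
  these end points.  By compactness a high coordinate of a thread determines a low coordinate of its image
  up to a small error, and coordinates near vertices go to coordinates near vertices.  An arc that
  crosses one piece at a high level is therefore sent to an arc whose itinerary at the low level depends on the piece
  only, because itineraries do not change under small perturbations (\<open>close_itin_eq\<close>).  This
  defines a substitution, and cutting an arbitrary arc into such pieces shows that its image has the
  substituted itinerary (\<open>itin_image\<close>).  Alternating between \<open>g\<close> and its inverse along a sequence of
  rapidly increasing levels gives the required ladder: the composition of two rungs codes the
  identity between two levels of one inverse limit, and this is a power of the substitution of the tent map
  (\<open>compose_words\<close>).

  From words to a homeomorphism.  A word that describes a path in the interval (a legal word) is
  traversed by some continuous piecewise monotone function, and two functions that traverse the same word differ
  by a reparametrization (\<open>traverses_reparam\<close>).  So if \<open>f\<close> realizes \<open>\<sigma>\<close> and \<open>\<sigma> \<circ> \<tau>\<close> is a power of the substitution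
  of \<open>T\<close>, then that power of \<open>T\<close> lifts through \<open>f\<close> to a function \<open>g\<close> realizing \<open>\<tau>\<close>, with
  \<open>f \<circ> g\<close> \<^emph>\<open>equal\<close> to the power of \<open>T\<close> (\<open>tent_lift\<close>).  Iterating, the ladder of substitutions becomes a
  strictly commuting ladder of interval maps, and such a ladder induces mutually inverse maps of the
  inverse limits (\<open>ladder_homeomorphic\<close>).  The lift is continuous only if the words \<open>\<tau> a\<^sub>1 \<dots> \<tau> a\<^sub>n\<close> are legal and fit
  together.  This holds because every junction \<open>a\<^sub>r a\<^bsub>r+1\<^esub>\<close> occurs in high iterates of the substitution
  (\<open>straight_eventually\<close>), so that \<open>\<tau> a\<^sub>r \<tau> a\<^bsub>r+1\<^esub>\<close> is, up to the bar, a factor of a word coming from an iterate of a tent map.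
\<close>

section \<open>Sorted lists of finite sets, and words\<close>

lemma sorted_list_eqI:
  assumes "sorted_wrt (<) l" "set l = (A::'a::linorder set)"
  shows "sorted_list_of_set A = l"
  using assms strict_sorted_equal[of "sorted_list_of_set A" l] by force

lemma sorted_list_strict_mono_image:
  fixes f :: "'a::linorder \<Rightarrow> 'b::linorder"
  assumes "finite S" "strict_mono_on S f"
  shows "sorted_list_of_set (f ` S) = map f (sorted_list_of_set S)"
proof (rule sorted_list_eqI)
  have "sorted_wrt (\<lambda>x y. f x < f y) (sorted_list_of_set S)"
    by (rule sorted_wrt_mono_rel[of _ "(<)"])
      (use assms in \<open>auto simp: monotone_on_def\<close>)
  then show "sorted_wrt (<) (map f (sorted_list_of_set S))"
    by (simp add: sorted_wrt_map)
qed (use assms in auto)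

lemma sorted_list_strict_antimono_image:
  fixes f :: "'a::linorder \<Rightarrow> 'b::linorder"
  assumes "finite S" "strict_antimono_on S f"
  shows "sorted_list_of_set (f ` S) = rev (map f (sorted_list_of_set S))"
proof (rule sorted_list_eqI)
  have "sorted_wrt (\<lambda>x y. f y < f x) (sorted_list_of_set S)"
    by (rule sorted_wrt_mono_rel[of _ "(<)"])
      (use assms in \<open>auto simp: monotone_on_def\<close>)
  then show "sorted_wrt (<) (rev (map f (sorted_list_of_set S)))"
    by (simp add: sorted_wrt_map sorted_wrt_rev)
qed (use assms in auto)

lemma sorted_list_union:
  fixes A B :: "'a::linorder set"
  assumes "finite A" "finite B" "\<And>a b. a \<in> A \<Longrightarrow> b \<in> B \<Longrightarrow> a < b"
  shows "sorted_list_of_set (A \<union> B) = sorted_list_of_set A @ sorted_list_of_set B"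
  by (rule sorted_list_eqI) (use assms in \<open>auto simp: sorted_wrt_append\<close>)

text \<open>A strictly increasing injection into a set that is no larger is onto.\<close>

lemma map_sorted_list_eq:
  fixes f :: "'a::linorder \<Rightarrow> 'b::linorder"
  assumes "finite S" "finite S'" "strict_mono_on S f" "f ` S \<subseteq> S'" "card S' \<le> card S"
    and "\<And>t. t \<in> S \<Longrightarrow> l' (f t) = l t"
  shows "map l (sorted_list_of_set S) = map l' (sorted_list_of_set S')"
proof -
  have "card (f ` S) = card S"
    using assms(3) by (simp add: card_image strict_mono_on_imp_inj_on)
  then have "f ` S = S'"
    using assms by (metis card_seteq)
  then show ?thesis
    using sorted_list_strict_mono_image[OF assms(1,3)] assms(1,6) by auto
qed

lemma strict_mono_on_less: "strict_mono_on {a..b::real} \<phi> \<Longrightarrow> a \<le> s \<Longrightarrow> s < t \<Longrightarrow> t \<le> b \<Longrightarrow> \<phi> s < (\<phi> t :: real)"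
  by (auto simp: monotone_on_def)

lemma strict_antimono_on_less: "strict_antimono_on {a..b::real} \<phi> \<Longrightarrow> a \<le> s \<Longrightarrow> s < t \<Longrightarrow> t \<le> b \<Longrightarrow> \<phi> t < (\<phi> s :: real)"
  by (auto simp: monotone_on_def)

lemma bar_bar [simp]: "bar (bar b) = b"
  by (cases b) auto

lemma word_bar_simps [simp]:
  "word_bar [] = []" "word_bar (b # w) = word_bar w @ [bar b]"
  "word_bar (u @ v) = word_bar v @ word_bar u" "word_bar (word_bar w) = w"
  by (auto simp: word_bar_def rev_map comp_def)

lemma word_bar_eq_Nil [simp]: "word_bar w = [] \<longleftrightarrow> w = []"
  by (simp add: word_bar_def)

lemma extend_simps [simp]:
  "extend \<phi> [] = []" "extend \<phi> (b # w) = \<phi> b @ extend \<phi> w"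
  "extend \<phi> (u @ v) = extend \<phi> u @ extend \<phi> v"
  by (auto simp: extend_def)

section \<open>Itineraries of functions through the pieces of a subdivision\<close>

locale subdivision =
  fixes n :: nat and x :: "nat \<Rightarrow> real"
  assumes n_pos: "0 < n" and x_0: "x 0 = 0" and x_n: "x n = 1"
    and x_less_Suc: "i < n \<Longrightarrow> x i < x (Suc i)"
begin

definition V :: "real set" where "V = x ` {0..n}"

text \<open>Crossing the midpoint of a piece serves as the witness that the piece has been traversed.\<close>

definition mid :: "nat \<Rightarrow> real" where "mid c = (x (c - 1) + x c) / 2"

definition Mid :: "real set" where "Mid = mid ` {1..n}"

text \<open>An eighth of the shortest piece: points within \<open>mesh\<close> of a vertex stay at distance at least
  \<open>3 * mesh\<close> from every midpoint, which leaves room for perturbations of size \<open>mesh\<close>.\<close>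

definition mesh :: real where "mesh = (MIN i\<in>{..<n}. x (Suc i) - x i) / 8"

definition near :: "real \<Rightarrow> real \<Rightarrow> bool" where
  "near d y \<longleftrightarrow> (\<exists>v\<in>V. \<bar>y - v\<bar> < d)"

lemma x_less: "i < j \<Longrightarrow> j \<le> n \<Longrightarrow> x i < x j"
proof (induction j)
  case (Suc j)
  then show ?case
    using x_less_Suc[of j] by (cases "i = j") auto
qed auto

lemma x_le: "i \<le> j \<Longrightarrow> j \<le> n \<Longrightarrow> x i \<le> x j"
  using x_less[of i j] by (cases "i = j") auto

lemma x_less_iff: "i \<le> n \<Longrightarrow> j \<le> n \<Longrightarrow> x i < x j \<longleftrightarrow> i < j"
  using x_less x_le by (meson linorder_not_less)

lemma x_le_iff: "i \<le> n \<Longrightarrow> j \<le> n \<Longrightarrow> x i \<le> x j \<longleftrightarrow> i \<le> j"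
  using x_less_iff[of j i] by (auto simp: not_less[symmetric])

lemma x_eq_iff: "i \<le> n \<Longrightarrow> j \<le> n \<Longrightarrow> x i = x j \<longleftrightarrow> i = j"
  using x_less_iff[of i j] x_less_iff[of j i] by force

lemma x_in [simp]: "i \<le> n \<Longrightarrow> x i \<in> V"
  by (auto simp: V_def)

lemma V_cases: "v \<in> V \<Longrightarrow> (\<And>i. i \<le> n \<Longrightarrow> v = x i \<Longrightarrow> P) \<Longrightarrow> P"
  by (auto simp: V_def)

lemma closed_V: "closed V"
  by (auto simp: V_def finite_imp_closed)

lemma V_bounds: "v \<in> V \<Longrightarrow> 0 \<le> v \<and> v \<le> 1"
  using x_le[of 0] x_le[of _ n] x_0 x_n by (auto simp: V_def)

lemma ends_in_V [simp]: "0 \<in> V" "1 \<in> V"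
  using x_in[of 0] x_in[of n] x_0 x_n by auto

lemma mesh_gap: "i < n \<Longrightarrow> x i + 8 * mesh \<le> x (Suc i)"
proof -
  assume "i < n"
  then have "(MIN i\<in>{..<n}. x (Suc i) - x i) \<le> x (Suc i) - x i"
    by (intro Min_le) auto
  then show ?thesis by (simp add: mesh_def)
qed

lemma mesh_pos: "0 < mesh"
proof -
  have "0 < (MIN i\<in>{..<n}. x (Suc i) - x i)"
    using n_pos x_less_Suc by (subst Min_gr_iff) auto
  then show ?thesis by (simp add: mesh_def)
qed

lemma mesh_piece: "c \<in> {1..n} \<Longrightarrow> x (c - 1) + 8 * mesh \<le> x c"
  using mesh_gap[of "c - 1"] by auto

lemma mid_gap: "c \<in> {1..n} \<Longrightarrow> x (c - 1) + 4 * mesh \<le> mid c \<and> mid c + 4 * mesh \<le> x c"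
  using mesh_piece[of c] by (auto simp: mid_def field_simps)

lemma piece_exists:
  assumes "0 \<le> y" "y \<le> 1" "y \<notin> V"
  obtains c where "c \<in> {1..n}" "x (c - 1) < y" "y < x c"
proof -
  define c where "c = (LEAST c. y < x c)"
  have n: "y < x n"
    using assms x_n ends_in_V(2) by (metis less_eq_real_def)
  then have c: "y < x c" unfolding c_def by (rule LeastI)
  have "c \<le> n" unfolding c_def using n by (rule Least_le)
  have "c \<noteq> 0" using c assms x_0 by (metis linorder_not_less)
  then have "\<not> y < x (c - 1)"
    unfolding c_def using not_less_Least
    by (metis One_nat_def diff_less less_one not_gr0 c_def)
  moreover have "x (c - 1) \<noteq> y"
    using \<open>c \<le> n\<close> assms(3) x_in[of "c - 1"] by auto
  ultimately show ?thesis
    using that[of c] c \<open>c \<le> n\<close> \<open>c \<noteq> 0\<close> by auto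
qed

lemma V_piece: "v \<in> V \<Longrightarrow> c \<in> {1..n} \<Longrightarrow> v \<le> x (c - 1) \<or> x c \<le> v"
  by (erule V_cases, cases c) (auto simp: x_le_iff)

lemma piece_not_V: "c \<in> {1..n} \<Longrightarrow> x (c - 1) < y \<Longrightarrow> y < x c \<Longrightarrow> y \<notin> V"
  using V_piece by force

lemma piece_unique:
  assumes "c \<in> {1..n}" "d \<in> {1..n}" "x (c - 1) < y" "y < x c" "x (d - 1) < y" "y < x d"
  shows "c = d"
proof -
  have "x (c - 1) < x d" "x (d - 1) < x c"
    using assms by linarith+
  then have "c - 1 < d" "d - 1 < c"
    using assms(1,2) by (auto simp: x_less_iff)
  then show ?thesis using assms(1,2) by auto
qed

lemma mid_inside: "c \<in> {1..n} \<Longrightarrow> x (c - 1) < mid c \<and> mid c < x c"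
  using mid_gap[of c] mesh_pos by auto

lemma mid_eq_iff: "c \<in> {1..n} \<Longrightarrow> d \<in> {1..n} \<Longrightarrow> mid c = mid d \<longleftrightarrow> c = d"
  using piece_unique[of c d "mid c"] mid_inside[of c] mid_inside[of d] by auto

lemma near_V [simp]: "v \<in> V \<Longrightarrow> 0 < d \<Longrightarrow> near d v"
  unfolding near_def by force

lemma near_mono: "near d y \<Longrightarrow> d \<le> e \<Longrightarrow> near e y"
  unfolding near_def by force

lemma near_piece:
  assumes "near d y" "c \<in> {1..n}" "x (c - 1) \<le> y" "y \<le> x c"
  shows "y < x (c - 1) + d \<or> x c - d < y"
proof -
  obtain v where v: "v \<in> V" "\<bar>y - v\<bar> < d"
    using assms(1) by (auto simp: near_def)
  show ?thesis using V_piece[OF v(1) assms(2)] v(2) assms(3,4) by linarith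
qed

lemma near_not_Mid:
  assumes "near d y" "d \<le> mesh"
  shows "y \<notin> Mid"
proof
  assume "y \<in> Mid"
  then obtain c where c: "c \<in> {1..n}" "y = mid c" by (auto simp: Mid_def)
  show False
    using near_piece[OF assms(1) c(1)] mid_gap[OF c(1)] mid_inside[OF c(1)] c(2) assms(2) mesh_pos
    by auto
qed

lemma Mid_not_V: "y \<in> Mid \<Longrightarrow> y \<notin> V"
  using near_not_Mid[of mesh y] mesh_pos by auto

lemma finite_Mid: "finite Mid" by (simp add: Mid_def)

text \<open>Direction can change only where the value is a vertex.  The coordinates of arcs in the inverse
  limit have this property.  The values at the ends of the domain need not be vertices.\<close>

definition turning :: "(real \<Rightarrow> real) \<Rightarrow> real \<Rightarrow> real \<Rightarrow> bool" where
  "turning \<phi> a b \<longleftrightarrow> continuous_on {a..b} \<phi> \<and> \<phi> ` {a..b} \<subseteq> {0..1} \<and>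
     (\<forall>u v. a \<le> u \<longrightarrow> v \<le> b \<longrightarrow> (\<forall>t\<in>{u..v}. \<phi> t \<notin> V) \<longrightarrow> inj_on \<phi> {u..v})"

definition crossings :: "(real \<Rightarrow> real) \<Rightarrow> real \<Rightarrow> real \<Rightarrow> real set" where
  "crossings \<phi> a b = {t \<in> {a..b}. \<phi> t \<in> Mid}"

text \<open>The direction of a crossing is read off to the right of \<open>t\<close> only, so that the letter is a
  property of the germ of \<open>\<phi>\<close> and does not depend on an ambient interval.\<close>

definition letter_at :: "(real \<Rightarrow> real) \<Rightarrow> real \<Rightarrow> letter" where
  "letter_at \<phi> t =
     (let c = (THE c. c \<in> {1..n} \<and> \<phi> t = mid c)
      in if \<exists>d>0. \<forall>u\<in>{t<..<t + d}. \<phi> t < \<phi> u then Plain c else Barred c)"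

definition itin :: "(real \<Rightarrow> real) \<Rightarrow> real \<Rightarrow> real \<Rightarrow> letter list" where
  "itin \<phi> a b = map (letter_at \<phi>) (sorted_list_of_set (crossings \<phi> a b))"

lemma turning_subinterval: "turning \<phi> a b \<Longrightarrow> a \<le> a' \<Longrightarrow> b' \<le> b \<Longrightarrow> turning \<phi> a' b'"
  unfolding turning_def
  by (meson atLeastatMost_subset_iff continuous_on_subset image_mono order_trans)

lemma letter_at_up:
  assumes "c \<in> {1..n}" "\<phi> t = mid c" "t < s" "\<And>u. t < u \<Longrightarrow> u < s \<Longrightarrow> mid c < \<phi> u"
  shows "letter_at \<phi> t = Plain c"
proof -
  have "(THE c. c \<in> {1..n} \<and> \<phi> t = mid c) = c"
    using assms mid_eq_iff by (intro the_equality) auto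
  moreover have "\<exists>d>0. \<forall>u\<in>{t<..<t + d}. \<phi> t < \<phi> u"
    by (rule exI[of _ "s - t"]) (use assms in auto)
  ultimately show ?thesis by (simp add: letter_at_def)
qed

lemma letter_at_down:
  assumes "c \<in> {1..n}" "\<phi> t = mid c" "t < s" "\<And>u. t < u \<Longrightarrow> u < s \<Longrightarrow> \<phi> u < mid c"
  shows "letter_at \<phi> t = Barred c"
proof -
  have "(THE c. c \<in> {1..n} \<and> \<phi> t = mid c) = c"
    using assms mid_eq_iff by (intro the_equality) auto
  moreover have "\<not> (\<exists>d>0. \<forall>u\<in>{t<..<t + d}. \<phi> t < \<phi> u)"
  proof
    assume "\<exists>d>0. \<forall>u\<in>{t<..<t + d}. \<phi> t < \<phi> u"
    then obtain d where d: "d > 0" "\<And>u. u \<in> {t<..<t + d} \<Longrightarrow> \<phi> t < \<phi> u" by auto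
    define u where "u = t + min d (s - t) / 2"
    have "t < u" "u < s" "u < t + d" using d assms(3) by (auto simp: u_def min_def field_simps)
    then show False using d(2)[of u] assms(4)[of u] assms(2) by auto
  qed
  ultimately show ?thesis by (simp add: letter_at_def)
qed

text \<open>Around a parameter where \<open>\<phi>\<close> avoids the vertices, extend to the nearest vertex on either side, or to the end
  of the domain.  In between \<open>\<phi>\<close> is injective and stays inside one piece, hence is strictly monotone.\<close>

lemma maximal_run:
  assumes tu: "turning \<phi> a b" and t: "t \<in> {a..b}" "\<phi> t \<notin> V"
  obtains \<alpha> \<beta> c where "a \<le> \<alpha>" "\<alpha> \<le> t" "t \<le> \<beta>" "\<beta> \<le> b" "\<alpha> = a \<or> \<phi> \<alpha> \<in> V \<and> \<alpha> < t" "\<beta> = b \<or> \<phi> \<beta> \<in> V \<and> t < \<beta>"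
    "c \<in> {1..n}" "\<forall>u\<in>{\<alpha><..<\<beta>}. x (c - 1) < \<phi> u \<and> \<phi> u < x c"
    "\<forall>u\<in>{\<alpha>..\<beta>}. x (c - 1) \<le> \<phi> u \<and> \<phi> u \<le> x c"
    "x (c - 1) < \<phi> t" "\<phi> t < x c"
    "strict_mono_on {\<alpha>..\<beta>} \<phi> \<or> strict_antimono_on {\<alpha>..\<beta>} \<phi>"
proof -
  have cont: "continuous_on {a..b} \<phi>" and rng: "\<phi> ` {a..b} \<subseteq> {0..1}"
    using tu by (auto simp: turning_def)
  obtain c where c: "c \<in> {1..n}" "x (c - 1) < \<phi> t" "\<phi> t < x c"
  proof -
    have "0 \<le> \<phi> t" "\<phi> t \<le> 1" using rng t(1) by (auto simp: image_subset_iff)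
    then show ?thesis using piece_exists[OF _ _ t(2)] that by blast
  qed
  have closed_pre: "closed {u \<in> {p..q}. \<phi> u \<in> V}" if "a \<le> p" "q \<le> b" for p q
  proof -
    have "continuous_on {p..q} \<phi>"
      using cont that by (meson atLeastatMost_subset_iff continuous_on_subset)
    then have "closed ({p..q} \<inter> \<phi> -` V)"
      using closed_V by (intro continuous_closed_preimage) auto
    moreover have "{p..q} \<inter> \<phi> -` V = {u \<in> {p..q}. \<phi> u \<in> V}" by auto
    ultimately show ?thesis by simp
  qed
  define A where "A = {u \<in> {a..t}. \<phi> u \<in> V}"
  define B where "B = {u \<in> {t..b}. \<phi> u \<in> V}"
  define \<alpha> where "\<alpha> = (if A = {} then a else Sup A)"
  define \<beta> where "\<beta> = (if B = {} then b else Inf B)"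
  have bA: "bdd_above A" and bB: "bdd_below B"
    unfolding A_def B_def by (auto intro!: bdd_aboveI[of _ t] bdd_belowI[of _ t])
  have supA: "A \<noteq> {} \<Longrightarrow> Sup A \<in> A"
    using closed_contains_Sup[OF _ bA] closed_pre[of a t] t unfolding A_def by auto
  have infB: "B \<noteq> {} \<Longrightarrow> Inf B \<in> B"
    using closed_contains_Inf[OF _ bB] closed_pre[of t b] t unfolding B_def by auto
  have supA': "a \<le> Sup A \<and> Sup A < t \<and> \<phi> (Sup A) \<in> V" if "A \<noteq> {}"
  proof -
    have "a \<le> Sup A" "Sup A \<le> t" "\<phi> (Sup A) \<in> V" using supA[OF that] unfolding A_def by auto
    then show ?thesis using t(2) by (metis less_le)
  qed
  have infB': "t < Inf B \<and> Inf B \<le> b \<and> \<phi> (Inf B) \<in> V" if "B \<noteq> {}"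
  proof -
    have "t \<le> Inf B" "Inf B \<le> b" "\<phi> (Inf B) \<in> V" using infB[OF that] unfolding B_def by auto
    then show ?thesis using t(2) by (metis less_le)
  qed
  have al: "a \<le> \<alpha>" "\<alpha> \<le> t" "\<alpha> = a \<or> \<phi> \<alpha> \<in> V \<and> \<alpha> < t"
    using supA' t(1) unfolding \<alpha>_def by (cases "A = {}"; simp)+
  have be: "\<beta> \<le> b" "t \<le> \<beta>" "\<beta> = b \<or> \<phi> \<beta> \<in> V \<and> t < \<beta>"
    using infB' t(1) unfolding \<beta>_def by (cases "B = {}"; simp)+
  have noV: "\<phi> u \<notin> V" if "\<alpha> < u" "u < \<beta>" for u
  proof
    assume V: "\<phi> u \<in> V"
    show False
    proof (cases "u \<le> t")
      case True
      then have "u \<in> A" using V that al by (auto simp: A_def)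
      then show False using cSup_upper[OF _ bA, of u] that by (auto simp: \<alpha>_def split: if_splits)
    next
      case False
      then have "u \<in> B" using V that be by (auto simp: B_def)
      then show False using cInf_lower[OF _ bB, of u] that by (auto simp: \<beta>_def split: if_splits)
    qed
  qed
  have noV': "\<phi> u \<notin> V" if "min u0 t \<le> u" "u \<le> max u0 t" "\<alpha> < u0" "u0 < \<beta>" for u u0
    using noV[of u] that t al be by (cases "u = t") (auto simp: min_def max_def split: if_splits)
  have cont': "continuous_on {\<alpha>..\<beta>} \<phi>"
    using cont al be by (meson atLeastatMost_subset_iff continuous_on_subset)
  have inside: "x (c - 1) < \<phi> u \<and> \<phi> u < x c" if u: "\<alpha> < u" "u < \<beta>" for u
  proof (rule ccontr)
    assume neg: "\<not> (x (c - 1) < \<phi> u \<and> \<phi> u < x c)"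
    have img: "connected (\<phi> ` {min u t..max u t})"
      using al be u t by (intro connected_continuous_image continuous_on_subset[OF cont]) (auto simp: min_def max_def)
    have mem: "\<phi> u \<in> \<phi> ` {min u t..max u t}" "\<phi> t \<in> \<phi> ` {min u t..max u t}"
      by (auto intro!: imageI simp: min_def max_def)
    have "x (c - 1) \<in> \<phi> ` {min u t..max u t} \<or> x c \<in> \<phi> ` {min u t..max u t}"
      using neg c connectedD_interval[OF img mem] connectedD_interval[OF img mem(2) mem(1)]
      by (meson less_eq_real_def linorder_not_less)
    then obtain r where "min u t \<le> r" "r \<le> max u t" "\<phi> r = x (c - 1) \<or> \<phi> r = x c" by auto
    moreover have "x (c - 1) \<in> V" "x c \<in> V" using c(1) by auto
    ultimately show False using noV'[of u r] u by auto
  qed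
  have inside': "x (c - 1) \<le> \<phi> u \<and> \<phi> u \<le> x c" if u: "\<alpha> \<le> u" "u \<le> \<beta>" for u
  proof (cases "\<alpha> < \<beta>")
    case True
    have cl: "closure {\<alpha><..<\<beta>} = {\<alpha>..\<beta>}" using True by simp
    have "\<phi> ` closure {\<alpha><..<\<beta>} \<subseteq> {x (c - 1)..x c}"
      by (rule image_closure_subset) (use cont' cl inside in \<open>auto simp: less_imp_le\<close>)
    then show ?thesis using u cl by (auto simp: image_subset_iff)
  next
    case False
    then have "u = t" using u al be by auto
    then show ?thesis using c by auto
  qed
  have inj_open: "inj_on \<phi> {\<alpha><..<\<beta>}"
  proof (rule inj_onI)
    fix p q assume pq: "p \<in> {\<alpha><..<\<beta>}" "q \<in> {\<alpha><..<\<beta>}" "\<phi> p = \<phi> q"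
    have "inj_on \<phi> {min p q..max p q}"
      using tu pq al be noV unfolding turning_def
      by (elim conjE allE[of _ "min p q"] allE[of _ "max p q"]) (auto simp: min_def max_def)
    then show "p = q" using pq(3) by (auto dest: inj_onD simp: min_def max_def split: if_splits)
  qed
  have open_mono: "strict_mono_on {\<alpha><..<\<beta>} \<phi> \<or> strict_antimono_on {\<alpha><..<\<beta>} \<phi>"
    using injective_eq_monotone_map[of "{\<alpha><..<\<beta>}" \<phi>] inj_open
      continuous_on_subset[OF cont', of "{\<alpha><..<\<beta>}"] by (simp add: is_interval_oo greaterThanLessThan_subseteq_atLeastAtMost_iff)
  have closed_mono: "strict_mono_on {\<alpha>..\<beta>} \<psi>"
    if m: "strict_mono_on {\<alpha><..<\<beta>} \<psi>" and ct: "continuous_on {\<alpha>..\<beta>} \<psi>" for \<psi> :: "real \<Rightarrow> real"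
  proof (cases "\<alpha> < \<beta>")
    case True
    have low: "\<psi> \<alpha> \<le> \<psi> u" if "\<alpha> < u" "u < \<beta>" for u
    proof -
      have "\<psi> ` closure {\<alpha><..<u} \<subseteq> {..\<psi> u}"
        by (rule image_closure_subset)
          (use that m in \<open>auto intro!: continuous_on_subset[OF ct] simp: monotone_on_def less_imp_le\<close>)
      then show ?thesis using that by (auto simp: image_subset_iff)
    qed
    have up: "\<psi> u \<le> \<psi> \<beta>" if "\<alpha> < u" "u < \<beta>" for u
    proof -
      have "\<psi> ` closure {u<..<\<beta>} \<subseteq> {\<psi> u..}"
        by (rule image_closure_subset)
          (use that m in \<open>auto intro!: continuous_on_subset[OF ct] simp: monotone_on_def less_imp_le\<close>)
      then show ?thesis using that by (auto simp: image_subset_iff)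
    qed
    show ?thesis
    proof (rule monotone_onI)
      fix p q assume pq: "p \<in> {\<alpha>..\<beta>}" "q \<in> {\<alpha>..\<beta>}" "p < q"
      define r1 r2 where "r1 = (2 * p + q) / 3" and "r2 = (p + 2 * q) / 3"
      have r: "p < r1" "r1 < r2" "r2 < q" using pq by (auto simp: r1_def r2_def)
      have "\<psi> p \<le> \<psi> r1" using low[of r1] m r pq by (cases "p = \<alpha>") (auto simp: monotone_on_def less_imp_le)
      also have "\<psi> r1 < \<psi> r2" using m r pq by (auto simp: monotone_on_def)
      also have "\<psi> r2 \<le> \<psi> q" using up[of r2] m r pq by (cases "q = \<beta>") (auto simp: monotone_on_def less_imp_le)
      finally show "\<psi> p < \<psi> q" .
    qed
  next
    case False
    then show ?thesis by (auto simp: monotone_on_def)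
  qed
  from open_mono have "strict_mono_on {\<alpha>..\<beta>} \<phi> \<or> strict_antimono_on {\<alpha>..\<beta>} \<phi>"
  proof
    assume "strict_antimono_on {\<alpha><..<\<beta>} \<phi>"
    then have "strict_mono_on {\<alpha>..\<beta>} (\<lambda>t. - \<phi> t)"
      by (intro closed_mono continuous_on_minus cont') (auto simp: monotone_on_def)
    then show ?thesis by (auto simp: monotone_on_def)
  qed (use closed_mono cont' in auto)
  then show ?thesis
    using that[of \<alpha> \<beta> c] al be c inside inside' by auto
qed

text \<open>An accumulation point of crossings would be a crossing itself, but the run through it contains no
  other crossing.\<close>

lemma finite_crossings:
  assumes tu: "turning \<phi> a b"
  shows "finite (crossings \<phi> a b)"
proof (rule ccontr)
  assume inf: "infinite (crossings \<phi> a b)"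
  have cont: "continuous_on {a..b} \<phi>" using tu by (auto simp: turning_def)
  have sub: "crossings \<phi> a b \<subseteq> {a..b}" by (auto simp: crossings_def)
  obtain p where p: "p \<in> {a..b}" "p islimpt crossings \<phi> a b"
    using Heine_Borel_imp_Bolzano_Weierstrass[of "{a..b}" "crossings \<phi> a b"] inf sub by auto
  have "closed ({a..b} \<inter> \<phi> -` Mid)"
    using cont finite_imp_closed[OF finite_Mid] by (intro continuous_closed_preimage) auto
  moreover have "{a..b} \<inter> \<phi> -` Mid = crossings \<phi> a b" by (auto simp: crossings_def)
  ultimately have pS: "p \<in> crossings \<phi> a b"
    using p(2) closed_limpt by auto
  then have pM: "\<phi> p \<in> Mid" by (auto simp: crossings_def)
  obtain \<alpha> \<beta> c where r: "a \<le> \<alpha>" "\<alpha> \<le> p" "p \<le> \<beta>" "\<beta> \<le> b" "\<alpha> = a \<or> \<phi> \<alpha> \<in> V \<and> \<alpha> < p" "\<beta> = b \<or> \<phi> \<beta> \<in> V \<and> p < \<beta>"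
    "c \<in> {1..n}" "\<forall>u\<in>{\<alpha>..\<beta>}. x (c - 1) \<le> \<phi> u \<and> \<phi> u \<le> x c"
    "strict_mono_on {\<alpha>..\<beta>} \<phi> \<or> strict_antimono_on {\<alpha>..\<beta>} \<phi>"
    using maximal_run[OF tu p(1) Mid_not_V[OF pM]] by metis
  have only: "\<phi> u = mid c" if u: "\<alpha> \<le> u" "u \<le> \<beta>" "u \<in> crossings \<phi> a b" for u
  proof -
    obtain d where d: "d \<in> {1..n}" "\<phi> u = mid d"
      using u(3) by (auto simp: crossings_def Mid_def)
    have "x (c - 1) \<le> mid d" "mid d \<le> x c" using bspec[OF r(8), of u] u d by auto
    moreover have "mid d \<notin> V" using d Mid_not_V by (auto simp: Mid_def)
    ultimately have "x (c - 1) < mid d" "mid d < x c"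
      using r(7) x_in[of c] x_in[of "c - 1"] by (metis (no_types, lifting) atLeastAtMost_iff diff_le_self less_le order_trans)+
    then have "c = d" using piece_unique[of c d "mid d"] mid_inside[OF d(1)] d r(7) by auto
    then show ?thesis using d by simp
  qed
  have uniq: "u = p" if "\<alpha> \<le> u" "u \<le> \<beta>" "u \<in> crossings \<phi> a b" for u
  proof -
    have "inj_on \<phi> {\<alpha>..\<beta>}"
      using r(9) injective_eq_monotone_map[of "{\<alpha>..\<beta>}" \<phi>] continuous_on_subset[OF cont, of "{\<alpha>..\<beta>}"] r
      by (auto simp: is_interval_cc)
    then show ?thesis
      using only[of u] only[of p] inj_onD[of \<phi> "{\<alpha>..\<beta>}" u p] that r(2,3) pS by auto
  qed
  obtain e where e: "e > 0" "{p - e<..<p + e} \<inter> {a..b} \<subseteq> {\<alpha>..\<beta>}"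
  proof
    define e where "e = min (if \<alpha> = a then 1 else p - \<alpha>) (if \<beta> = b then 1 else \<beta> - p)"
    show "e > 0" "{p - e<..<p + e} \<inter> {a..b} \<subseteq> {\<alpha>..\<beta>}"
      using r(1-6) by (auto simp: e_def min_def split: if_splits)
  qed
  then obtain u where "u \<in> crossings \<phi> a b" "u \<noteq> p" "\<bar>u - p\<bar> < e"
    using p(2) islimpt_approachable_real by metis
  moreover from this have "u \<in> {p - e<..<p + e} \<inter> {a..b}" using sub by (auto simp: abs_less_iff)
  ultimately show False using uniq[of u] e(2) by auto
qed

text \<open>When the ends of the domain are near vertices, the run through a crossing goes from near one
  vertex of the piece to near the other.\<close>

lemma crossing_run:
  assumes tu: "turning \<phi> a b" and ends: "near mesh (\<phi> a)" "near mesh (\<phi> b)"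
    and t: "t \<in> crossings \<phi> a b"
  obtains \<alpha> \<beta> c where "a \<le> \<alpha>" "\<alpha> < t" "t < \<beta>" "\<beta> \<le> b" "\<alpha> = a \<or> \<phi> \<alpha> \<in> V" "\<beta> = b \<or> \<phi> \<beta> \<in> V"
    "c \<in> {1..n}" "\<phi> t = mid c"
    "\<forall>u\<in>{\<alpha><..<\<beta>}. x (c - 1) < \<phi> u \<and> \<phi> u < x c"
    "\<forall>u\<in>{\<alpha>..\<beta>}. x (c - 1) \<le> \<phi> u \<and> \<phi> u \<le> x c"
    "strict_mono_on {\<alpha>..\<beta>} \<phi> \<and> \<phi> \<alpha> < x (c - 1) + mesh \<and> x c - mesh < \<phi> \<beta> \<and> letter_at \<phi> t = Plain c \<or>
     strict_antimono_on {\<alpha>..\<beta>} \<phi> \<and> \<phi> \<beta> < x (c - 1) + mesh \<and> x c - mesh < \<phi> \<alpha> \<and> letter_at \<phi> t = Barred c"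
proof -
  have tab: "t \<in> {a..b}" "\<phi> t \<in> Mid" using t by (auto simp: crossings_def)
  obtain \<alpha> \<beta> c where r: "a \<le> \<alpha>" "\<alpha> \<le> t" "t \<le> \<beta>" "\<beta> \<le> b" "\<alpha> = a \<or> \<phi> \<alpha> \<in> V \<and> \<alpha> < t" "\<beta> = b \<or> \<phi> \<beta> \<in> V \<and> t < \<beta>"
    "c \<in> {1..n}" "\<forall>u\<in>{\<alpha><..<\<beta>}. x (c - 1) < \<phi> u \<and> \<phi> u < x c"
    "\<forall>u\<in>{\<alpha>..\<beta>}. x (c - 1) \<le> \<phi> u \<and> \<phi> u \<le> x c"
    "x (c - 1) < \<phi> t" "\<phi> t < x c"
    "strict_mono_on {\<alpha>..\<beta>} \<phi> \<or> strict_antimono_on {\<alpha>..\<beta>} \<phi>"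
    by (rule maximal_run[OF tu tab(1) Mid_not_V[OF tab(2)]]) (rule that)
  have near_ends: "near mesh (\<phi> \<alpha>)" "near mesh (\<phi> \<beta>)"
    using r(5,6) ends mesh_pos by auto
  have "\<alpha> \<noteq> t" "\<beta> \<noteq> t" using near_ends near_not_Mid[of mesh] tab by auto
  then have lt: "\<alpha> < t" "t < \<beta>" using r by auto
  obtain d where d: "d \<in> {1..n}" "\<phi> t = mid d" using tab by (auto simp: Mid_def)
  have "c = d" using piece_unique[of c d "mid d"] mid_inside[of d] d r by auto
  then have tc: "\<phi> t = mid c" using d by simp
  have ne: "\<phi> \<alpha> < x (c - 1) + mesh \<or> x c - mesh < \<phi> \<alpha>" "\<phi> \<beta> < x (c - 1) + mesh \<or> x c - mesh < \<phi> \<beta>"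
    using near_piece[OF near_ends(1) r(7)] near_piece[OF near_ends(2) r(7)] bspec[OF r(9), of \<alpha>] bspec[OF r(9), of \<beta>] lt by auto
  note mg = mid_gap[OF r(7)] mesh_pos
  from r(12) have "strict_mono_on {\<alpha>..\<beta>} \<phi> \<and> \<phi> \<alpha> < x (c - 1) + mesh \<and> x c - mesh < \<phi> \<beta> \<and> letter_at \<phi> t = Plain c \<or>
     strict_antimono_on {\<alpha>..\<beta>} \<phi> \<and> \<phi> \<beta> < x (c - 1) + mesh \<and> x c - mesh < \<phi> \<alpha> \<and> letter_at \<phi> t = Barred c"
  proof
    assume m: "strict_mono_on {\<alpha>..\<beta>} \<phi>"
    have "\<phi> \<alpha> < mid c" "mid c < \<phi> \<beta>"
      using monotone_onD[OF m, of \<alpha> t] monotone_onD[OF m, of t \<beta>] lt tc by auto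
    moreover have "letter_at \<phi> t = Plain c"
      by (rule letter_at_up[of _ _ _ \<beta>]) (use r(7) tc lt strict_mono_on_less[of \<alpha> \<beta> \<phi> t] strict_antimono_on_less[of \<alpha> \<beta> \<phi> t] m in auto)
    ultimately show ?thesis using m ne mg by auto
  next
    assume m: "strict_antimono_on {\<alpha>..\<beta>} \<phi>"
    have "\<phi> \<beta> < mid c" "mid c < \<phi> \<alpha>"
      using monotone_onD[OF m, of \<alpha> t] monotone_onD[OF m, of t \<beta>] lt tc by auto
    moreover have "letter_at \<phi> t = Barred c"
      by (rule letter_at_down[of _ _ _ \<beta>]) (use r(7) tc lt strict_mono_on_less[of \<alpha> \<beta> \<phi> t] strict_antimono_on_less[of \<alpha> \<beta> \<phi> t] m in auto)
    ultimately show ?thesis using m ne mg by auto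
  qed
  then show ?thesis using that[of \<alpha> \<beta> c] r lt tc by auto
qed

end

context subdivision begin

lemma itin_split:
  assumes "finite (crossings \<phi> a b)" "a \<le> m" "m \<le> b" "\<phi> m \<notin> Mid"
  shows "itin \<phi> a b = itin \<phi> a m @ itin \<phi> m b"
proof -
  have eq: "crossings \<phi> a b = crossings \<phi> a m \<union> crossings \<phi> m b"
    using assms by (auto simp: crossings_def)
  have "sorted_list_of_set (crossings \<phi> a b)
      = sorted_list_of_set (crossings \<phi> a m) @ sorted_list_of_set (crossings \<phi> m b)"
    unfolding eq
  proof (rule sorted_list_union)
    show "finite (crossings \<phi> a m)" "finite (crossings \<phi> m b)" using assms(1) eq by auto
    fix s t assume "s \<in> crossings \<phi> a m" "t \<in> crossings \<phi> m b"
    then have "s \<le> m" "m \<le> t" "s \<noteq> m" "t \<noteq> m" using assms(4) by (auto simp: crossings_def)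
    then show "s < t" by auto
  qed
  then show ?thesis by (simp add: itin_def)
qed

lemma itin_Nil: "finite (crossings \<phi> a b) \<Longrightarrow> itin \<phi> a b = [] \<longleftrightarrow> crossings \<phi> a b = {}"
  by (simp add: itin_def)

lemma itin_eq_NilI:
  assumes "\<And>t. a \<le> t \<Longrightarrow> t \<le> b \<Longrightarrow> \<phi> t \<notin> Mid"
  shows "itin \<phi> a b = []"
proof -
  have "crossings \<phi> a b = {}" using assms by (auto simp: crossings_def)
  then show ?thesis by (simp add: itin_def)
qed

lemma crossing_direction:
  assumes tu: "turning \<phi> a b" and ends: "near mesh (\<phi> a)" "near mesh (\<phi> b)"
    and t: "t \<in> crossings \<phi> a b"
  obtains \<alpha> \<beta> c where "a \<le> \<alpha>" "\<alpha> < t" "t < \<beta>" "\<beta> \<le> b" "c \<in> {1..n}" "\<phi> t = mid c"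
    "strict_mono_on {\<alpha>..\<beta>} \<phi> \<and> letter_at \<phi> t = Plain c \<or>
     strict_antimono_on {\<alpha>..\<beta>} \<phi> \<and> letter_at \<phi> t = Barred c"
proof (rule crossing_run[OF assms])
  fix \<alpha> \<beta> c
  assume "a \<le> \<alpha>" "\<alpha> < t" "t < \<beta>" "\<beta> \<le> b" "c \<in> {1..n}" "\<phi> t = mid c"
    "strict_mono_on {\<alpha>..\<beta>} \<phi> \<and> \<phi> \<alpha> < x (c - 1) + mesh \<and> x c - mesh < \<phi> \<beta> \<and> letter_at \<phi> t = Plain c \<or>
     strict_antimono_on {\<alpha>..\<beta>} \<phi> \<and> \<phi> \<beta> < x (c - 1) + mesh \<and> x c - mesh < \<phi> \<alpha> \<and> letter_at \<phi> t = Barred c"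
  then show ?thesis using that[of \<alpha> \<beta> c] by auto
qed

lemma itin_single: "crossings \<phi> a b = {t} \<Longrightarrow> itin \<phi> a b = [letter_at \<phi> t]"
  by (simp add: itin_def)

lemma letter_at_cong:
  assumes "t < s" "\<And>u. t \<le> u \<Longrightarrow> u < s \<Longrightarrow> \<phi> u = \<psi> u" "\<phi> t \<in> Mid"
    and dich: "(\<forall>u. t < u \<and> u < s \<longrightarrow> \<phi> t < \<phi> u) \<or> (\<forall>u. t < u \<and> u < s \<longrightarrow> \<phi> u < \<phi> t)"
  shows "letter_at \<phi> t = letter_at \<psi> t"
proof -
  obtain c where c: "c \<in> {1..n}" "\<phi> t = mid c" using assms(3) by (auto simp: Mid_def)
  have c': "\<psi> t = mid c" using assms(1) assms(2)[of t] c by auto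
  from dich show ?thesis
  proof
    assume up: "\<forall>u. t < u \<and> u < s \<longrightarrow> \<phi> t < \<phi> u"
    have "letter_at \<phi> t = Plain c" by (rule letter_at_up[of c \<phi> t s, OF c assms(1)]) (use up c in auto)
    moreover have "letter_at \<psi> t = Plain c"
      by (rule letter_at_up[of c \<psi> t s, OF c(1) c' assms(1)]) (use up c assms(2)[symmetric] in auto)
    ultimately show ?thesis by simp
  next
    assume down: "\<forall>u. t < u \<and> u < s \<longrightarrow> \<phi> u < \<phi> t"
    have "letter_at \<phi> t = Barred c" by (rule letter_at_down[of c \<phi> t s, OF c assms(1)]) (use down c in auto)
    moreover have "letter_at \<psi> t = Barred c"
      by (rule letter_at_down[of c \<psi> t s, OF c(1) c' assms(1)]) (use down c assms(2)[symmetric] in auto)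
    ultimately show ?thesis by simp
  qed
qed

text \<open>\<open>letter_at\<close> looks at parameters beyond \<open>t\<close>, where equality on \<open>{a..b}\<close> has to be combined
  with the monotonicity of the run through \<open>t\<close>.\<close>

lemma itin_cong_turning:
  assumes tu: "turning \<phi> a b" and ends: "near mesh (\<phi> a)" "near mesh (\<phi> b)"
    and eq: "\<And>t. a \<le> t \<Longrightarrow> t \<le> b \<Longrightarrow> \<phi> t = \<psi> t"
  shows "itin \<phi> a b = itin \<psi> a b"
proof -
  have "crossings \<phi> a b = crossings \<psi> a b" using eq by (auto simp: crossings_def)
  moreover have "letter_at \<phi> t = letter_at \<psi> t" if t: "t \<in> crossings \<phi> a b" for t
  proof -
    obtain \<alpha> \<beta> c where r: "a \<le> \<alpha>" "\<alpha> < t" "t < \<beta>" "\<beta> \<le> b" "c \<in> {1..n}" "\<phi> t = mid c"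
      "strict_mono_on {\<alpha>..\<beta>} \<phi> \<and> letter_at \<phi> t = Plain c \<or>
       strict_antimono_on {\<alpha>..\<beta>} \<phi> \<and> letter_at \<phi> t = Barred c"
      by (rule crossing_direction[OF tu ends t]) (rule that)
    show ?thesis
      by (rule letter_at_cong[of t \<beta>])
        (use r t eq strict_mono_on_less[of \<alpha> \<beta> \<phi> t] strict_antimono_on_less[of \<alpha> \<beta> \<phi> t] in \<open>auto simp: crossings_def\<close>)
  qed
  ultimately show ?thesis
    using finite_crossings[OF tu] by (auto simp: itin_def)
qed

text \<open>On the run through a crossing of \<open>\<phi>\<close>, the nearby function \<open>\<psi>\<close> passes from one side of the midpoint to the
  other, so it crosses the midpoint, the last time in the same direction as \<open>\<phi>\<close>.  Distinct crossings of
  \<open>\<phi>\<close> have disjoint runs, whence the assignment is strictly increasing.\<close>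

lemma close_itin_le:
  assumes tu: "turning \<phi> a b" "turning \<psi> a b"
    and ends: "near mesh (\<phi> a)" "near mesh (\<phi> b)"
    and close: "\<And>t. a \<le> t \<Longrightarrow> t \<le> b \<Longrightarrow> \<bar>\<phi> t - \<psi> t\<bar> < mesh"
  obtains f where "strict_mono_on (crossings \<phi> a b) f" "f ` crossings \<phi> a b \<subseteq> crossings \<psi> a b"
    "\<forall>t\<in>crossings \<phi> a b. letter_at \<psi> (f t) = letter_at \<phi> t"
proof -
  have cont: "continuous_on {a..b} \<psi>" using tu by (auto simp: turning_def)
  have "\<forall>t\<in>crossings \<phi> a b. \<exists>\<alpha> \<beta> t'. a \<le> \<alpha> \<and> \<alpha> < t \<and> t < \<beta> \<and> \<beta> \<le> b \<and> \<alpha> < t' \<and> t' < \<beta> \<and>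
      t' \<in> crossings \<psi> a b \<and> letter_at \<psi> t' = letter_at \<phi> t \<and>
      (\<forall>u\<in>{\<alpha><..<\<beta>}. \<phi> u \<notin> V \<and> (u \<in> crossings \<phi> a b \<longrightarrow> u = t)) \<and>
      (\<alpha> = a \<or> \<phi> \<alpha> \<in> V) \<and> (\<beta> = b \<or> \<phi> \<beta> \<in> V)"
  proof
    fix t assume t: "t \<in> crossings \<phi> a b"
    obtain \<alpha> \<beta> c where r: "a \<le> \<alpha>" "\<alpha> < t" "t < \<beta>" "\<beta> \<le> b" "\<alpha> = a \<or> \<phi> \<alpha> \<in> V" "\<beta> = b \<or> \<phi> \<beta> \<in> V"
      "c \<in> {1..n}" "\<phi> t = mid c"
      "\<forall>u\<in>{\<alpha><..<\<beta>}. x (c - 1) < \<phi> u \<and> \<phi> u < x c"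
      "\<forall>u\<in>{\<alpha>..\<beta>}. x (c - 1) \<le> \<phi> u \<and> \<phi> u \<le> x c"
      "strict_mono_on {\<alpha>..\<beta>} \<phi> \<and> \<phi> \<alpha> < x (c - 1) + mesh \<and> x c - mesh < \<phi> \<beta> \<and> letter_at \<phi> t = Plain c \<or>
       strict_antimono_on {\<alpha>..\<beta>} \<phi> \<and> \<phi> \<beta> < x (c - 1) + mesh \<and> x c - mesh < \<phi> \<alpha> \<and> letter_at \<phi> t = Barred c"
      by (rule crossing_run[OF tu(1) ends t]) (rule that)
    have "mid c \<in> Mid" using r(7) by (auto simp: Mid_def)
    have cont': "continuous_on {\<alpha>..\<beta>} \<psi>" by (rule continuous_on_subset[OF cont]) (use r(1,4) in auto)
    have noV: "\<forall>u\<in>{\<alpha><..<\<beta>}. \<phi> u \<notin> V" using r(9) piece_not_V[OF r(7)] by blast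
    have inj: "inj_on \<phi> {\<alpha>..\<beta>}"
      using r(11) strict_mono_on_imp_inj_on[of "{\<alpha>..\<beta>}" \<phi>]
      by (auto simp: strict_antimono_iff_antimono)
    have uniq: "u = t" if u: "u \<in> {\<alpha><..<\<beta>}" "u \<in> crossings \<phi> a b" for u
    proof -
      obtain d where d: "d \<in> {1..n}" "\<phi> u = mid d"
        using u(2) by (auto simp: crossings_def Mid_def)
      have "d = c" using piece_unique[of c d "mid d"] mid_inside[of d] d r(7) bspec[OF r(9) u(1)] by auto
      then show ?thesis using d r(8) inj_onD[OF inj, of u t] u r(2,3) by auto
    qed
    define S where "S = {u \<in> {\<alpha>..\<beta>}. \<psi> u = mid c}"
    have "closed ({\<alpha>..\<beta>} \<inter> \<psi> -` {mid c})" by (intro continuous_closed_preimage cont') auto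
    moreover have "{\<alpha>..\<beta>} \<inter> \<psi> -` {mid c} = S" by (auto simp: S_def)
    ultimately have clS: "closed S" by simp
    have bdd: "bdd_above S" by (auto simp: S_def intro!: bdd_aboveI[of _ \<beta>])
    note mg = mid_gap[OF r(7)] mesh_pos
    have cl: "\<bar>\<phi> \<alpha> - \<psi> \<alpha>\<bar> < mesh" "\<bar>\<phi> \<beta> - \<psi> \<beta>\<bar> < mesh" using close r by auto
    have "\<psi> \<alpha> < mid c \<and> mid c < \<psi> \<beta> \<or> \<psi> \<beta> < mid c \<and> mid c < \<psi> \<alpha>"
      using r(11) cl mg by linarith
    then have "S \<noteq> {}"
    proof
      assume "\<psi> \<alpha> < mid c \<and> mid c < \<psi> \<beta>"
      then show ?thesis using IVT'[of \<psi> \<alpha> "mid c" \<beta>] cont' r by (auto simp: S_def)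
    next
      assume "\<psi> \<beta> < mid c \<and> mid c < \<psi> \<alpha>"
      then show ?thesis using IVT2'[of \<psi> \<beta> "mid c" \<alpha>] cont' r by (auto simp: S_def)
    qed
    \<comment> \<open>the last passage through the midpoint, after which \<open>\<psi>\<close> stays on the side where \<open>\<phi>\<close> ends the run\<close>
    define t' where "t' = Sup S"
    have "t' \<in> S" using closed_contains_Sup[OF \<open>S \<noteq> {}\<close> bdd clS] by (simp add: t'_def)
    then have t': "\<alpha> \<le> t'" "t' \<le> \<beta>" "\<psi> t' = mid c" by (auto simp: S_def)
    have ne: "t' \<noteq> \<alpha>" "t' \<noteq> \<beta>" using r(11) cl mg t'(3) by auto
    have after: "\<psi> u \<noteq> mid c" if "t' < u" "u \<le> \<beta>" for u
      using cSup_upper[OF _ bdd, of u] that t' by (auto simp: S_def t'_def)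
    have contu: "continuous_on {u..\<beta>} \<psi>" if "t' < u" for u
      using continuous_on_subset[OF cont', of "{u..\<beta>}"] that t' by auto
    have "letter_at \<psi> t' = letter_at \<phi> t"
      using r(11)
    proof
      assume inc: "strict_mono_on {\<alpha>..\<beta>} \<phi> \<and> \<phi> \<alpha> < x (c - 1) + mesh \<and> x c - mesh < \<phi> \<beta> \<and> letter_at \<phi> t = Plain c"
      have "mid c < \<psi> u" if u: "t' < u" "u < \<beta>" for u
      proof (rule ccontr)
        assume "\<not> mid c < \<psi> u"
        moreover have "mid c \<le> \<psi> \<beta>" using inc cl mg by linarith
        ultimately obtain w where "u \<le> w" "w \<le> \<beta>" "\<psi> w = mid c"
          using IVT'[of \<psi> u "mid c" \<beta>] contu[OF u(1)] u by auto
        then show False using after[of w] u by auto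
      qed
      then show ?thesis using letter_at_up[of c \<psi> t' \<beta>, OF r(7) t'(3)] t' ne inc by auto
    next
      assume dec: "strict_antimono_on {\<alpha>..\<beta>} \<phi> \<and> \<phi> \<beta> < x (c - 1) + mesh \<and> x c - mesh < \<phi> \<alpha> \<and> letter_at \<phi> t = Barred c"
      have "\<psi> u < mid c" if u: "t' < u" "u < \<beta>" for u
      proof (rule ccontr)
        assume "\<not> \<psi> u < mid c"
        moreover have "\<psi> \<beta> \<le> mid c" using dec cl mg by linarith
        ultimately obtain w where "u \<le> w" "w \<le> \<beta>" "\<psi> w = mid c"
          using IVT2'[of \<psi> \<beta> "mid c" u] contu[OF u(1)] u by auto
        then show False using after[of w] u by auto
      qed
      then show ?thesis using letter_at_down[of c \<psi> t' \<beta>, OF r(7) t'(3)] t' ne dec by auto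
    qed
    moreover have "t' \<in> crossings \<psi> a b" using t' r \<open>mid c \<in> Mid\<close> by (auto simp: crossings_def)
    moreover have "\<forall>u\<in>{\<alpha><..<\<beta>}. \<phi> u \<notin> V \<and> (u \<in> crossings \<phi> a b \<longrightarrow> u = t)"
      using noV uniq by blast
    moreover have "\<alpha> < t'" "t' < \<beta>" using t' ne by auto
    ultimately show "\<exists>\<alpha> \<beta> t'. a \<le> \<alpha> \<and> \<alpha> < t \<and> t < \<beta> \<and> \<beta> \<le> b \<and> \<alpha> < t' \<and> t' < \<beta> \<and>
      t' \<in> crossings \<psi> a b \<and> letter_at \<psi> t' = letter_at \<phi> t \<and>
      (\<forall>u\<in>{\<alpha><..<\<beta>}. \<phi> u \<notin> V \<and> (u \<in> crossings \<phi> a b \<longrightarrow> u = t)) \<and>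
      (\<alpha> = a \<or> \<phi> \<alpha> \<in> V) \<and> (\<beta> = b \<or> \<phi> \<beta> \<in> V)"
      using r(1-6) by blast
  qed
  then obtain A B f where f: "\<And>t. t \<in> crossings \<phi> a b \<Longrightarrow> a \<le> A t \<and> A t < t \<and> t < B t \<and> B t \<le> b \<and> A t < f t \<and> f t < B t \<and>
      f t \<in> crossings \<psi> a b \<and> letter_at \<psi> (f t) = letter_at \<phi> t \<and>
      (\<forall>u\<in>{A t<..<B t}. \<phi> u \<notin> V \<and> (u \<in> crossings \<phi> a b \<longrightarrow> u = t)) \<and>
      (A t = a \<or> \<phi> (A t) \<in> V) \<and> (B t = b \<or> \<phi> (B t) \<in> V)"
    by metis
  have "strict_mono_on (crossings \<phi> a b) f"
  proof (rule monotone_onI)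
    fix t1 t2 assume t: "t1 \<in> crossings \<phi> a b" "t2 \<in> crossings \<phi> a b" "t1 < t2"
    note f1 = f[OF t(1)] and f2 = f[OF t(2)]
    have "B t1 \<le> t2" using f1 t by (metis greaterThanLessThan_iff less_trans less_irrefl not_less)
    have "t1 \<le> A t2" using f2 t by (metis greaterThanLessThan_iff less_trans less_irrefl not_less)
    have "B t1 \<le> A t2"
    proof (rule ccontr)
      assume "\<not> B t1 \<le> A t2"
      then have "A t2 \<in> {A t1<..<B t1}" using f1 \<open>t1 \<le> A t2\<close> by auto
      then have "\<phi> (A t2) \<notin> V" using f1 by auto
      then have "A t2 = a" using f2 by auto
      then show False using f1 \<open>t1 \<le> A t2\<close> by auto
    qed
    then show "f t1 < f t2" using f1 f2 by auto
  qed
  then show ?thesis using that[of f] f by auto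
qed

text \<open>Itineraries are stable under perturbation: applying the previous lemma in both directions shows that
  the two sets of crossings have the same size.\<close>

lemma close_itin_eq:
  assumes tu: "turning \<phi> a b" "turning \<psi> a b"
    and ends: "near mesh (\<phi> a)" "near mesh (\<phi> b)" "near mesh (\<psi> a)" "near mesh (\<psi> b)"
    and close: "\<And>t. a \<le> t \<Longrightarrow> t \<le> b \<Longrightarrow> \<bar>\<phi> t - \<psi> t\<bar> < mesh"
  shows "itin \<phi> a b = itin \<psi> a b"
proof -
  have close': "\<bar>\<psi> t - \<phi> t\<bar> < mesh" if "a \<le> t" "t \<le> b" for t
    using close[OF that] by (simp add: abs_minus_commute)
  obtain f where f: "strict_mono_on (crossings \<phi> a b) f" "f ` crossings \<phi> a b \<subseteq> crossings \<psi> a b"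
    "\<forall>t\<in>crossings \<phi> a b. letter_at \<psi> (f t) = letter_at \<phi> t"
    by (rule close_itin_le[OF tu ends(1,2) close]) (use that in auto)
  obtain g where g: "strict_mono_on (crossings \<psi> a b) g" "g ` crossings \<psi> a b \<subseteq> crossings \<phi> a b"
    by (rule close_itin_le[OF tu(2,1) ends(3,4) close']) (use that in auto)
  have "card (crossings \<psi> a b) \<le> card (crossings \<phi> a b)"
    using card_inj_on_le[OF strict_mono_on_imp_inj_on[OF g(1)] g(2) finite_crossings[OF tu(1)]] .
  then show ?thesis unfolding itin_def
    by (intro map_sorted_list_eq[OF finite_crossings[OF tu(1)] finite_crossings[OF tu(2)] f(1,2)]) (use f(3) in auto)
qed

lemma itin_uminus:
  assumes tu: "turning \<phi> a b" and ends: "near mesh (\<phi> a)" "near mesh (\<phi> b)"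
  shows "itin (\<lambda>t. \<phi> (- t)) (- b) (- a) = word_bar (itin \<phi> a b)"
proof -
  let ?\<psi> = "\<lambda>t. \<phi> (- t)"
  have S: "crossings ?\<psi> (- b) (- a) = uminus ` crossings \<phi> a b"
  proof
    show "crossings ?\<psi> (- b) (- a) \<subseteq> uminus ` crossings \<phi> a b"
    proof
      fix t assume "t \<in> crossings ?\<psi> (- b) (- a)"
      then have "- t \<in> crossings \<phi> a b" by (auto simp: crossings_def)
      then show "t \<in> uminus ` crossings \<phi> a b" by (metis image_eqI minus_minus)
    qed
  qed (auto simp: crossings_def)
  have fin: "finite (crossings \<phi> a b)" by (rule finite_crossings[OF tu])
  have lt: "letter_at ?\<psi> (- t) = bar (letter_at \<phi> t)" if t: "t \<in> crossings \<phi> a b" for t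
  proof -
    obtain \<alpha> \<beta> c where "a \<le> \<alpha>" and r1: "\<alpha> < t" "t < \<beta>" and "\<beta> \<le> b" and r2: "c \<in> {1..n}" "\<phi> t = mid c"
      "strict_mono_on {\<alpha>..\<beta>} \<phi> \<and> letter_at \<phi> t = Plain c \<or> strict_antimono_on {\<alpha>..\<beta>} \<phi> \<and> letter_at \<phi> t = Barred c"
      by (rule crossing_direction[OF tu ends t]) (rule that)
    note r = r1 r2
    from r(5) show ?thesis
    proof
      assume m: "strict_mono_on {\<alpha>..\<beta>} \<phi> \<and> letter_at \<phi> t = Plain c"
      have "letter_at ?\<psi> (- t) = Barred c"
        by (rule letter_at_down[OF r(3), of _ _ "- \<alpha>"]) (use r strict_mono_on_less[OF conjunct1[OF m], of "- _" t] in auto)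
      then show ?thesis using m by simp
    next
      assume m: "strict_antimono_on {\<alpha>..\<beta>} \<phi> \<and> letter_at \<phi> t = Barred c"
      have "letter_at ?\<psi> (- t) = Plain c"
        by (rule letter_at_up[OF r(3), of _ _ "- \<alpha>"]) (use r strict_antimono_on_less[OF conjunct1[OF m], of "- _" t] in auto)
      then show ?thesis using m by simp
    qed
  qed
  have "sorted_list_of_set (uminus ` crossings \<phi> a b) = rev (map uminus (sorted_list_of_set (crossings \<phi> a b)))"
    by (rule sorted_list_strict_antimono_image[OF fin]) (auto simp: monotone_on_def)
  then show ?thesis
    using lt fin by (auto simp: itin_def S word_bar_def rev_map)
qed

lemma itin_compose_mono:
  assumes tu: "turning \<phi> (\<theta> a) (\<theta> b)" and ends: "near mesh (\<phi> (\<theta> a))" "near mesh (\<phi> (\<theta> b))"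
    and th: "continuous_on {a..b} \<theta>" "strict_mono_on {a..b} \<theta>" and ab: "a \<le> b"
  shows "itin (\<lambda>t. \<phi> (\<theta> t)) a b = itin \<phi> (\<theta> a) (\<theta> b)"
proof -
  let ?\<psi> = "\<lambda>t. \<phi> (\<theta> t)"
  have range: "\<theta> t \<in> {\<theta> a..\<theta> b}" if "t \<in> {a..b}" for t
    using monotone_onD[OF th(2), of a t] monotone_onD[OF th(2), of t b] that
    by (cases "t = a"; cases "t = b") auto
  have surj: "\<exists>t\<in>{a..b}. \<theta> t = u" if "u \<in> {\<theta> a..\<theta> b}" for u
    using IVT'[of \<theta> a u b] that th(1) ab by auto
  have S: "crossings \<phi> (\<theta> a) (\<theta> b) = \<theta> ` crossings ?\<psi> a b"
    using range surj by (fastforce simp: crossings_def)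
  have mono: "strict_mono_on (crossings ?\<psi> a b) \<theta>"
    using th(2) by (rule monotone_on_subset) (auto simp: crossings_def)
  have fin: "finite (crossings ?\<psi> a b)"
    using finite_crossings[OF tu] S strict_mono_on_imp_inj_on[OF mono] finite_imageD by metis
  have lt: "letter_at ?\<psi> t = letter_at \<phi> (\<theta> t)" if t: "t \<in> crossings ?\<psi> a b" for t
  proof -
    have tc: "\<theta> t \<in> crossings \<phi> (\<theta> a) (\<theta> b)" using S t by auto
    obtain \<alpha> \<beta> c where "\<theta> a \<le> \<alpha>" and r: "\<alpha> < \<theta> t" "\<theta> t < \<beta>" "\<beta> \<le> \<theta> b" "c \<in> {1..n}" "\<phi> (\<theta> t) = mid c"
      "strict_mono_on {\<alpha>..\<beta>} \<phi> \<and> letter_at \<phi> (\<theta> t) = Plain c \<or> strict_antimono_on {\<alpha>..\<beta>} \<phi> \<and> letter_at \<phi> (\<theta> t) = Barred c"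
      by (rule crossing_direction[OF tu ends tc]) (rule that)
    obtain s where s: "s \<in> {a..b}" "\<theta> s = \<beta>" using surj[of \<beta>] r range[of t] t by (auto simp: crossings_def)
    have tab: "t \<in> {a..b}" using t by (auto simp: crossings_def)
    have ts: "t < s" using monotone_onD[OF th(2), of s t] s tab r(2) by (metis less_asym less_irrefl linorder_neqE)
    have img: "\<theta> t < \<theta> u" "\<theta> u < \<beta>" if "t < u" "u < s" for u
      using monotone_onD[OF th(2), of t u] monotone_onD[OF th(2), of u s] that s tab by auto
    from r(6) show ?thesis
    proof
      assume m: "strict_mono_on {\<alpha>..\<beta>} \<phi> \<and> letter_at \<phi> (\<theta> t) = Plain c"
      have "mid c < \<phi> (\<theta> u)" if "t < u" "u < s" for u
        using strict_mono_on_less[OF conjunct1[OF m], of "\<theta> t" "\<theta> u"] img[OF that] r(1,5) by auto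
      then have "letter_at ?\<psi> t = Plain c"
        by (intro letter_at_up[of c ?\<psi> t s, OF r(4,5) ts]) auto
      then show ?thesis using m by simp
    next
      assume m: "strict_antimono_on {\<alpha>..\<beta>} \<phi> \<and> letter_at \<phi> (\<theta> t) = Barred c"
      have "\<phi> (\<theta> u) < mid c" if "t < u" "u < s" for u
        using strict_antimono_on_less[OF conjunct1[OF m], of "\<theta> t" "\<theta> u"] img[OF that] r(1,5) by auto
      then have "letter_at ?\<psi> t = Barred c"
        by (intro letter_at_down[of c ?\<psi> t s, OF r(4,5) ts]) auto
      then show ?thesis using m by simp
    qed
  qed
  show ?thesis
    unfolding itin_def S sorted_list_strict_mono_image[OF fin mono] using lt fin by simp
qed

text \<open>Both ends of a run are near vertices, and near the same vertex if the run does not cross the midpoint;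
  being monotone, the run stays near this vertex.\<close>

lemma no_crossing_near:
  assumes tu: "turning \<phi> a b" and d: "0 < d" "d \<le> mesh"
    and ends: "near d (\<phi> a)" "near d (\<phi> b)" and no: "crossings \<phi> a b = {}"
    and t: "a \<le> t" "t \<le> b"
  shows "near d (\<phi> t)"
proof (cases "\<phi> t \<in> V")
  case True
  then show ?thesis using d by simp
next
  case False
  have tab: "t \<in> {a..b}" using t by auto
  obtain \<alpha> \<beta> c where r: "a \<le> \<alpha>" "\<alpha> \<le> t" "t \<le> \<beta>" "\<beta> \<le> b" "\<alpha> = a \<or> \<phi> \<alpha> \<in> V \<and> \<alpha> < t" "\<beta> = b \<or> \<phi> \<beta> \<in> V \<and> t < \<beta>"
    "c \<in> {1..n}" "\<forall>u\<in>{\<alpha><..<\<beta>}. x (c - 1) < \<phi> u \<and> \<phi> u < x c"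
    "\<forall>u\<in>{\<alpha>..\<beta>}. x (c - 1) \<le> \<phi> u \<and> \<phi> u \<le> x c"
    "x (c - 1) < \<phi> t" "\<phi> t < x c"
    "strict_mono_on {\<alpha>..\<beta>} \<phi> \<or> strict_antimono_on {\<alpha>..\<beta>} \<phi>"
    by (rule maximal_run[OF tu tab False]) (rule that)
  have ne: "near d (\<phi> \<alpha>)" "near d (\<phi> \<beta>)" using r(5,6) ends d by auto
  have cases: "\<phi> \<alpha> < x (c - 1) + d \<or> x c - d < \<phi> \<alpha>" "\<phi> \<beta> < x (c - 1) + d \<or> x c - d < \<phi> \<beta>"
    using near_piece[OF ne(1) r(7)] near_piece[OF ne(2) r(7)] bspec[OF r(9), of \<alpha>] bspec[OF r(9), of \<beta>] r by auto
  have between: "\<phi> \<alpha> \<le> \<phi> t \<and> \<phi> t \<le> \<phi> \<beta> \<or> \<phi> \<beta> \<le> \<phi> t \<and> \<phi> t \<le> \<phi> \<alpha>"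
    using r(12)
  proof
    assume "strict_mono_on {\<alpha>..\<beta>} \<phi>"
    then show ?thesis using monotone_onD[of _ _ _ \<phi> \<alpha> t] monotone_onD[of _ _ _ \<phi> t \<beta>] r(2,3)
      by (metis atLeastAtMost_iff less_eq_real_def order_trans)
  next
    assume "strict_antimono_on {\<alpha>..\<beta>} \<phi>"
    then show ?thesis using monotone_onD[of _ _ _ \<phi> \<alpha> t] monotone_onD[of _ _ _ \<phi> t \<beta>] r(2,3)
      by (metis atLeastAtMost_iff less_eq_real_def order_trans)
  qed
  have "continuous_on {a..b} \<phi>" using tu by (simp add: turning_def)
  then have cont: "continuous_on {\<alpha>..\<beta>} \<phi>" by (rule continuous_on_subset) (use r(1,4) in auto)
  have noc: "\<phi> u \<noteq> mid c" if "\<alpha> \<le> u" "u \<le> \<beta>" for u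
  proof
    assume "\<phi> u = mid c"
    then have "u \<in> crossings \<phi> a b" using that r(1,4,7) by (simp add: crossings_def Mid_def)
    then show False using no by simp
  qed
  have "\<not> (\<phi> \<alpha> < mid c \<and> mid c < \<phi> \<beta>)"
    using IVT'[of \<phi> \<alpha> "mid c" \<beta>] cont noc r by (metis less_imp_le order_trans)
  moreover have "\<not> (\<phi> \<beta> < mid c \<and> mid c < \<phi> \<alpha>)"
    using IVT2'[of \<phi> \<beta> "mid c" \<alpha>] cont noc r by (metis less_imp_le order_trans)
  ultimately have "\<phi> t < x (c - 1) + d \<or> x c - d < \<phi> t"
    using cases between mid_gap[OF r(7)] mesh_pos d by linarith
  moreover have "x (c - 1) \<in> V" "x c \<in> V" using r(7) by auto
  ultimately show ?thesis using r(10,11) unfolding near_def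
    by (metis abs_less_iff add.commute diff_less_eq less_diff_eq minus_diff_eq d(1) diff_gt_0_iff_gt
        abs_of_pos abs_minus_commute)
qed

end

section \<open>Traversals of words, reparametrization and lifting\<close>

fun crosses :: "(nat \<Rightarrow> real) \<Rightarrow> (real \<Rightarrow> real) \<Rightarrow> real \<Rightarrow> real \<Rightarrow> letter \<Rightarrow> bool" where
  "crosses x f a b (Plain c) \<longleftrightarrow> a < b \<and> continuous_on {a..b} f \<and> strict_mono_on {a..b} f \<and>
     f a = x (c - 1) \<and> f b = x c"
| "crosses x f a b (Barred c) \<longleftrightarrow> a < b \<and> continuous_on {a..b} f \<and> strict_antimono_on {a..b} f \<and>
     f a = x c \<and> f b = x (c - 1)"

text \<open>Unlike an itinerary, which tolerates inaccurate ends and constancy at vertices, a traversal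
  is exact: the domain splits into intervals on each of which the function is a monotone
  homeomorphism onto the piece named by the letter.\<close>

primrec traverses :: "(nat \<Rightarrow> real) \<Rightarrow> (real \<Rightarrow> real) \<Rightarrow> real \<Rightarrow> real \<Rightarrow> letter list \<Rightarrow> bool" where
  "traverses x f a b [] \<longleftrightarrow> a = b"
| "traverses x f a b (c # w) \<longleftrightarrow> (\<exists>m. crosses x f a m c \<and> traverses x f m b w)"

fun src :: "letter \<Rightarrow> nat" where "src (Plain c) = c - 1" | "src (Barred c) = c"
fun tgt :: "letter \<Rightarrow> nat" where "tgt (Plain c) = c" | "tgt (Barred c) = c - 1"

lemma src_tgt_bar [simp]: "src (bar b) = tgt b" "tgt (bar b) = src b"
  by (cases b; simp)+

lemma crosses_ends: "crosses x f a b c \<Longrightarrow> a < b \<and> continuous_on {a..b} f \<and> f a = x (src c) \<and> f b = x (tgt c)"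
  by (cases c) auto

lemma traverses_le: "traverses x f a b w \<Longrightarrow> a \<le> b \<and> (w \<noteq> [] \<longrightarrow> a < b)"
proof (induction w arbitrary: a)
  case (Cons c w)
  then obtain m where "crosses x f a m c" "traverses x f m b w" by auto
  then show ?case using Cons.IH[of m] crosses_ends[of x f a m c] by auto
qed auto

lemma traverses_ends:
  "traverses x f a b w \<Longrightarrow> w \<noteq> [] \<Longrightarrow> f a = x (src (hd w)) \<and> f b = x (tgt (last w))"
proof (induction w arbitrary: a)
  case (Cons c w)
  then obtain m where "crosses x f a m c" "traverses x f m b w" by auto
  then show ?case using Cons.IH[of m] crosses_ends[of x f a m c] by auto
qed auto

lemma traverses_append:
  "traverses x f a b (u @ v) \<longleftrightarrow> (\<exists>m. traverses x f a m u \<and> traverses x f m b v)"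
  by (induction u arbitrary: a) auto

lemma crosses_cong: "(\<And>t. a \<le> t \<Longrightarrow> t \<le> b \<Longrightarrow> f t = g t) \<Longrightarrow> crosses x f a b c \<longleftrightarrow> crosses x g a b c"
  using continuous_on_cong[of "{a..b}" "{a..b}" f g]
  by (cases c) (auto simp: monotone_on_def)

lemma traverses_cong:
  assumes "\<And>t. a \<le> t \<Longrightarrow> t \<le> b \<Longrightarrow> f t = g t" "traverses x f a b w"
  shows "traverses x g a b w"
  using assms
proof (induction w arbitrary: a)
  case (Cons c w)
  then obtain m where m: "crosses x f a m c" "traverses x f m b w" by auto
  have am: "a < m" "m \<le> b" using crosses_ends[OF m(1)] traverses_le[OF m(2)] by auto
  have "crosses x g a m c" using crosses_cong[of a m f g] Cons.prems(1) am m(1) by auto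
  moreover have "traverses x g m b w" using Cons.IH[OF _ m(2)] Cons.prems(1) am by auto
  ultimately show ?case by auto
qed auto

lemma crosses_uminus: assumes "crosses x f a b c" shows "crosses x (\<lambda>t. f (- t)) (- b) (- a) (bar c)"
proof -
  have *: "continuous_on {- b..- a} (\<lambda>t. f (- t))" if "continuous_on {a..b} f"
    using that by (intro continuous_on_compose2[of "{a..b}" f _ uminus] continuous_on_minus continuous_on_id) auto
  show ?thesis using assms * by (cases c) (auto simp: monotone_on_def)
qed

lemma traverses_uminus: "traverses x f a b w \<Longrightarrow> traverses x (\<lambda>t. f (- t)) (- b) (- a) (word_bar w)"
proof (induction w arbitrary: a)
  case (Cons c w)
  then obtain m where m: "crosses x f a m c" "traverses x f m b w" by auto
  have "traverses x (\<lambda>t. f (- t)) (- b) (- m) (word_bar w)" using Cons.IH[OF m(2)] .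
  moreover have "traverses x (\<lambda>t. f (- t)) (- m) (- a) [bar c]" using crosses_uminus[OF m(1)] by auto
  ultimately show ?case by (auto simp: traverses_append)
qed auto

lemma crosses_compose:
  assumes "crosses x f (\<theta> a) (\<theta> b) c" "continuous_on {a..b} \<theta>" "strict_mono_on {a..b} \<theta>" "a < b"
  shows "crosses x (\<lambda>t. f (\<theta> t)) a b c"
proof -
  have r: "\<theta> a \<le> \<theta> t \<and> \<theta> t \<le> \<theta> b" if "a \<le> t" "t \<le> b" for t
    using strict_mono_on_less[OF assms(3), of a t] strict_mono_on_less[OF assms(3), of t b] that
    by (cases "t = a"; cases "t = b") auto
  have "continuous_on {a..b} (\<lambda>t. f (\<theta> t))"
    by (rule continuous_on_compose2[of "{\<theta> a..\<theta> b}" f]) (use crosses_ends[OF assms(1)] assms(2) r in auto)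
  then show ?thesis using assms r by (cases c) (auto simp: monotone_on_def)
qed

lemma traverses_compose:
  assumes "traverses x f (\<theta> a) (\<theta> b) w" "continuous_on {a..b} \<theta>" "strict_mono_on {a..b} \<theta>" "a \<le> b"
  shows "traverses x (\<lambda>t. f (\<theta> t)) a b w"
  using assms
proof (induction w arbitrary: a)
  case Nil
  then show ?case using strict_mono_on_less[OF Nil(3), of a b] by (cases "a = b") auto
next
  case (Cons c w)
  then obtain m' where m: "crosses x f (\<theta> a) m' c" "traverses x f m' (\<theta> b) w" by auto
  have m': "\<theta> a < m'" "m' \<le> \<theta> b" using crosses_ends[OF m(1)] traverses_le[OF m(2)] by auto
  then obtain k where k: "a \<le> k" "k \<le> b" "\<theta> k = m'"
    using IVT'[of \<theta> a m' b] Cons.prems by auto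
  have "a < k" using k m' by (cases "a = k") auto
  have "crosses x (\<lambda>t. f (\<theta> t)) a k c"
    by (rule crosses_compose) (use m k \<open>a < k\<close> Cons.prems in \<open>auto intro: continuous_on_subset monotone_on_subset\<close>)
  moreover have "traverses x (\<lambda>t. f (\<theta> t)) k b w"
    by (rule Cons.IH) (use m k \<open>a < k\<close> Cons.prems in \<open>auto intro: continuous_on_subset monotone_on_subset\<close>)
  ultimately show ?case by auto
qed

definition reparam :: "(real \<Rightarrow> real) \<Rightarrow> real \<Rightarrow> real \<Rightarrow> real \<Rightarrow> real \<Rightarrow> bool" where
  "reparam \<theta> a b a' b' \<longleftrightarrow> continuous_on {a..b} \<theta> \<and> strict_mono_on {a..b} \<theta> \<and> \<theta> a = a' \<and> \<theta> b = b'"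

lemma continuous_on_glue:
  fixes f g :: "real \<Rightarrow> 'a::topological_space"
  assumes "continuous_on {a..m} f" "continuous_on {m..b} g" "f m = g m" "a \<le> m" "m \<le> b"
  shows "continuous_on {a..b} (\<lambda>t. if t \<le> m then f t else g t)"
proof -
  have "continuous_on ({a..m} \<union> {m..b}) (\<lambda>t. if t \<le> m then f t else g t)"
    by (rule continuous_on_If) (use assms in auto)
  moreover have "{a..m} \<union> {m..b} = {a..b}" using assms by auto
  ultimately show ?thesis by simp
qed

lemma reparam_glue:
  assumes "reparam \<theta> a m a' m'" "reparam \<eta> m b m' b'" "a \<le> m" "m \<le> b"
  shows "reparam (\<lambda>t. if t \<le> m then \<theta> t else \<eta> t) a b a' b'"
  unfolding reparam_def
proof (intro conjI)
  show "continuous_on {a..b} (\<lambda>t. if t \<le> m then \<theta> t else \<eta> t)"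
    by (rule continuous_on_glue) (use assms in \<open>auto simp: reparam_def\<close>)
  show "strict_mono_on {a..b} (\<lambda>t. if t \<le> m then \<theta> t else \<eta> t)"
  proof (rule monotone_onI)
    fix p q assume pq: "p \<in> {a..b}" "q \<in> {a..b}" "p < q"
    consider "q \<le> m" | "m \<le> p" "m < q" | "p < m" "m < q" by linarith
    then show "(if p \<le> m then \<theta> p else \<eta> p) < (if q \<le> m then \<theta> q else \<eta> q)"
    proof cases
      case 1 then show ?thesis using pq assms strict_mono_on_less[of a m \<theta> p q] by (auto simp: reparam_def)
    next
      case 2 then show ?thesis using pq assms strict_mono_on_less[of m b \<eta> p q] by (auto simp: reparam_def)
    next
      case 3
      then have "\<theta> p < \<theta> m" "\<eta> m < \<eta> q"
        using pq assms strict_mono_on_less[of a m \<theta> p m] strict_mono_on_less[of m b \<eta> m q] by (auto simp: reparam_def)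
      then show ?thesis using 3 assms by (auto simp: reparam_def)
    qed
  qed
qed (use assms in \<open>auto simp: reparam_def\<close>)

lemma strict_mono_reparam:
  fixes f g :: "real \<Rightarrow> real"
  assumes f: "continuous_on {a..b} f" "strict_mono_on {a..b} f" "a \<le> b"
    and g: "continuous_on {a'..b'} g" "strict_mono_on {a'..b'} g" "a' \<le> b'"
    and eq: "f a = g a'" "f b = g b'"
  shows "\<exists>\<theta>. reparam \<theta> a b a' b' \<and> (\<forall>t\<in>{a..b}. g (\<theta> t) = f t)"
proof -
  have inj: "inj_on g {a'..b'}" using g(2) by (rule strict_mono_on_imp_inj_on)
  define \<theta> where "\<theta> t = the_inv_into {a'..b'} g (f t)" for t
  have img: "f t \<in> g ` {a'..b'}" if "t \<in> {a..b}" for t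
  proof -
    have "g a' \<le> f t" "f t \<le> g b'"
      using strict_mono_on_less[OF f(2), of a t] strict_mono_on_less[OF f(2), of t b] that eq
      by (cases "t = a"; cases "t = b"; simp)+
    then show ?thesis using IVT'[of g a' "f t" b'] g by force
  qed
  have th: "g (\<theta> t) = f t" "\<theta> t \<in> {a'..b'}" if "t \<in> {a..b}" for t
    unfolding \<theta>_def using f_the_inv_into_f[OF inj img[OF that]] the_inv_into_into[OF inj img[OF that] order_refl] by auto
  have "continuous_on {a..b} \<theta>"
  proof -
    have "continuous_on (g ` {a'..b'}) (the_inv_into {a'..b'} g)"
      by (rule continuous_on_inv_into) (use g inj in auto)
    then show ?thesis
      unfolding \<theta>_def by (rule continuous_on_compose2[OF _ f(1)]) (use img in auto)
  qed
  moreover have "strict_mono_on {a..b} \<theta>"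
  proof (rule monotone_onI)
    fix p q assume pq: "p \<in> {a..b}" "q \<in> {a..b}" "p < q"
    then have "g (\<theta> p) < g (\<theta> q)" using th f(2) by (auto simp: monotone_on_def)
    then show "\<theta> p < \<theta> q"
      using strict_mono_on_less[OF g(2), of "\<theta> q" "\<theta> p"] th(2)[OF pq(1)] th(2)[OF pq(2)]
      by (cases "\<theta> p" "\<theta> q" rule: linorder_cases) auto
  qed
  moreover have "\<theta> a = a'" "\<theta> b = b'"
    unfolding \<theta>_def eq using the_inv_into_f_f[OF inj] g(3) by auto
  ultimately show ?thesis using th unfolding reparam_def by auto
qed

lemma crosses_reparam:
  assumes "crosses x f a b c" "crosses x g a' b' c"
  shows "\<exists>\<theta>. reparam \<theta> a b a' b' \<and> (\<forall>t\<in>{a..b}. g (\<theta> t) = f t)"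
proof (cases c)
  case (Plain d)
  then show ?thesis using assms by (intro strict_mono_reparam) auto
next
  case (Barred d)
  have "\<exists>\<theta>. reparam \<theta> a b a' b' \<and> (\<forall>t\<in>{a..b}. - g (\<theta> t) = - f t)"
    by (rule strict_mono_reparam[of a b "\<lambda>t. - f t" a' b' "\<lambda>t. - g t"])
      (use assms Barred in \<open>auto simp: monotone_on_def intro!: continuous_on_minus\<close>)
  then show ?thesis by auto
qed

text \<open>The word determines a traversal up to a change of parameter.\<close>

lemma traverses_reparam:
  assumes "traverses x f a b w" "traverses x g a' b' w" "w \<noteq> []"
  shows "\<exists>\<theta>. reparam \<theta> a b a' b' \<and> (\<forall>t\<in>{a..b}. g (\<theta> t) = f t)"
  using assms
proof (induction w arbitrary: a a')
  case (Cons c w)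
  then obtain m m' where m: "crosses x f a m c" "traverses x f m b w"
    "crosses x g a' m' c" "traverses x g m' b' w" by auto
  have am: "a < m" "m \<le> b" using crosses_ends[OF m(1)] traverses_le[OF m(2)] by auto
  obtain \<theta> where \<theta>: "reparam \<theta> a m a' m'" "\<forall>t\<in>{a..m}. g (\<theta> t) = f t"
    using crosses_reparam[OF m(1,3)] by auto
  show ?case
  proof (cases "w = []")
    case True
    then show ?thesis using m \<theta> by auto
  next
    case False
    obtain \<eta> where \<eta>: "reparam \<eta> m b m' b'" "\<forall>t\<in>{m..b}. g (\<eta> t) = f t"
      using Cons.IH[OF m(2,4) False] by auto
    show ?thesis
      by (rule exI[of _ "\<lambda>t. if t \<le> m then \<theta> t else \<eta> t"])
        (use reparam_glue[OF \<theta>(1) \<eta>(1)] am \<theta>(2) \<eta>(2) in auto)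
  qed
qed auto

lemma traverses_continuous: "traverses x f a b w \<Longrightarrow> continuous_on {a..b} f"
proof (induction w arbitrary: a)
  case (Cons c w)
  then obtain m where m: "crosses x f a m c" "traverses x f m b w" by auto
  have am: "a < m" "m \<le> b" using crosses_ends[OF m(1)] traverses_le[OF m(2)] by auto
  have "continuous_on {a..b} (\<lambda>t. if t \<le> m then f t else f t)"
    by (rule continuous_on_glue) (use am crosses_ends[OF m(1)] Cons.IH[OF m(2)] in auto)
  then show ?case by simp
qed auto

text \<open>The words that describe edge paths of the subdivided interval.  A path may turn back at a
  vertex, so a factor such as \<open>[Plain c, Barred c]\<close> is legal.\<close>

definition legal :: "letter list \<Rightarrow> bool" where
  "legal = successively (\<lambda>b c. tgt b = src c)"

lemma legal_simps [simp]:
  "legal []" "legal (b # w) \<longleftrightarrow> (w = [] \<or> tgt b = src (hd w)) \<and> legal w"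
  "legal (u @ v) \<longleftrightarrow> legal u \<and> legal v \<and> (u = [] \<or> v = [] \<or> tgt (last u) = src (hd v))"
  by (auto simp: legal_def successively_Cons successively_append_iff)

text \<open>Only unbarred letters are mentioned; a barred letter is the same piece run backwards.\<close>

definition realizes :: "(nat \<Rightarrow> real) \<Rightarrow> nat \<Rightarrow> (nat \<Rightarrow> real) \<Rightarrow> (letter \<Rightarrow> letter list) \<Rightarrow> (real \<Rightarrow> real) \<Rightarrow> bool" where
  "realizes x m y \<sigma> f \<longleftrightarrow> (\<forall>c\<in>{1..m}. traverses x f (y (c - 1)) (y c) (\<sigma> (Plain c)))"

lemma traverses_letter:
  assumes f: "realizes x m y \<sigma> f" and bar: "\<forall>b\<in>alphabet m. \<sigma> (bar b) = word_bar (\<sigma> b)"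
    and h: "crosses y h a b c" and c: "c \<in> alphabet m"
  shows "traverses x (\<lambda>t. f (h t)) a b (\<sigma> c)"
proof (cases c)
  case (Plain d)
  then have "d \<in> {1..m}" using c by (auto simp: alphabet_def)
  then have "traverses x f (h a) (h b) (\<sigma> c)" using f h Plain by (auto simp: realizes_def)
  then show ?thesis by (rule traverses_compose) (use h Plain in auto)
next
  case (Barred d)
  then have d: "d \<in> {1..m}" using c by (auto simp: alphabet_def)
  then have "\<sigma> c = word_bar (\<sigma> (Plain d))" using bar Barred by (auto simp: alphabet_def dest: bspec[of _ _ "Plain d"])
  moreover have "crosses y (\<lambda>t. h (- t)) (- b) (- a) (Plain d)"
    using crosses_uminus[OF h] Barred by simp
  note h' = this
  then have "traverses x f (h (- (- b))) (h (- (- a))) (\<sigma> (Plain d))" using f d by (auto simp: realizes_def)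
  then have "traverses x (\<lambda>t. f (h (- t))) (- b) (- a) (\<sigma> (Plain d))"
    by (rule traverses_compose) (use h' in auto)
  from traverses_uminus[OF this] have "traverses x (\<lambda>t. f (h t)) a b (word_bar (\<sigma> (Plain d)))" by simp
  ultimately show ?thesis by simp
qed

text \<open>Composition of functions realizes composition of substitutions.\<close>

lemma traverses_extend:
  assumes f: "realizes x m y \<sigma> f" and bar: "\<forall>b\<in>alphabet m. \<sigma> (bar b) = word_bar (\<sigma> b)"
    and h: "traverses y h a b w" and w: "set w \<subseteq> alphabet m"
  shows "traverses x (\<lambda>t. f (h t)) a b (extend \<sigma> w)"
  using h w
proof (induction w arbitrary: a)
  case (Cons c w)
  then obtain k where k: "crosses y h a k c" "traverses y h k b w" by auto
  have "traverses x (\<lambda>t. f (h t)) a k (\<sigma> c)"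
    using traverses_letter[OF f bar k(1)] Cons.prems by auto
  moreover have "traverses x (\<lambda>t. f (h t)) k b (extend \<sigma> w)"
    using Cons.IH[OF k(2)] Cons.prems by auto
  ultimately show ?case by (auto simp: traverses_append)
qed auto

lemma crosses_id:
  assumes "y (d - 1) < y d"
  shows "crosses y id (y (d - 1)) (y d) (Plain d)"
    "crosses y uminus (- y d) (- y (d - 1)) (Barred d)"
  using assms by (auto simp: monotone_on_def intro: continuous_intros)

text \<open>Some function \<open>k\<close> crosses \<open>c\<close>, and then \<open>f \<circ> k\<close> traverses the same word as \<open>h\<close>; the change of parameter
  between them turns \<open>k\<close> into the lift of \<open>h\<close>.\<close>

lemma letter_lift:
  assumes f: "realizes x m y \<sigma> f" and bar: "\<forall>b\<in>alphabet m. \<sigma> (bar b) = word_bar (\<sigma> b)"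
    and y: "\<forall>d\<in>{1..m}. y (d - 1) < y d"
    and h: "traverses x h a b (\<sigma> c)" and c: "c \<in> alphabet m"
  shows "\<exists>g. crosses y g a b c \<and> (\<forall>t\<in>{a..b}. f (g t) = h t)"
proof -
  obtain p q k where k: "crosses y k p q c"
  proof (cases c)
    case (Plain d)
    then have "d \<in> {1..m}" using c by (auto simp: alphabet_def)
    then show ?thesis using that Plain crosses_id(1)[of y d] y by blast
  next
    case (Barred d)
    then have "d \<in> {1..m}" using c by (auto simp: alphabet_def)
    then show ?thesis using that Barred crosses_id(2)[of y d] y by blast
  qed
  have fk: "traverses x (\<lambda>t. f (k t)) p q (\<sigma> c)" by (rule traverses_letter[OF f bar k c])
  have ne: "\<sigma> c \<noteq> []" using fk crosses_ends[OF k] by auto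
  obtain \<theta> where \<theta>: "reparam \<theta> a b p q" "\<forall>t\<in>{a..b}. f (k (\<theta> t)) = h t"
    using traverses_reparam[OF h fk ne] by auto
  have "crosses y k (\<theta> a) (\<theta> b) c" using \<theta>(1) k by (simp add: reparam_def)
  then have "crosses y (\<lambda>t. k (\<theta> t)) a b c"
    by (rule crosses_compose) (use \<theta>(1) traverses_le[OF h] ne in \<open>auto simp: reparam_def\<close>)
  then show ?thesis using \<theta>(2) by auto
qed

lemma traverses_glue:
  assumes g1: "traverses y g1 a k u" and g2: "traverses y g2 k b v"
    and uv: "u \<noteq> []" "v \<noteq> []" "tgt (last u) = src (hd v)"
  shows "traverses y (\<lambda>t. if t \<le> k then g1 t else g2 t) a b (u @ v)"
    "\<forall>t\<in>{k..b}. (if t \<le> k then g1 t else g2 t) = g2 t"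
proof -
  have "g1 k = g2 k" using traverses_ends[OF g1 uv(1)] traverses_ends[OF g2 uv(2)] uv(3) by auto
  then show *: "\<forall>t\<in>{k..b}. (if t \<le> k then g1 t else g2 t) = g2 t" by auto
  have "traverses y (\<lambda>t. if t \<le> k then g1 t else g2 t) a k u"
    by (rule traverses_cong[OF _ g1]) auto
  moreover have "traverses y (\<lambda>t. if t \<le> k then g1 t else g2 t) k b v"
    by (rule traverses_cong[OF _ g2]) (use * in \<open>metis atLeastAtMost_iff\<close>)
  ultimately show "traverses y (\<lambda>t. if t \<le> k then g1 t else g2 t) a b (u @ v)"
    by (auto simp: traverses_append)
qed

text \<open>The lifts of the single letters are glued; legality of \<open>w\<close> is what makes the glued function continuous.\<close>

lemma traverses_lift:
  assumes f: "realizes x m y \<sigma> f" and bar: "\<forall>b\<in>alphabet m. \<sigma> (bar b) = word_bar (\<sigma> b)"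
    and y: "\<forall>d\<in>{1..m}. y (d - 1) < y d"
    and h: "traverses x h a b (extend \<sigma> w)" and w: "set w \<subseteq> alphabet m" "legal w" "w \<noteq> []"
  shows "\<exists>g. traverses y g a b w \<and> (\<forall>t\<in>{a..b}. f (g t) = h t)"
  using h w
proof (induction w arbitrary: a)
  case (Cons c w)
  then obtain k where k: "traverses x h a k (\<sigma> c)" "traverses x h k b (extend \<sigma> w)"
    by (auto simp: traverses_append)
  obtain g1 where g1: "crosses y g1 a k c" "\<forall>t\<in>{a..k}. f (g1 t) = h t"
    using letter_lift[OF f bar y k(1)] Cons.prems by auto
  then have g1': "traverses y g1 a k [c]" by auto
  show ?case
  proof (cases "w = []")
    case True
    then show ?thesis using g1 k by auto
  next
    case False
    obtain g2 where g2: "traverses y g2 k b w" "\<forall>t\<in>{k..b}. f (g2 t) = h t"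
      using Cons.IH[OF k(2)] Cons.prems False by auto
    note gl = traverses_glue[OF g1' g2(1) _ False]
    show ?thesis
      by (rule exI[of _ "\<lambda>t. if t \<le> k then g1 t else g2 t"])
        (use gl Cons.prems False g1(2) g2(2) in auto)
  qed
qed auto

text \<open>Maps defined on the individual pieces fit together if the word of each piece ends where the
  next one begins.  The relation \<open>P\<close> carries along whatever the maps satisfy pointwise.\<close>

lemma realizes_glue:
  assumes ex: "\<And>c. c \<in> {1..k} \<Longrightarrow> \<exists>g. traverses y g (z (c - 1)) (z c) (\<tau> (Plain c)) \<and> (\<forall>t\<in>{z (c - 1)..z c}. P t (g t))"
    and ne: "\<forall>c\<in>{1..k}. \<tau> (Plain c) \<noteq> []"
    and junction: "\<forall>c\<in>{1..<k}. tgt (last (\<tau> (Plain c))) = src (hd (\<tau> (Plain (Suc c))))"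
    and "0 < k"
  shows "\<exists>g. realizes y k z \<tau> g \<and> (\<forall>t\<in>{z 0..z k}. P t (g t))"
proof -
  have "i \<le> k \<Longrightarrow> 0 < i \<Longrightarrow> \<exists>g. realizes y i z \<tau> g \<and> (\<forall>t\<in>{z 0..z i}. P t (g t))" for i
  proof (induction i)
    case (Suc i)
    obtain g2 where g2: "traverses y g2 (z i) (z (Suc i)) (\<tau> (Plain (Suc i)))"
      "\<forall>t\<in>{z i..z (Suc i)}. P t (g2 t)"
      using ex[of "Suc i"] Suc.prems by auto
    show ?case
    proof (cases "i = 0")
      case True
      then show ?thesis using g2 by (auto simp: realizes_def)
    next
      case False
      then obtain g1 where g1: "realizes y i z \<tau> g1" "\<forall>t\<in>{z 0..z i}. P t (g1 t)"
        using Suc by auto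
      let ?g = "\<lambda>t. if t \<le> z i then g1 t else g2 t"
      have zle: "z (c - 1) < z c" if "c \<in> {1..i}" for c
      proof -
        have "traverses y g1 (z (c - 1)) (z c) (\<tau> (Plain c))" "\<tau> (Plain c) \<noteq> []"
          using g1(1) ne that Suc.prems unfolding realizes_def by auto
        then show ?thesis using traverses_le by blast
      qed
      have zmono: "z c \<le> z i" if "c \<le> i" for c
        using that
      proof (induction "i - c" arbitrary: c)
        case (Suc j)
        then have "z c < z (Suc c)" using zle[of "Suc c"] by auto
        also have "z (Suc c) \<le> z i" using Suc by (intro Suc.hyps(1)) auto
        finally show ?case by simp
      qed auto
      have t1: "traverses y g1 (z (i - 1)) (z i) (\<tau> (Plain i))"
        using g1(1) False by (auto simp: realizes_def)
      have "\<tau> (Plain i) \<noteq> []" "\<tau> (Plain (Suc i)) \<noteq> []" "tgt (last (\<tau> (Plain i))) = src (hd (\<tau> (Plain (Suc i))))"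
        using ne junction Suc.prems False by auto
      then have "g1 (z i) = g2 (z i)"
        using traverses_ends[OF t1] traverses_ends[OF g2(1)] by simp
      then have eq2: "?g t = g2 t" if "z i \<le> t" for t using that by auto
      have "realizes y (Suc i) z \<tau> ?g"
        unfolding realizes_def
      proof
        fix c assume c: "c \<in> {1..Suc i}"
        show "traverses y ?g (z (c - 1)) (z c) (\<tau> (Plain c))"
        proof (cases "c = Suc i")
          case True
          then show ?thesis using traverses_cong[OF _ g2(1), of ?g] eq2 by auto
        next
          case False
          then have "traverses y g1 (z (c - 1)) (z c) (\<tau> (Plain c))" "z c \<le> z i"
            using c g1(1) zmono by (auto simp: realizes_def)
          then show ?thesis by (auto intro: traverses_cong[of _ _ g1])
        qed
      qed
      moreover have "\<forall>t\<in>{z 0..z (Suc i)}. P t (?g t)" using g1(2) g2(2) by auto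
      ultimately show ?thesis by blast
    qed
  qed auto
  then show ?thesis using assms(4) by auto
qed

text \<open>Divide the domain and be affine on each part.\<close>

lemma word_traversal_exists:
  assumes y: "\<forall>d\<in>{1..m}. y (d - 1) < y d" and w: "set w \<subseteq> alphabet m" "legal w" "w \<noteq> []" and ab: "a < b"
  shows "\<exists>g. traverses y g a b w"
  using w ab
proof (induction w arbitrary: a)
  case (Cons c w)
  have one: "\<exists>g. traverses y g a k [c]" if ak: "a < k" for k
  proof -
    define l where "l p q t = p + (t - a) / (k - a) * (q - p)" for p q t :: real
    have cont: "continuous_on S (l p q)" for S p q
      unfolding l_def using ak by (intro continuous_intros) auto
    have lin: "l p q s - l p q t = (s - t) * ((q - p) / (k - a))" for p q s t
    proof -
      have "l p q s - l p q t = ((s - a) / (k - a) - (t - a) / (k - a)) * (q - p)"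
        by (simp add: l_def algebra_simps)
      also have "(s - a) / (k - a) - (t - a) / (k - a) = (s - t) / (k - a)"
        by (simp add: diff_divide_distrib[symmetric])
      finally show ?thesis by simp
    qed
    have inc: "strict_mono_on {a..k} (l p q)" if "p < q" for p q
    proof (rule monotone_onI)
      fix s t :: real assume "s < t"
      then have "0 < (t - s) * ((q - p) / (k - a))" using ak that by (intro mult_pos_pos divide_pos_pos) auto
      then show "l p q s < l p q t" using lin[of p q t s] by linarith
    qed
    have dec: "strict_antimono_on {a..k} (l p q)" if "q < p" for p q
    proof (rule monotone_onI)
      fix s t :: real assume "s < t"
      then have "(t - s) * ((q - p) / (k - a)) < 0" using ak that by (intro mult_pos_neg divide_neg_pos) auto
      then show "l p q t < l p q s" using lin[of p q t s] by linarith
    qed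
    have ends: "l p q a = p" "l p q k = q" for p q using ak by (auto simp: l_def)
    have c: "c \<in> alphabet m" using Cons.prems by auto
    show ?thesis
    proof (cases c)
      case (Plain d)
      then have "y (d - 1) < y d" using y c by (auto simp: alphabet_def)
      then show ?thesis using ak cont inc ends Plain by (intro exI[of _ "l (y (d - 1)) (y d)"]) auto
    next
      case (Barred d)
      then have "y (d - 1) < y d" using y c by (auto simp: alphabet_def)
      then show ?thesis using ak cont dec ends Barred by (intro exI[of _ "l (y d) (y (d - 1))"]) auto
    qed
  qed
  show ?case
  proof (cases "w = []")
    case True
    then show ?thesis using one[of b] Cons.prems by auto
  next
    case False
    define k where "k = (a + b) / 2"
    have "a < k" "k < b" using Cons.prems by (auto simp: k_def)
    obtain g1 where g1: "traverses y g1 a k [c]" using one[OF \<open>a < k\<close>] by blast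
    obtain g2 where g2: "traverses y g2 k b w" using Cons.IH[of k] Cons.prems False \<open>k < b\<close> by auto
    show ?thesis using traverses_glue(1)[OF g1 g2 _ False] Cons.prems False by auto
  qed
qed auto

context subdivision begin

lemma crosses_itin:
  assumes f: "crosses x f a b c" and c: "c \<in> alphabet n"
  shows "finite (crossings f a b) \<and> itin f a b = [c] \<and> f ` {a..b} \<subseteq> {0..1}"
proof -
  obtain d where d: "d \<in> {1..n}" "c = Plain d \<or> c = Barred d" using c by (auto simp: alphabet_def)
  have ab: "a < b" "continuous_on {a..b} f" using crosses_ends[OF f] by auto
  have md: "mid d \<in> Mid" using d by (auto simp: Mid_def)
  have range: "x (d - 1) \<le> f t \<and> f t \<le> x d" if "a \<le> t" "t \<le> b" for t
    using d(2)
  proof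
    assume "c = Plain d"
    then show ?thesis using f strict_mono_on_less[of a b f a t] strict_mono_on_less[of a b f t b] that
      by (cases "t = a"; cases "t = b") auto
  next
    assume "c = Barred d"
    then show ?thesis using f strict_antimono_on_less[of a b f a t] strict_antimono_on_less[of a b f t b] that
      by (cases "t = a"; cases "t = b") auto
  qed
  have inj: "inj_on f {a..b}"
    using d(2) f by (auto intro: strict_mono_on_imp_inj_on simp: strict_antimono_iff_antimono)
  obtain t where t: "a \<le> t" "t \<le> b" "f t = mid d"
    using IVT'[of f a "mid d" b] IVT2'[of f b "mid d" a] ab d f mid_inside[OF d(1)] by auto
  have "t \<noteq> a" "t \<noteq> b" using t d f mid_inside[OF d(1)] by auto
  then have tab: "a < t" "t < b" using t by auto
  have S: "crossings f a b = {t}"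
  proof -
    have "u = t" if u: "u \<in> crossings f a b" for u
    proof -
      obtain e where e: "e \<in> {1..n}" "f u = mid e" using u by (auto simp: crossings_def Mid_def)
      have "mid e \<notin> V" using e Mid_not_V by (auto simp: Mid_def)
      then have "mid e \<noteq> x (d - 1)" "mid e \<noteq> x d" using d x_in[of "d - 1"] x_in[of d] by auto
      moreover have "x (d - 1) \<le> mid e" "mid e \<le> x d" using range[of u] u e by (auto simp: crossings_def)
      ultimately have "e = d" using piece_unique[of e d "mid e"] mid_inside[OF e(1)] e d by auto
      then show ?thesis using inj_onD[OF inj, of u t] e t u by (auto simp: crossings_def)
    qed
    moreover have "t \<in> crossings f a b" using t md by (auto simp: crossings_def)
    ultimately show ?thesis by blast
  qed
  have "letter_at f t = c"
    using d(2)
  proof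
    assume c: "c = Plain d"
    have "letter_at f t = Plain d"
      by (rule letter_at_up[of d f t b, OF d(1) t(3) tab(2)]) (use f c t tab strict_mono_on_less[of a b f t] in auto)
    then show ?thesis using c by simp
  next
    assume c: "c = Barred d"
    have "letter_at f t = Barred d"
      by (rule letter_at_down[of d f t b, OF d(1) t(3) tab(2)]) (use f c t tab strict_antimono_on_less[of a b f t] in auto)
    then show ?thesis using c by simp
  qed
  moreover have "f ` {a..b} \<subseteq> {0..1}"
    using range V_bounds[of "x (d - 1)"] V_bounds[of "x d"] d(1) by fastforce
  ultimately show ?thesis using S itin_single[OF S] by auto
qed

text \<open>For traversals the two ways to read off a word agree.\<close>

lemma traverses_itin:
  assumes "traverses x f a b w" "set w \<subseteq> alphabet n" "w \<noteq> []"
  shows "finite (crossings f a b) \<and> itin f a b = w \<and> f ` {a..b} \<subseteq> {0..1}"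
  using assms
proof (induction w arbitrary: a)
  case (Cons c w)
  then obtain m where m: "crosses x f a m c" "traverses x f m b w" by auto
  have am: "a < m" "m \<le> b" using crosses_ends[OF m(1)] traverses_le[OF m(2)] by auto
  note one = crosses_itin[OF m(1)]
  show ?case
  proof (cases "w = []")
    case True
    then show ?thesis using one m Cons.prems by auto
  next
    case False
    then have IH: "finite (crossings f m b)" "itin f m b = w" "f ` {m..b} \<subseteq> {0..1}"
      using Cons.IH[OF m(2)] Cons.prems by auto
    have S: "crossings f a b = crossings f a m \<union> crossings f m b" using am by (auto simp: crossings_def)
    have "tgt c \<le> n" using Cons.prems by (auto simp: alphabet_def)
    then have "f m \<in> V" using crosses_ends[OF m(1)] by auto
    then have "f m \<notin> Mid" using Mid_not_V by auto
    then have "itin f a b = itin f a m @ itin f m b"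
      using S one IH am Cons.prems by (intro itin_split) auto
    moreover have "{a..b} = {a..m} \<union> {m..b}" using am by auto
    ultimately show ?thesis using S one IH Cons.prems by (auto simp: image_Un)
  qed
qed auto

end

lemma bar_alphabet [simp]: "bar b \<in> alphabet n \<longleftrightarrow> b \<in> alphabet n"
  by (cases b) (auto simp: alphabet_def)

lemma set_word_bar [simp]: "set (word_bar w) \<subseteq> alphabet n \<longleftrightarrow> set w \<subseteq> alphabet n"
  by (auto simp: word_bar_def)

section \<open>Tent maps with periodic critical point\<close>

locale periodic_tent =
  fixes s :: real
  assumes s_param: "s \<in> periodic_params"
begin

abbreviation "T \<equiv> tent s"
abbreviation "N \<equiv> crit_period s"
abbreviation "n \<equiv> num_pieces s"
abbreviation "x \<equiv> orbit_point s"

lemma s_bounds: "1 < s" "s \<le> 2" using s_param by (auto simp: periodic_params_def)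

lemma s_crit: "s * crit s = s - 1" using s_bounds by (simp add: crit_def)

lemma crit_bounds: "0 < crit s" "crit s < 1" using s_bounds by (auto simp: crit_def field_simps)

lemma tent_eq: "T t = 1 - s * \<bar>t - crit s\<bar>"
  using s_crit by (auto simp: tent_def abs_if algebra_simps)

lemma tent_left: "t \<le> crit s \<Longrightarrow> T t = s * t + 2 - s"
  by (simp add: tent_def)

lemma tent_right: "crit s \<le> t \<Longrightarrow> T t = s - s * t"
  using s_crit by (auto simp: tent_eq algebra_simps)

lemma tent_crit [simp]: "T (crit s) = 1" by (simp add: tent_eq)
lemma tent_1 [simp]: "T 1 = 0" using crit_bounds by (simp add: tent_right)
lemma tent_range: assumes t: "0 \<le> t" "t \<le> 1" shows "0 \<le> T t \<and> T t \<le> 1"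
proof
  show "T t \<le> 1" using s_bounds by (simp add: tent_eq)
  show "0 \<le> T t"
  proof (cases "t \<le> crit s")
    case True
    have "0 \<le> s * t" using t s_bounds by simp
    then show ?thesis using tent_left[OF True] s_bounds by simp
  next
    case False
    have "s * t \<le> s" using t s_bounds by (simp add: mult_left_le)
    then show ?thesis using tent_right[of t] False by simp
  qed
qed

lemma tent_iter_range: "0 \<le> t \<Longrightarrow> t \<le> 1 \<Longrightarrow> 0 \<le> (T ^^ k) t \<and> (T ^^ k) t \<le> 1"
  by (induction k) (auto simp: tent_range)

lemma continuous_on_tent: "continuous_on S T"
  unfolding tent_eq by (intro continuous_intros)

lemma continuous_on_tent_iter: "continuous_on S (T ^^ k)"
proof (induction k)
  case (Suc k)
  show ?case
    using continuous_on_compose2[OF continuous_on_tent[of UNIV] Suc] by (simp add: comp_def)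
qed (auto simp: id_def)

lemma tent_less_left: "t < u \<Longrightarrow> u \<le> crit s \<Longrightarrow> T t < T u"
  using s_bounds by (simp add: tent_left)

lemma tent_less_right: "crit s \<le> t \<Longrightarrow> t < u \<Longrightarrow> T u < T t"
  using s_bounds by (simp add: tent_right)

lemma crit_period: "0 < N" "(T ^^ N) (crit s) = crit s"
proof -
  have "\<exists>k. 0 < k \<and> (T ^^ k) (crit s) = crit s" using s_param by (auto simp: periodic_params_def)
  from LeastI_ex[OF this] show "0 < N" "(T ^^ N) (crit s) = crit s" by (auto simp: crit_period_def)
qed

lemma crit_period_least: "0 < k \<Longrightarrow> k < N \<Longrightarrow> (T ^^ k) (crit s) \<noteq> crit s"
  using not_less_Least[of k "\<lambda>k. 0 < k \<and> (T ^^ k) (crit s) = crit s"] by (auto simp: crit_period_def)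

lemma iter_mod: "(T ^^ k) (crit s) = (T ^^ (k mod N)) (crit s)"
proof -
  have "(T ^^ (j * N)) (crit s) = crit s" for j
    by (induction j) (use crit_period in \<open>auto simp: funpow_add\<close>)
  from this[of "k div N"] have "(T ^^ (k mod N + k div N * N)) (crit s) = (T ^^ (k mod N)) (crit s)"
    by (simp only: funpow_add comp_apply)
  then show ?thesis by simp
qed

lemma orbit_eq: "crit_orbit s = (\<lambda>k. (T ^^ k) (crit s)) ` {..<N}"
proof
  show "crit_orbit s \<subseteq> (\<lambda>k. (T ^^ k) (crit s)) ` {..<N}"
    unfolding crit_orbit_def using iter_mod crit_period(1)
    by (auto simp: image_iff intro!: bexI[of _ "_ mod N"])
qed (auto simp: crit_orbit_def)

lemma orbit_T: "v \<in> crit_orbit s \<Longrightarrow> T v \<in> crit_orbit s"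
  unfolding crit_orbit_def by (auto intro: exI[of _ "Suc _"])

lemma orbit_iter: "v \<in> crit_orbit s \<Longrightarrow> (T ^^ k) v \<in> crit_orbit s"
  by (induction k) (auto simp: orbit_T)

lemma orbit_fix: "v \<in> crit_orbit s \<Longrightarrow> (T ^^ N) v = v"
proof -
  assume "v \<in> crit_orbit s"
  then obtain k where k: "v = (T ^^ k) (crit s)" by (auto simp: crit_orbit_def)
  have "(T ^^ N) v = (T ^^ (k + N)) (crit s)" by (simp only: k add.commute[of k] funpow_add comp_apply)
  also have "\<dots> = (T ^^ k) ((T ^^ N) (crit s))" by (simp only: funpow_add comp_apply)
  finally show ?thesis using crit_period(2) k by simp
qed

text \<open>\<open>T\<close> has an inverse on the orbit, namely an iterate of itself.\<close>

lemma orbit_inj: "u \<in> crit_orbit s \<Longrightarrow> v \<in> crit_orbit s \<Longrightarrow> T u = T v \<Longrightarrow> u = v"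
proof -
  assume a: "u \<in> crit_orbit s" "v \<in> crit_orbit s" "T u = T v"
  have "(T ^^ N) u = (T ^^ (N - 1)) (T u)" for u
    using crit_period(1) by (metis Suc_diff_1 comp_apply funpow_Suc_right)
  then show ?thesis using orbit_fix[OF a(1)] orbit_fix[OF a(2)] a(3) by simp
qed

lemma orbit_bounds: "v \<in> crit_orbit s \<Longrightarrow> 0 \<le> v \<and> v \<le> 1"
  using tent_iter_range crit_bounds by (auto simp: crit_orbit_def)

lemma crit_in_orbit: "crit s \<in> crit_orbit s" unfolding crit_orbit_def by (auto intro: exI[of _ 0])
lemma one_in_orbit: "1 \<in> crit_orbit s" using orbit_T[OF crit_in_orbit] by simp
lemma zero_in_orbit: "0 \<in> crit_orbit s" using orbit_T[OF one_in_orbit] by simp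

lemma finite_orbit: "finite (crit_orbit s)" by (simp add: orbit_eq)

lemma card_orbit: "card (crit_orbit s) = N"
proof -
  have "inj_on (\<lambda>k. (T ^^ k) (crit s)) {..<N}"
  proof (rule linorder_inj_onI)
    fix i j assume ij: "i < j" "i \<in> {..<N}" "j \<in> {..<N}"
    show "(T ^^ i) (crit s) \<noteq> (T ^^ j) (crit s)"
    proof
      assume eq: "(T ^^ i) (crit s) = (T ^^ j) (crit s)"
      have "crit s = (T ^^ (N - i + i)) (crit s)" using crit_period(2) ij by simp
      also have "\<dots> = (T ^^ (N - i)) ((T ^^ j) (crit s))" using eq by (simp only: funpow_add comp_apply)
      also have "\<dots> = (T ^^ (j - i + N)) (crit s)"
      proof -
        have "N - i + j = j - i + N" using ij by simp
        then show ?thesis by (metis funpow_add comp_apply)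
      qed
      also have "\<dots> = (T ^^ (j - i)) (crit s)" using crit_period(2) by (simp only: funpow_add comp_apply)
      finally have "(T ^^ (j - i)) (crit s) = crit s" by simp
      moreover have "0 < j - i" "j - i < N" using ij by auto
      ultimately show False using crit_period_least[of "j - i"] by simp
    qed
  qed auto
  then show ?thesis by (simp add: orbit_eq card_image)
qed

lemma N_eq: "N = Suc n" using crit_period(1) by (simp add: num_pieces_def)

lemma sorted_orbit: "sorted_wrt (<) (sorted_list_of_set (crit_orbit s))"
  "length (sorted_list_of_set (crit_orbit s)) = Suc n"
  "set (sorted_list_of_set (crit_orbit s)) = crit_orbit s"
  using finite_orbit card_orbit N_eq by auto

lemma x_mono: "i < j \<Longrightarrow> j \<le> n \<Longrightarrow> x i < x j"
  using sorted_orbit unfolding orbit_point_def by (auto simp: sorted_wrt_iff_nth_less)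

lemma x_image: "x ` {0..n} = crit_orbit s"
proof -
  have "x ` {0..n} = set (sorted_list_of_set (crit_orbit s))"
    using sorted_orbit(2) unfolding orbit_point_def set_conv_nth
    by (auto simp: image_iff less_Suc_eq_le)
  then show ?thesis using sorted_orbit(3) by simp
qed

sublocale subdivision n x
proof
  show "0 < n"
  proof (rule ccontr)
    assume "\<not> 0 < n"
    then have "card (crit_orbit s) = 1" using card_orbit N_eq by simp
    then show False using one_in_orbit zero_in_orbit by (metis card_1_singletonE singletonD zero_neq_one)
  qed
  obtain i where i: "i \<le> n" "x i = 0" using zero_in_orbit x_image by (metis atLeastAtMost_iff image_iff)
  obtain j where j: "j \<le> n" "x j = 1" using one_in_orbit x_image by (metis atLeastAtMost_iff image_iff)
  have bd: "0 \<le> x k \<and> x k \<le> 1" if "k \<le> n" for k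
  proof -
    have "x k \<in> crit_orbit s" using that by (auto simp: x_image[symmetric])
    then show ?thesis by (rule orbit_bounds)
  qed
  show "x 0 = 0" using x_mono[of 0 i] i bd[of 0] by (cases "i = 0") auto
  show "x n = 1" using x_mono[of j n] j bd[of n] by (cases "j = n") auto
qed (use x_mono in auto)

lemma V_eq: "V = crit_orbit s" by (simp add: V_def x_image)

lemma T_V: "v \<in> V \<Longrightarrow> T v \<in> V" using orbit_T V_eq by simp
lemma T_iter_V: "v \<in> V \<Longrightarrow> (T ^^ k) v \<in> V" using orbit_iter V_eq by simp
lemma crit_V: "crit s \<in> V" using crit_in_orbit V_eq by simp

subsection \<open>The permutation of the vertices\<close>

text \<open>The action of the tent map on the indices of the vertices, and the index of the critical point.  All
  combinatorial properties of the substitution are derived from \<open>\<pi>\<close>, which increases up to \<open>\<kappa>\<close> and decreases from there on.\<close>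

definition \<pi> :: "nat \<Rightarrow> nat" where "\<pi> i = (THE j. j \<le> n \<and> x j = T (x i))"
definition \<kappa> :: nat where "\<kappa> = (THE j. j \<le> n \<and> x j = crit s)"

lemma vertex_index: assumes "v \<in> V" shows "\<exists>!j. j \<le> n \<and> x j = v"
proof -
  obtain j where "j \<le> n" "v = x j" using assms V_cases by blast
  then show ?thesis using x_eq_iff by (intro ex1I[of _ j]) auto
qed

lemma \<pi>: "i \<le> n \<Longrightarrow> \<pi> i \<le> n \<and> x (\<pi> i) = T (x i)"
  unfolding \<pi>_def by (rule theI'[OF vertex_index]) (use T_V in auto)

lemma \<kappa>: "\<kappa> \<le> n" "x \<kappa> = crit s"
  using theI'[OF vertex_index[OF crit_V]] unfolding \<kappa>_def by auto

lemma \<pi>_eqI: "i \<le> n \<Longrightarrow> j \<le> n \<Longrightarrow> x j = T (x i) \<Longrightarrow> \<pi> i = j"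
  using \<pi>[of i] x_eq_iff[of "\<pi> i" j] by auto

lemma \<pi>_\<kappa>: "\<pi> \<kappa> = n" using \<pi>_eqI[of \<kappa> n] \<kappa> x_n by auto
lemma \<pi>_n: "\<pi> n = 0" using \<pi>_eqI[of n 0] x_0 x_n by auto

lemma \<kappa>_bounds: "0 < \<kappa>" "\<kappa> < n"
  using \<kappa> crit_bounds x_0 x_n by (metis gr0I less_irrefl, metis le_neq_implies_less less_irrefl)

lemma \<pi>_inj: "i \<le> n \<Longrightarrow> j \<le> n \<Longrightarrow> \<pi> i = \<pi> j \<Longrightarrow> i = j"
  using \<pi>[of i] \<pi>[of j] orbit_inj[of "x i" "x j"] V_eq x_eq_iff[of i j] x_in by metis

lemma \<pi>_left: assumes "i < j" "j \<le> \<kappa>" shows "\<pi> i < \<pi> j"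
proof -
  have b: "i \<le> n" "j \<le> n" using assms \<kappa> by auto
  have "x j \<le> crit s" using x_le_iff[of j \<kappa>] assms \<kappa> b by auto
  then have "T (x i) < T (x j)" using tent_less_left[of "x i" "x j"] x_less[of i j] assms b by auto
  then show ?thesis using \<pi>[of i] \<pi>[of j] b x_less_iff[of "\<pi> i" "\<pi> j"] by auto
qed

lemma \<pi>_right: assumes "\<kappa> \<le> i" "i < j" "j \<le> n" shows "\<pi> j < \<pi> i"
proof -
  have b: "i \<le> n" "j \<le> n" using assms by auto
  have "crit s \<le> x i" using x_le_iff[of \<kappa> i] assms \<kappa> b by auto
  then have "T (x j) < T (x i)" using tent_less_right[of "x i" "x j"] x_less[of i j] assms b by auto
  then show ?thesis using \<pi>[of i] \<pi>[of j] b x_less_iff[of "\<pi> j" "\<pi> i"] by auto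
qed

lemma union_pieces:
  assumes "1 \<le> l" "l + k \<le> n"
  shows "(\<Union>j\<in>{l..l + k}. piece s j) = {x (l - 1)..x (l + k)}"
  using assms
proof (induction k)
  case (Suc k)
  have "{l..l + Suc k} = insert (l + Suc k) {l..l + k}" by auto
  then have "(\<Union>j\<in>{l..l + Suc k}. piece s j) = {x (l + k)..x (l + Suc k)} \<union> {x (l - 1)..x (l + k)}"
    using Suc by (simp add: piece_def)
  moreover have "x (l - 1) \<le> x (l + k)" "x (l + k) \<le> x (l + Suc k)" using Suc.prems by (auto intro!: x_le)
  ultimately show ?case by auto
qed (simp add: piece_def)

lemma tent_image_eq:
  assumes "1 \<le> l" "l + k \<le> n" "T ` piece s i = {x (l - 1)..x (l + k)}"
  shows "tent_image s i = (l, k)"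
  unfolding tent_image_def
proof (rule the_equality)
  show "case (l, k) of (l, k) \<Rightarrow> 1 \<le> l \<and> l + k \<le> n \<and> T ` piece s i = (\<Union>j\<in>{l..l + k}. piece s j)"
    using assms union_pieces[OF assms(1,2)] by simp
  fix r :: "nat \<times> nat"
  assume r: "case r of (l, k) \<Rightarrow> 1 \<le> l \<and> l + k \<le> n \<and> T ` piece s i = (\<Union>j\<in>{l..l + k}. piece s j)"
  obtain l' k' where r': "r = (l', k')" by (cases r)
  have lk: "1 \<le> l'" "l' + k' \<le> n" "{x (l - 1)..x (l + k)} = {x (l' - 1)..x (l' + k')}"
    using r r' union_pieces[of l' k'] assms(3) by auto
  have "x (l - 1) \<le> x (l + k)" using assms by (auto intro!: x_le)
  then have "x (l - 1) = x (l' - 1)" "x (l + k) = x (l' + k')" using lk(3) by (simp_all add: Icc_eq_Icc)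
  then have "l - 1 = l' - 1" "l + k = l' + k'" using assms lk x_eq_iff[of "l - 1" "l' - 1"] x_eq_iff[of "l + k" "l' + k'"] by auto
  then show "r = (l, k)" using r' assms lk by auto
qed

lemma tent_subst_left:
  assumes "1 \<le> i" "i \<le> \<kappa>"
  shows "tent_subst s (Plain i) = map Plain [\<pi> (i - 1) + 1..<\<pi> i + 1]"
proof -
  have b: "i \<le> n" "i - 1 \<le> n" "i - 1 < i" using assms \<kappa> by auto
  have lt: "\<pi> (i - 1) < \<pi> i" using \<pi>_left[of "i - 1" i] assms by auto
  have xc: "x i \<le> crit s" using x_le_iff[of i \<kappa>] assms \<kappa> b by auto
  have xx: "x (i - 1) < x i" using x_less b by auto
  have img: "T ` piece s i = {T (x (i - 1))..T (x i)}"
  proof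
    show "T ` piece s i \<subseteq> {T (x (i - 1))..T (x i)}"
      using xc s_bounds by (auto simp: piece_def tent_left)
    show "{T (x (i - 1))..T (x i)} \<subseteq> T ` piece s i"
      using IVT'[of T "x (i - 1)" _ "x i"] continuous_on_tent xx by (force simp: piece_def)
  qed
  have "tent_image s i = (\<pi> (i - 1) + 1, \<pi> i - \<pi> (i - 1) - 1)"
    by (rule tent_image_eq) (use lt \<pi>[of i] \<pi>[of "i - 1"] b img in auto)
  moreover have "strict_mono_on (piece s i) T"
    by (rule monotone_onI) (use xc tent_less_left in \<open>auto simp: piece_def\<close>)
  moreover have "\<pi> (i - 1) + 1 + (\<pi> i - \<pi> (i - 1) - 1) + 1 = \<pi> i + 1" using lt by simp
  ultimately show ?thesis by (simp only: tent_subst.simps tent_subst_word_def prod.case if_True)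
qed

lemma tent_subst_right:
  assumes "\<kappa> < i" "i \<le> n"
  shows "tent_subst s (Plain i) = map Barred (rev [\<pi> i + 1..<\<pi> (i - 1) + 1])"
proof -
  have b: "i \<le> n" "i - 1 \<le> n" "i - 1 < i" using assms by auto
  have lt: "\<pi> i < \<pi> (i - 1)" using \<pi>_right[of "i - 1" i] assms by auto
  have xc: "crit s \<le> x (i - 1)" using x_le_iff[of \<kappa> "i - 1"] assms \<kappa> b by auto
  have xx: "x (i - 1) < x i" using x_less b by auto
  have img: "T ` piece s i = {T (x i)..T (x (i - 1))}"
  proof
    show "T ` piece s i \<subseteq> {T (x i)..T (x (i - 1))}"
      using xc s_bounds by (auto simp: piece_def tent_right)
    show "{T (x i)..T (x (i - 1))} \<subseteq> T ` piece s i"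
      using IVT2'[of T "x i" _ "x (i - 1)"] continuous_on_tent xx by (force simp: piece_def)
  qed
  have "tent_image s i = (\<pi> i + 1, \<pi> (i - 1) - \<pi> i - 1)"
    by (rule tent_image_eq) (use lt \<pi>[of i] \<pi>[of "i - 1"] b img in auto)
  moreover have "\<not> strict_mono_on (piece s i) T"
  proof
    assume "strict_mono_on (piece s i) T"
    then have "T (x (i - 1)) < T (x i)" by (rule monotone_onD) (use xx in \<open>auto simp: piece_def\<close>)
    then show False using tent_less_right[OF xc xx] by simp
  qed
  moreover have "\<pi> i + 1 + (\<pi> (i - 1) - \<pi> i - 1) + 1 = \<pi> (i - 1) + 1" using lt by simp
  ultimately show ?thesis by (simp only: tent_subst.simps tent_subst_word_def prod.case if_False)
qed

lemma tent_subst_bar: "tent_subst s (bar b) = word_bar (tent_subst s b)"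
  by (cases b) auto

lemma monotone_traverses:
  assumes "continuous_on {a..b} f" "strict_mono_on {a..b} f" "f a = x p" "f b = x q" "a < b" "p < q" "q \<le> n"
  shows "traverses x f a b (map Plain [p + 1..<q + 1])"
  using assms
proof (induction "q - p" arbitrary: p a)
  case (Suc d)
  show ?case
  proof (cases "q = p + 1")
    case True
    then show ?thesis using Suc.prems by auto
  next
    case False
    then have pq: "p + 1 < q" using Suc.prems by auto
    have "x p < x (p + 1)" "x (p + 1) < x q" using pq Suc.prems by (auto intro!: x_less)
    then obtain m where m: "a \<le> m" "m \<le> b" "f m = x (p + 1)"
      using IVT'[of f a "x (p + 1)" b] Suc.prems by auto
    have ne: "m \<noteq> a" "m \<noteq> b" using m Suc.prems \<open>x p < x (p + 1)\<close> \<open>x (p + 1) < x q\<close> by auto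
    have "traverses x f m b (map Plain [(p + 1) + 1..<q + 1])"
      by (rule Suc.hyps(1))
        (use Suc.hyps(2) Suc.prems m ne pq in \<open>auto intro: continuous_on_subset monotone_on_subset\<close>)
    moreover have "crosses x f a m (Plain (p + 1))"
      using Suc.prems m ne by (auto intro: continuous_on_subset monotone_on_subset)
    moreover have "[p + 1..<q + 1] = (p + 1) # [(p + 1) + 1..<q + 1]" using pq by (simp add: upt_conv_Cons)
    ultimately show ?thesis by auto
  qed
qed auto

lemma tent_realizes: "realizes x n x (tent_subst s) T"
  unfolding realizes_def
proof
  fix i assume i: "i \<in> {1..n}"
  have b: "i \<le> n" "i - 1 \<le> n" "i - 1 < i" using i by auto
  have xx: "x (i - 1) < x i" using x_less b by auto
  show "traverses x T (x (i - 1)) (x i) (tent_subst s (Plain i))"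
  proof (cases "i \<le> \<kappa>")
    case True
    have xc: "x i \<le> crit s" using x_le_iff[of i \<kappa>] True \<kappa> b by auto
    have "traverses x T (x (i - 1)) (x i) (map Plain [\<pi> (i - 1) + 1..<\<pi> i + 1])"
      by (rule monotone_traverses)
        (use xc xx b \<pi>[of i] \<pi>[of "i - 1"] \<pi>_left[of "i - 1" i] True i continuous_on_tent tent_less_left in
          \<open>auto simp: monotone_on_def\<close>)
    then show ?thesis using tent_subst_left[of i] True i by simp
  next
    case False
    have xc: "crit s \<le> x (i - 1)" using x_le_iff[of \<kappa> "i - 1"] False \<kappa> b by auto
    have "continuous_on {- x i..- x (i - 1)} (\<lambda>t. T (- t))"
      by (rule continuous_on_compose2[OF continuous_on_tent[of UNIV]]) (auto intro: continuous_intros)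
    then have "traverses x (\<lambda>t. T (- t)) (- x i) (- x (i - 1)) (map Plain [\<pi> i + 1..<\<pi> (i - 1) + 1])"
      by (intro monotone_traverses)
        (use xc xx b \<pi>[of i] \<pi>[of "i - 1"] \<pi>_right[of "i - 1" i] False tent_less_right in
          \<open>auto simp: monotone_on_def\<close>)
    from traverses_uminus[OF this]
    have "traverses x T (x (i - 1)) (x i) (map Barred (rev [\<pi> i + 1..<\<pi> (i - 1) + 1]))"
      by (simp add: word_bar_def rev_map comp_def del: upt_Suc)
    then show ?thesis using tent_subst_right[of i] False i by simp
  qed
qed

lemma tent_subst_set: "b \<in> alphabet n \<Longrightarrow> set (tent_subst s b) \<subseteq> alphabet n \<and> tent_subst s b \<noteq> []"
proof -
  have P: "set (tent_subst s (Plain i)) \<subseteq> alphabet n \<and> tent_subst s (Plain i) \<noteq> []" if "i \<in> {1..n}" for i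
  proof (cases "i \<le> \<kappa>")
    case True
    then show ?thesis using tent_subst_left[of i] that \<pi>[of i] \<pi>_left[of "i - 1" i] by (auto simp: alphabet_def)
  next
    case False
    then have w: "tent_subst s (Plain i) = map Barred (rev [\<pi> i + 1..<\<pi> (i - 1) + 1])"
      and lt: "\<pi> i < \<pi> (i - 1)" "\<pi> (i - 1) \<le> n"
      using tent_subst_right[of i] that \<pi>[of "i - 1"] \<pi>_right[of "i - 1" i] by auto
    show ?thesis unfolding w using lt by (auto simp: alphabet_def simp del: upt_Suc)
  qed
  assume "b \<in> alphabet n"
  then obtain i where i: "i \<in> {1..n}" "b = Plain i \<or> b = bar (Plain i)" by (auto simp: alphabet_def)
  then show ?thesis using P[OF i(1)] tent_subst_bar[of "Plain i"] by (elim disjE) (simp_all del: bar.simps tent_subst.simps)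
qed

end

lemma extend_word_bar:
  assumes "\<forall>b\<in>alphabet n. \<phi> (bar b) = word_bar (\<phi> b)" "set w \<subseteq> alphabet n"
  shows "extend \<phi> (word_bar w) = word_bar (extend \<phi> w)"
  using assms(2) by (induction w) (use assms(1) in auto)

lemma bar_substitution_extend:
  assumes "bar_substitution n m \<phi>" "set w \<subseteq> alphabet n"
  shows "set (extend \<phi> w) \<subseteq> alphabet m" "w \<noteq> [] \<Longrightarrow> extend \<phi> w \<noteq> []"
  using assms(2) by (induction w) (use assms(1) in \<open>auto simp: bar_substitution_def words_def\<close>)

lemma bar_substitution_power:
  assumes "bar_substitution n n \<phi>" "set w \<subseteq> alphabet n"
  shows "set ((extend \<phi> ^^ k) w) \<subseteq> alphabet n" "w \<noteq> [] \<Longrightarrow> (extend \<phi> ^^ k) w \<noteq> []"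
    "(extend \<phi> ^^ k) (word_bar w) = word_bar ((extend \<phi> ^^ k) w)"
proof -
  show set: "set ((extend \<phi> ^^ k) w) \<subseteq> alphabet n" for k
    using assms by (induction k) (auto dest!: bar_substitution_extend)
  then show "w \<noteq> [] \<Longrightarrow> (extend \<phi> ^^ k) w \<noteq> []"
    by (induction k) (use assms(1) bar_substitution_extend(2) in auto)
  show "(extend \<phi> ^^ k) (word_bar w) = word_bar ((extend \<phi> ^^ k) w)"
    by (induction k) (use extend_word_bar[OF _ set] assms(1) in \<open>auto simp: bar_substitution_def\<close>)
qed

lemma extend_power_append: "(extend \<phi> ^^ k) (u @ v) = (extend \<phi> ^^ k) u @ (extend \<phi> ^^ k) v"
  by (induction k) auto

context subdivision begin

text \<open>The end of one letter and the beginning of the next are values of a function at the same point.\<close>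

lemma traverses_legal:
  assumes "traverses x f a b w" "set w \<subseteq> alphabet n"
  shows "legal w"
  using assms
proof (induction w arbitrary: a)
  case (Cons c w)
  then obtain m where m: "crosses x f a m c" "traverses x f m b w" by auto
  have "tgt c = src (hd w)" if "w \<noteq> []"
  proof -
    have "hd w \<in> alphabet n" "c \<in> alphabet n" using Cons.prems that by (auto dest: hd_in_set)
    then have "tgt c \<le> n" "src (hd w) \<le> n" by (auto simp: alphabet_def)
    then show ?thesis
      using crosses_ends[OF m(1)] traverses_ends[OF m(2) that] x_eq_iff by auto
  qed
  then show ?case using Cons.IH[OF m(2)] Cons.prems by auto
qed auto

end

lemma legal_word_bar [simp]: "legal (word_bar w) \<longleftrightarrow> legal w"
proof -
  have "legal (word_bar w)" if "legal w" for w
    using that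
  proof (induction w)
    case (Cons b w)
    then have "word_bar w = [] \<or> tgt (last (word_bar w)) = src (bar b)"
      by (cases w) auto
    then show ?case using Cons by (auto simp: word_bar_def)
  qed auto
  from this[of w] this[of "word_bar w"] show ?thesis by auto
qed

context periodic_tent begin

lemma tent_bar_substitution: "bar_substitution n n (tent_subst s)"
  unfolding bar_substitution_def words_def using tent_subst_set tent_subst_bar by auto

lemma tent_power_traverses:
  assumes "i \<in> {1..n}"
  shows "traverses x (T ^^ k) (x (i - 1)) (x i) ((extend (tent_subst s) ^^ k) [Plain i])"
proof (induction k)
  case 0
  have "x (i - 1) < x i" using assms by (intro x_less) auto
  then show ?case using crosses_id(1)[of x i] by (auto simp: id_def)
next
  case (Suc k)
  have "traverses x (\<lambda>t. T ((T ^^ k) t)) (x (i - 1)) (x i) (extend (tent_subst s) ((extend (tent_subst s) ^^ k) [Plain i]))"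
    by (rule traverses_extend[OF tent_realizes _ Suc])
      (use tent_subst_bar bar_substitution_power(1)[OF tent_bar_substitution, of "[Plain i]"] assms in \<open>auto simp: alphabet_def\<close>)
  then show ?case by (simp add: comp_def)
qed

text \<open>The word is traversed by an actual function, the iterate of the tent map.\<close>

lemma tent_power_legal:
  assumes "b \<in> alphabet n"
  shows "legal ((extend (tent_subst s) ^^ k) [b])"
proof -
  have P: "legal ((extend (tent_subst s) ^^ k) [Plain i])" if "i \<in> {1..n}" for i
    by (rule traverses_legal[OF tent_power_traverses[OF that]])
      (use bar_substitution_power(1)[OF tent_bar_substitution, of "[Plain i]"] that in \<open>auto simp: alphabet_def\<close>)
  obtain i where i: "i \<in> {1..n}" "[b] = [Plain i] \<or> [b] = word_bar [Plain i]" using assms by (auto simp: alphabet_def)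
  moreover have "set [Plain i] \<subseteq> alphabet n" using i by (auto simp: alphabet_def)
  ultimately show ?thesis using P[OF i(1)] bar_substitution_power(3)[OF tent_bar_substitution, of "[Plain i]" k] by fastforce
qed

subsection \<open>Straight junctions\<close>

text \<open>A straight junction at the vertex \<open>r\<close>: the path passes through this vertex without turning.\<close>

definition straight :: "nat \<Rightarrow> letter list \<Rightarrow> bool" where
  "straight r w \<longleftrightarrow> (\<exists>u v. w = u @ [Plain r, Plain (Suc r)] @ v \<or> w = u @ [Barred (Suc r), Barred r] @ v)"

lemma straight_append: "straight r w \<Longrightarrow> straight r (u @ w @ v)"
  unfolding straight_def by (metis append.assoc)

lemma straight_word_bar: "straight r w \<Longrightarrow> straight r (word_bar w)"
proof -
  assume "straight r w"
  then obtain u v where uv: "w = u @ [Plain r, Plain (Suc r)] @ v \<or> w = u @ [Barred (Suc r), Barred r] @ v"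
    by (auto simp: straight_def)
  then have "word_bar w = word_bar v @ [Barred (Suc r), Barred r] @ word_bar u \<or>
     word_bar w = word_bar v @ [Plain r, Plain (Suc r)] @ word_bar u" by auto
  then show ?thesis unfolding straight_def by blast
qed

text \<open>\<open>T\<close> is monotone near every vertex other than the critical point, so it maps a straight passage to a
  straight passage.\<close>

lemma straight_step:
  assumes r: "0 < r" "r < n" "r \<noteq> \<kappa>" and w: "straight r w" "set w \<subseteq> alphabet n"
  shows "straight (\<pi> r) (extend (tent_subst s) w)"
proof -
  have two: "straight (\<pi> r) (tent_subst s (Plain r) @ tent_subst s (Plain (Suc r)))"
  proof (cases "r < \<kappa>")
    case True
    have "\<pi> (r - 1) < \<pi> r" "\<pi> r < \<pi> (Suc r)" using True r by (auto intro!: \<pi>_left)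
    then have "[\<pi> (r - 1) + 1..<\<pi> r + 1] = [\<pi> (r - 1) + 1..<\<pi> r] @ [\<pi> r]"
      "[\<pi> r + 1..<\<pi> (Suc r) + 1] = Suc (\<pi> r) # [\<pi> r + 2..<\<pi> (Suc r) + 1]"
      by (auto simp: upt_conv_Cons)
    then have "tent_subst s (Plain r) @ tent_subst s (Plain (Suc r)) =
      map Plain [\<pi> (r - 1) + 1..<\<pi> r] @ [Plain (\<pi> r), Plain (Suc (\<pi> r))] @ map Plain [\<pi> r + 2..<\<pi> (Suc r) + 1]"
      using tent_subst_left[of r] tent_subst_left[of "Suc r"] True r by (simp del: upt_Suc)
    then show ?thesis unfolding straight_def by blast
  next
    case False
    have "\<pi> r < \<pi> (r - 1)" "\<pi> (Suc r) < \<pi> r" using False r by (auto intro!: \<pi>_right)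
    then have "[\<pi> r + 1..<\<pi> (r - 1) + 1] = Suc (\<pi> r) # [\<pi> r + 2..<\<pi> (r - 1) + 1]"
      "[\<pi> (Suc r) + 1..<\<pi> r + 1] = [\<pi> (Suc r) + 1..<\<pi> r] @ [\<pi> r]"
      by (auto simp: upt_conv_Cons)
    then have "tent_subst s (Plain r) @ tent_subst s (Plain (Suc r)) =
      map Barred (rev [\<pi> r + 2..<\<pi> (r - 1) + 1]) @ [Barred (Suc (\<pi> r)), Barred (\<pi> r)] @ map Barred (rev [\<pi> (Suc r) + 1..<\<pi> r])"
      using tent_subst_right[of r] tent_subst_right[of "Suc r"] False r by (simp del: upt_Suc)
    then show ?thesis unfolding straight_def by blast
  qed
  obtain u v where uv: "w = u @ [Plain r, Plain (Suc r)] @ v \<or> w = u @ word_bar [Plain r, Plain (Suc r)] @ v"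
    using w(1) by (auto simp: straight_def)
  have al: "set [Plain r, Plain (Suc r)] \<subseteq> alphabet n" using r by (auto simp: alphabet_def)
  have bar: "\<forall>b\<in>alphabet n. tent_subst s (bar b) = word_bar (tent_subst s b)" using tent_subst_bar by auto
  have "extend (tent_subst s) (word_bar [Plain r, Plain (Suc r)]) = word_bar (tent_subst s (Plain r) @ tent_subst s (Plain (Suc r)))"
    using extend_word_bar[OF bar al] by simp
  then show ?thesis
    using uv straight_append[OF two] straight_append[OF straight_word_bar[OF two]] by auto
qed

lemma \<pi>_0: "0 < \<pi> 0" "\<pi> 0 < n"
proof -
  have "\<pi> 0 \<noteq> \<pi> n" "\<pi> 0 \<noteq> \<pi> \<kappa>" using \<pi>_inj[of 0 n] \<pi>_inj[of 0 \<kappa>] \<kappa>_bounds n_pos by auto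
  then show "0 < \<pi> 0" "\<pi> 0 < n" using \<pi>_n \<pi>_\<kappa> \<pi>[of 0] by auto
qed

text \<open>On \<open>{\<kappa>..n}\<close> the permutation descends from \<open>n\<close> to \<open>0\<close>; take the first index where it has come down to \<open>r\<close>.\<close>

lemma descent_step:
  assumes "0 \<le> r" "r < n"
  shows "\<exists>b. \<kappa> < b \<and> b \<le> n \<and> \<pi> b \<le> r \<and> r < \<pi> (b - 1)"
proof -
  define b where "b = (LEAST b. \<kappa> \<le> b \<and> \<pi> b \<le> r)"
  have ex: "\<kappa> \<le> n \<and> \<pi> n \<le> r" using \<pi>_n \<kappa> by auto
  have b: "\<kappa> \<le> b" "\<pi> b \<le> r" using LeastI[of "\<lambda>b. \<kappa> \<le> b \<and> \<pi> b \<le> r", OF ex] by (auto simp: b_def)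
  have "b \<le> n" unfolding b_def by (rule Least_le[of "\<lambda>b. \<kappa> \<le> b \<and> \<pi> b \<le> r", OF ex])
  have "b \<noteq> \<kappa>" using b \<pi>_\<kappa> assms by auto
  then have "\<kappa> \<le> b - 1" "b - 1 < b" using b by auto
  then have "r < \<pi> (b - 1)" using not_less_Least[of "b - 1" "\<lambda>b. \<kappa> \<le> b \<and> \<pi> b \<le> r"] by (auto simp: b_def)
  then show ?thesis using b \<open>b \<noteq> \<kappa>\<close> \<open>b \<le> n\<close> by (intro exI[of _ b]) auto
qed

lemma letter_occurs: "i \<in> {1..n} \<Longrightarrow> \<exists>b\<in>{1..n}. Barred i \<in> set (tent_subst s (Plain b))"
proof -
  assume i: "i \<in> {1..n}"
  then have "i - 1 < n" by auto
  then obtain b where b: "\<kappa> < b" "b \<le> n" "\<pi> b \<le> i - 1" "i - 1 < \<pi> (b - 1)" using descent_step[of "i - 1"] by auto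
  then have w: "tent_subst s (Plain b) = map Barred (rev [\<pi> b + 1..<\<pi> (b - 1) + 1])"
    using tent_subst_right[of b] by simp
  have "i \<in> set (rev [\<pi> b + 1..<\<pi> (b - 1) + 1])" using b i by (auto simp del: upt_Suc)
  then have "Barred i \<in> set (tent_subst s (Plain b))" unfolding w set_map by (rule imageI)
  then show ?thesis using b by (intro bexI[of _ b]) auto
qed

lemma letter_occurs_power:
  "i \<in> {1..n} \<Longrightarrow> \<exists>b\<in>alphabet n. Plain i \<in> set ((extend (tent_subst s) ^^ k) [b])"
proof (induction k arbitrary: i)
  case (Suc k)
  obtain b where b: "b \<in> {1..n}" "Barred i \<in> set (tent_subst s (Plain b))" using letter_occurs[OF Suc.prems] by auto
  obtain d where d: "d \<in> alphabet n" "Plain b \<in> set ((extend (tent_subst s) ^^ k) [d])" using Suc.IH[OF b(1)] by auto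
  then obtain u v where "(extend (tent_subst s) ^^ k) [d] = u @ [Plain b] @ v" by (metis split_list append_Cons append_Nil)
  then have "Barred i \<in> set ((extend (tent_subst s) ^^ Suc k) [d])" using b by auto
  then have "Plain i \<in> set (word_bar ((extend (tent_subst s) ^^ Suc k) [d]))" by (force simp: word_bar_def image_iff)
  then have "Plain i \<in> set ((extend (tent_subst s) ^^ Suc k) [bar d])"
    using bar_substitution_power(3)[OF tent_bar_substitution, of "[d]" "Suc k"] d(1) by simp
  then show ?case using d(1) by (intro bexI[of _ "bar d"]) auto
qed (auto simp: alphabet_def)

text \<open>\<open>T 0\<close> has a second preimage, to the right of the critical point.  It is not a vertex since \<open>T\<close> is injective on
  the orbit, so the image of the piece around it passes straight through \<open>T 0\<close>.\<close>

lemma straight_at_\<pi>_0: "\<exists>b\<in>{1..n}. straight (\<pi> 0) (tent_subst s (Plain b))"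
proof -
  obtain b where b: "\<kappa> < b" "b \<le> n" "\<pi> b \<le> \<pi> 0" "\<pi> 0 < \<pi> (b - 1)" using descent_step[of "\<pi> 0"] \<pi>_0 by auto
  have "\<pi> b \<noteq> \<pi> 0" using \<pi>_inj[of b 0] b by auto
  then have lt: "\<pi> b < \<pi> 0" using b by auto
  have "[\<pi> b + 1..<\<pi> (b - 1) + 1] = [\<pi> b + 1..<\<pi> 0] @ [\<pi> 0, Suc (\<pi> 0)] @ [\<pi> 0 + 2..<\<pi> (b - 1) + 1]"
  proof (rule nth_equalityI)
    fix i assume "i < length [\<pi> b + 1..<\<pi> (b - 1) + 1]"
    then show "[\<pi> b + 1..<\<pi> (b - 1) + 1] ! i = ([\<pi> b + 1..<\<pi> 0] @ [\<pi> 0, Suc (\<pi> 0)] @ [\<pi> 0 + 2..<\<pi> (b - 1) + 1]) ! i"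
      using lt b by (auto simp: nth_append nth_Cons' simp del: upt_Suc)
  qed (use lt b in auto)
  then have "tent_subst s (Plain b) = map Barred (rev [\<pi> 0 + 2..<\<pi> (b - 1) + 1]) @ [Barred (Suc (\<pi> 0)), Barred (\<pi> 0)] @ map Barred (rev [\<pi> b + 1..<\<pi> 0])"
    using tent_subst_right[of b] b by (simp del: upt_Suc)
  then have "straight (\<pi> 0) (tent_subst s (Plain b))" unfolding straight_def by blast
  then show ?thesis using b by (intro bexI[of _ b]) auto
qed

lemma \<pi>_iter: "i \<le> n \<Longrightarrow> (\<pi> ^^ k) i \<le> n \<and> x ((\<pi> ^^ k) i) = (T ^^ k) (x i)"
  by (induction k) (use \<pi> in auto)

text \<open>The critical orbit starts with \<open>c, 1, 0, T 0\<close>.  Hence every vertex other than \<open>0\<close> and \<open>1\<close> is reached from \<open>T 0\<close>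
  before the orbit closes up, that is, before it has passed through the critical point again.\<close>

lemma vertex_orbit:
  assumes "0 < r" "r < n"
  shows "\<exists>k. r = (\<pi> ^^ k) (\<pi> 0) \<and> (\<forall>j<k. (\<pi> ^^ j) (\<pi> 0) \<noteq> \<kappa> \<and> 0 < (\<pi> ^^ j) (\<pi> 0) \<and> (\<pi> ^^ j) (\<pi> 0) < n)"
proof -
  have "x r \<in> crit_orbit s" using x_in[of r] assms V_eq by auto
  then obtain k0 where k0: "x r = (T ^^ k0) (crit s)" by (auto simp: crit_orbit_def)
  \<comment> \<open>the three steps from the critical point over \<open>1\<close> and \<open>0\<close> to \<open>T 0\<close>\<close>
  have three: "(T ^^ 3) (crit s) = x (\<pi> 0)"
    using \<pi>[of 0] x_0 by (simp add: numeral_3_eq_3)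
  have "(T ^^ (k0 + 3 * N)) (crit s) = x r"
    using k0 iter_mod[of "k0 + 3 * N"] iter_mod[of k0] by simp
  moreover have "k0 + 3 * N = (k0 + 3 * N - 3) + 3" using crit_period(1) by simp
  ultimately have "x r = (T ^^ (k0 + 3 * N - 3)) (x (\<pi> 0))" using three by (metis funpow_add comp_apply)
  then have "x r = x ((\<pi> ^^ (k0 + 3 * N - 3)) (\<pi> 0))" using \<pi>_iter[of "\<pi> 0"] \<pi>[of 0] by auto
  then have ex: "r = (\<pi> ^^ (k0 + 3 * N - 3)) (\<pi> 0)"
    using x_eq_iff[of r "(\<pi> ^^ (k0 + 3 * N - 3)) (\<pi> 0)"] \<pi>_iter[of "\<pi> 0"] \<pi>[of 0] assms by auto
  define k where "k = (LEAST k. r = (\<pi> ^^ k) (\<pi> 0))"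
  have k: "r = (\<pi> ^^ k) (\<pi> 0)" unfolding k_def by (rule LeastI[of "\<lambda>k. r = (\<pi> ^^ k) (\<pi> 0)", OF ex])
  have least: "r \<noteq> (\<pi> ^^ j) (\<pi> 0)" if "j < k" for j using that not_less_Least unfolding k_def by blast
  have shift: "(\<pi> ^^ (i + j)) (\<pi> 0) = (\<pi> ^^ i) ((\<pi> ^^ j) (\<pi> 0))" for i j by (simp add: funpow_add)
  have zero: "(\<pi> ^^ j) (\<pi> 0) \<noteq> 0" if "j < k" for j
  proof
    assume z: "(\<pi> ^^ j) (\<pi> 0) = 0"
    have "r = (\<pi> ^^ (k - j)) 0" using k shift[of "k - j" j] z that by simp
    moreover have "k - j = Suc (k - j - 1)" using that by simp
    ultimately have "r = (\<pi> ^^ (k - j - 1)) (\<pi> 0)" by (metis comp_apply funpow_Suc_right)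
    then show False using least[of "k - j - 1"] that by auto
  qed
  have en: "(\<pi> ^^ j) (\<pi> 0) \<noteq> n" if "j < k" for j
  proof
    assume z: "(\<pi> ^^ j) (\<pi> 0) = n"
    then have "(\<pi> ^^ Suc j) (\<pi> 0) = 0" using \<pi>_n by simp
    then have "Suc j = k" using zero[of "Suc j"] that by (metis Suc_lessI)
    then show False using k \<open>(\<pi> ^^ Suc j) (\<pi> 0) = 0\<close> assms by simp
  qed
  have kk: "(\<pi> ^^ j) (\<pi> 0) \<noteq> \<kappa>" if "j < k" for j
  proof
    assume z: "(\<pi> ^^ j) (\<pi> 0) = \<kappa>"
    then have "(\<pi> ^^ Suc j) (\<pi> 0) = n" using \<pi>_\<kappa> by simp
    then have "Suc j = k" using en[of "Suc j"] that by (metis Suc_lessI)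
    then show False using k \<open>(\<pi> ^^ Suc j) (\<pi> 0) = n\<close> assms by simp
  qed
  show ?thesis using k zero en kk \<pi>_iter[of "\<pi> 0"] \<pi>[of 0] by (intro exI[of _ k]) (auto simp: le_neq_implies_less)
qed

text \<open>Push the straight junction at \<open>T 0\<close> forward along the orbit to the vertex \<open>r\<close>; to obtain it in all
  higher iterates, find the letter that produces it in the preceding iterates.\<close>

lemma straight_eventually:
  assumes "0 < r" "r < n"
  shows "\<exists>K. \<forall>M\<ge>K. \<exists>b\<in>alphabet n. straight r ((extend (tent_subst s) ^^ M) [b])"
proof -
  obtain k where k: "r = (\<pi> ^^ k) (\<pi> 0)"
    "\<forall>j<k. (\<pi> ^^ j) (\<pi> 0) \<noteq> \<kappa> \<and> 0 < (\<pi> ^^ j) (\<pi> 0) \<and> (\<pi> ^^ j) (\<pi> 0) < n"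
    using vertex_orbit[OF assms] by blast
  obtain i where i: "i \<in> {1..n}" "straight (\<pi> 0) (tent_subst s (Plain i))" using straight_at_\<pi>_0 by auto
  have ial: "set [Plain i] \<subseteq> alphabet n" using i by (auto simp: alphabet_def)
  have st: "straight ((\<pi> ^^ j) (\<pi> 0)) ((extend (tent_subst s) ^^ Suc j) [Plain i])" if "j \<le> k" for j
    using that
  proof (induction j)
    case (Suc j)
    have "set ((extend (tent_subst s) ^^ Suc j) [Plain i]) \<subseteq> alphabet n"
      by (rule bar_substitution_power(1)[OF tent_bar_substitution ial])
    then have "straight (\<pi> ((\<pi> ^^ j) (\<pi> 0))) (extend (tent_subst s) ((extend (tent_subst s) ^^ Suc j) [Plain i]))"
      by (intro straight_step) (use Suc k(2) in auto)
    then show ?case by simp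
  qed (use i in simp)
  show ?thesis
  proof (intro exI[of _ "Suc k"] allI impI)
    fix M assume M: "Suc k \<le> M"
    obtain b where b: "b \<in> alphabet n" "Plain i \<in> set ((extend (tent_subst s) ^^ (M - Suc k)) [b])"
      using letter_occurs_power[OF i(1)] by blast
    then obtain u v where uv: "(extend (tent_subst s) ^^ (M - Suc k)) [b] = u @ [Plain i] @ v"
      by (metis split_list append_Cons append_Nil)
    have "M = Suc k + (M - Suc k)" using M by simp
    then have "(extend (tent_subst s) ^^ M) [b] = (extend (tent_subst s) ^^ Suc k) (u @ [Plain i] @ v)"
      using uv by (metis funpow_add comp_apply)
    also have "\<dots> = (extend (tent_subst s) ^^ Suc k) u @ (extend (tent_subst s) ^^ Suc k) [Plain i] @ (extend (tent_subst s) ^^ Suc k) v"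
      by (simp only: extend_power_append)
    finally have "straight r ((extend (tent_subst s) ^^ M) [b])"
      using straight_append[OF st[of k]] k(1) by simp
    then show "\<exists>b\<in>alphabet n. straight r ((extend (tent_subst s) ^^ M) [b])" using b by auto
  qed
qed

end

section \<open>The inverse limit\<close>

lemma continuous_on_coordinate: "continuous_on S (\<lambda>z::nat \<Rightarrow> real. z i)"
  using continuous_on_product_coordinates[of i] by (rule continuous_on_subset) simp

lemma connected_real_between:
  assumes "connected (D :: real set)" "a \<in> D" "b \<in> D" "a \<le> t" "t \<le> b"
  shows "t \<in> D"
  using connectedD_interval[OF assms] .

context periodic_tent begin

definition X :: "(nat \<Rightarrow> real) set" where
  "X = {z. (\<forall>i. z i \<in> {0..1}) \<and> (\<forall>i. T (z (Suc i)) = z i)}"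

lemma tent_inverse_limit_eq: "tent_inverse_limit s = top_of_set X"
proof -
  have "product_topology (\<lambda>_. top_of_set {0..1::real}) (UNIV :: nat set) =
     subtopology (product_topology (\<lambda>_. euclidean) UNIV) (PiE UNIV (\<lambda>_. {0..1}))"
    by (simp add: subtopology_product_topology)
  also have "product_topology (\<lambda>_. euclidean :: real topology) (UNIV :: nat set) = euclidean"
    by (simp add: euclidean_product_topology)
  finally have "tent_inverse_limit s = top_of_set (PiE UNIV (\<lambda>_. {0..1}) \<inter>
       {z. (\<forall>i. z i \<in> {0..1}) \<and> (\<forall>i\<ge>1. T (z i) = z (i - 1))})"
    by (simp add: tent_inverse_limit_def subtopology_subtopology)
  also have "PiE UNIV (\<lambda>_. {0..1}) \<inter> {z. (\<forall>i. z i \<in> {0..1}) \<and> (\<forall>i\<ge>1. T (z i) = z (i - 1))} = X"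
  proof -
    have "(\<forall>i\<ge>1. T (z i) = z (i - 1)) \<longleftrightarrow> (\<forall>i. T (z (Suc i)) = z i)" for z :: "nat \<Rightarrow> real"
    proof
      assume a: "\<forall>i\<ge>1. T (z i) = z (i - 1)"
      show "\<forall>i. T (z (Suc i)) = z i"
      proof
        fix i show "T (z (Suc i)) = z i" using a[rule_format, of "Suc i"] by simp
      qed
    next
      assume a: "\<forall>i. T (z (Suc i)) = z i"
      show "\<forall>i\<ge>1. T (z i) = z (i - 1)"
      proof (intro allI impI)
        fix i :: nat assume "1 \<le> i"
        then show "T (z i) = z (i - 1)" using a[rule_format, of "i - 1"] by simp
      qed
    qed
    then show ?thesis by (auto simp: X_def)
  qed
  finally show ?thesis .
qed

lemma X_bounds: "z \<in> X \<Longrightarrow> 0 \<le> z i \<and> z i \<le> 1" by (auto simp: X_def)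

lemma X_iter: "z \<in> X \<Longrightarrow> (T ^^ k) (z (i + k)) = z i"
proof (induction k)
  case (Suc k)
  have "(T ^^ Suc k) (z (i + Suc k)) = (T ^^ k) (T (z (Suc (i + k))))" by (simp add: funpow_swap1)
  then show ?case using Suc by (simp add: X_def)
qed simp

lemma X_iter': "z \<in> X \<Longrightarrow> i \<le> j \<Longrightarrow> (T ^^ (j - i)) (z j) = z i"
  using X_iter[of z "j - i" i] by simp

lemma X_V: "z \<in> X \<Longrightarrow> i \<le> j \<Longrightarrow> z j \<in> V \<Longrightarrow> z i \<in> V"
  using X_iter'[of z i j] T_iter_V by metis

lemma X_eqI: "z \<in> X \<Longrightarrow> z' \<in> X \<Longrightarrow> (\<And>i. \<exists>j\<ge>i. z j = z' j) \<Longrightarrow> z = z'"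
  using X_iter' by (metis ext)

lemma compact_X: "compact X"
proof -
  have "compactin (product_topology (\<lambda>_. euclidean :: real topology) (UNIV :: nat set)) (PiE UNIV (\<lambda>_. {0..1}))"
    by (simp add: compactin_PiE)
  then have cube: "compact (PiE (UNIV :: nat set) (\<lambda>_. {0..1::real}))"
    by (simp add: euclidean_product_topology)
  have "closed {z :: nat \<Rightarrow> real. \<forall>i. T (z (Suc i)) = z i}"
    by (intro closed_Collect_all closed_Collect_eq continuous_on_coordinate
        continuous_on_compose2[OF continuous_on_tent[of UNIV]]) auto
  moreover have "X = PiE UNIV (\<lambda>_. {0..1}) \<inter> {z. \<forall>i. T (z (Suc i)) = z i}"
    by (auto simp: X_def)
  ultimately show ?thesis using cube by (simp add: compact_Int_closed)
qed

text \<open>The decreasing inverse branch of \<open>T\<close>.  It is defined on all of \<open>{0..1}\<close>.\<close>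

definition R :: "real \<Rightarrow> real" where "R t = (s - t) / s"

lemma R: "0 \<le> t \<Longrightarrow> t \<le> 1 \<Longrightarrow> 0 \<le> R t \<and> R t \<le> 1 \<and> T (R t) = t"
proof -
  assume t: "0 \<le> t" "t \<le> 1"
  have "crit s \<le> R t" using t s_bounds by (simp add: R_def crit_def divide_right_mono)
  moreover have "R t \<le> 1" using t s_bounds by (simp add: R_def)
  ultimately show ?thesis using crit_bounds s_bounds by (auto simp: tent_right R_def)
qed

text \<open>A continuous section of the \<open>j\<close>-th coordinate: the thread with \<open>j\<close>-th coordinate \<open>t\<close> whose higher coordinates are
  obtained by always taking the decreasing branch.\<close>

definition L :: "nat \<Rightarrow> real \<Rightarrow> nat \<Rightarrow> real" where
  "L j t i = (if i \<le> j then (T ^^ (j - i)) t else (R ^^ (i - j)) t)"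

lemma R_iter: "0 \<le> t \<Longrightarrow> t \<le> 1 \<Longrightarrow> 0 \<le> (R ^^ k) t \<and> (R ^^ k) t \<le> 1"
  by (induction k) (auto simp: R)

lemma L_self [simp]: "L j t j = t" by (simp add: L_def)

lemma L_in_X: assumes "0 \<le> t" "t \<le> 1" shows "L j t \<in> X"
proof -
  have "T (L j t (Suc i)) = L j t i" for i
  proof (cases "Suc i \<le> j")
    case True
    then have "j - i = Suc (j - Suc i)" by simp
    then show ?thesis using True by (simp add: L_def)
  next
    case False
    then have "Suc i - j = Suc (i - j)" by simp
    then have "T (L j t (Suc i)) = (R ^^ (i - j)) t"
      using False R[of "(R ^^ (i - j)) t"] R_iter[OF assms] by (simp add: L_def)
    then show ?thesis using False by (auto simp: L_def not_le le_less_Suc_eq)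
  qed
  then show ?thesis using tent_iter_range[OF assms] R_iter[OF assms] by (auto simp: X_def L_def)
qed

lemma continuous_on_L: "continuous_on S (L j)"
proof -
  have R: "continuous_on UNIV (R ^^ k)" for k
  proof (induction k)
    case (Suc k)
    have "continuous_on UNIV R" using s_bounds unfolding R_def by (intro continuous_intros) auto
    from continuous_on_compose2[OF this Suc] show ?case by (simp add: comp_def)
  qed (auto simp: id_def)
  have "continuous_on S (\<lambda>t. L j t i)" for i
    using continuous_on_tent_iter[of S] continuous_on_subset[OF R, of S] by (cases "i \<le> j") (auto simp: L_def)
  then show ?thesis by (rule continuous_on_coordinatewise_then_product)
qed

lemma L_low: "i \<le> j \<Longrightarrow> L j t i = (T ^^ (j - i)) t" by (simp add: L_def)

text \<open>The higher coordinates avoid the vertices as well, in particular the critical point, so by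
  connectedness they stay on one side of it, where \<open>T\<close> is injective.\<close>

lemma coordinate_inj_on_connected:
  assumes C: "connected C" "C \<subseteq> X" "\<And>z. z \<in> C \<Longrightarrow> z j \<notin> V"
    and z: "z \<in> C" "z' \<in> C" "z j = z' j"
  shows "z = z'"
proof -
  have "z (j + i) = z' (j + i)" for i
  proof (induction i)
    case (Suc i)
    let ?k = "Suc (j + i)"
    have con: "connected ((\<lambda>z. z ?k) ` C)"
      by (rule connected_continuous_image[OF continuous_on_coordinate C(1)])
    have noc: "w ?k \<noteq> crit s" if "w \<in> C" for w
      using X_V[of w j ?k] C that crit_V by auto
    have crit: "crit s \<notin> (\<lambda>z. z ?k) ` C" using noc by force
    have same: "(z ?k < crit s \<and> z' ?k < crit s) \<or> (crit s < z ?k \<and> crit s < z' ?k)"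
      using connected_real_between[OF con, of "z ?k" "z' ?k" "crit s"]
        connected_real_between[OF con, of "z' ?k" "z ?k" "crit s"] z crit noc[of z] noc[of z'] by force
    have "z \<in> X" "z' \<in> X" using C(2) z by auto
    then have "T (z ?k) = z (j + i)" "T (z' ?k) = z' (j + i)" by (simp_all add: X_def)
    then have T: "T (z ?k) = T (z' ?k)" using Suc by simp
    show ?case
      using same T tent_less_left[of "z ?k" "z' ?k"] tent_less_left[of "z' ?k" "z ?k"]
        tent_less_right[of "z ?k" "z' ?k"] tent_less_right[of "z' ?k" "z ?k"]
      by (cases "z ?k" "z' ?k" rule: linorder_cases) auto
  qed (use z in simp)
  then have "\<exists>k\<ge>i. z k = z' k" for i by (intro exI[of _ "j + i"]) simp
  then show ?thesis using C(2) z by (intro X_eqI) auto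
qed

definition arc :: "(real \<Rightarrow> nat \<Rightarrow> real) \<Rightarrow> real \<Rightarrow> real \<Rightarrow> bool" where
  "arc \<omega> a b \<longleftrightarrow> continuous_on {a..b} \<omega> \<and> inj_on \<omega> {a..b} \<and> \<omega> ` {a..b} \<subseteq> X"

lemma arc_subinterval: "arc \<omega> a b \<Longrightarrow> a \<le> a' \<Longrightarrow> b' \<le> b \<Longrightarrow> arc \<omega> a' b'"
  unfolding arc_def by (meson atLeastatMost_subset_iff continuous_on_subset image_mono inj_on_subset order_trans)

text \<open>A stretch of the arc that avoids the vertices is a connected set, so the coordinate is injective on it.\<close>

lemma arc_turning:
  assumes "arc \<omega> a b"
  shows "turning (\<lambda>t. \<omega> t j) a b"
  unfolding turning_def
proof (intro conjI allI impI)
  have cont: "continuous_on {a..b} \<omega>" and sub: "\<omega> ` {a..b} \<subseteq> X" using assms by (auto simp: arc_def)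
  show "continuous_on {a..b} (\<lambda>t. \<omega> t j)"
    by (rule continuous_on_compose2[OF continuous_on_coordinate cont]) auto
  show "(\<lambda>t. \<omega> t j) ` {a..b} \<subseteq> {0..1}" using sub X_bounds by (auto simp: image_subset_iff)
  fix u v assume uv: "a \<le> u" "v \<le> b" "\<forall>t\<in>{u..v}. \<omega> t j \<notin> V"
  have s: "{u..v} \<subseteq> {a..b}" using uv by auto
  have con: "connected (\<omega> ` {u..v})"
    by (intro connected_continuous_image continuous_on_subset[OF cont s]) auto
  show "inj_on (\<lambda>t. \<omega> t j) {u..v}"
  proof (rule inj_onI)
    fix p q assume pq: "p \<in> {u..v}" "q \<in> {u..v}" "\<omega> p j = \<omega> q j"
    have "\<omega> p = \<omega> q"
      by (rule coordinate_inj_on_connected[OF con, of j]) (use uv s sub pq in auto)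
    then show "p = q" using assms s pq by (auto simp: arc_def dest: inj_onD)
  qed
qed

lemma arc_L: "0 \<le> a \<Longrightarrow> b \<le> 1 \<Longrightarrow> arc (L j) a b"
  unfolding arc_def using continuous_on_L L_in_X
  by (auto intro!: inj_onI) (metis L_self)

lemma arc_uminus: "arc \<omega> a b \<Longrightarrow> arc (\<lambda>t. \<omega> (- t)) (- b) (- a)"
proof -
  assume a: "arc \<omega> a b"
  have "continuous_on {- b..- a} (\<lambda>t. \<omega> (- t))"
    using a unfolding arc_def by (intro continuous_on_compose2[of "{a..b}" \<omega> _ uminus] continuous_on_minus continuous_on_id) auto
  moreover have "inj_on (\<lambda>t. \<omega> (- t)) {- b..- a}"
    using a unfolding arc_def by (auto intro!: inj_onI dest: inj_onD[of \<omega> "{a..b}" "- _" "- _"])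
  moreover have "(\<lambda>t. \<omega> (- t)) ` {- b..- a} \<subseteq> X" using a unfolding arc_def by (auto simp: image_subset_iff)
  ultimately show ?thesis by (simp add: arc_def)
qed

subsection \<open>The end points\<close>

text \<open>These threads are the end points of the inverse limit.\<close>

definition E :: "(nat \<Rightarrow> real) set" where "E = {z \<in> X. \<forall>i. z i \<in> V}"

lemma T_period_V: "v \<in> V \<Longrightarrow> (T ^^ (N * k)) v = v"
proof (induction k)
  case (Suc k)
  have "N * Suc k = N * k + N" by simp
  then have "(T ^^ (N * Suc k)) v = (T ^^ (N * k)) ((T ^^ N) v)" by (simp only: funpow_add comp_apply)
  then show ?case using Suc orbit_fix V_eq by simp
qed simp

text \<open>\<open>T\<close> permutes \<open>V\<close> with period \<open>N\<close>, so \<open>T ^^ (N - 1)\<close> is its inverse there.\<close>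

lemma E_exists:
  assumes "v \<in> V"
  shows "\<exists>e\<in>E. e k = v"
proof -
  define e where "e i = (T ^^ ((N - 1) * i + k)) v" for i
  have "T (e (Suc i)) = e i" for i
  proof -
    have "Suc ((N - 1) * Suc i + k) = ((N - 1) * i + k) + N * 1" using crit_period(1) by simp
    then have "T (e (Suc i)) = (T ^^ ((N - 1) * i + k)) ((T ^^ (N * 1)) v)"
      unfolding e_def by (metis comp_apply funpow.simps(2) funpow_add)
    then show ?thesis using T_period_V[OF assms, of 1] by (simp add: e_def)
  qed
  moreover have "e i \<in> V" for i using T_iter_V[OF assms] by (simp add: e_def)
  ultimately have "e \<in> E" using V_bounds by (auto simp: E_def X_def)
  moreover have "e k = v"
  proof -
    have "(N - 1) * k + k = N * k" using crit_period(1) by (cases N) auto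
    then show ?thesis using T_period_V[OF assms, of k] by (simp add: e_def)
  qed
  ultimately show ?thesis by auto
qed

lemma V_gap: assumes "u \<in> V" "v \<in> V" "u < v" shows "u + 8 * mesh \<le> v"
proof -
  obtain i where i: "i \<le> n" "u = x i" using assms V_cases by blast
  obtain j where j: "j \<le> n" "v = x j" using assms V_cases by blast
  have "i < j" using i j assms x_less_iff by auto
  then have "x i + 8 * mesh \<le> x (Suc i)" "x (Suc i) \<le> x j" using mesh_gap[of i] x_le[of "Suc i" j] j by auto
  then show ?thesis using i j by auto
qed

text \<open>A short one-sided neighbourhood of a vertex is mapped affinely onto a one-sided neighbourhood of the
  image, because it contains no critical point in its interior; \<open>\<epsilon>\<close> records the side.\<close>

lemma germ:
  "\<exists>\<epsilon>\<in>{1, -1}. \<forall>u\<ge>0. s ^ k * u \<le> mesh \<longrightarrow> (T ^^ k) (1 - u) = (T ^^ k) 1 + \<epsilon> * (s ^ k * u)"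
proof (induction k)
  case 0
  show ?case by (rule bexI[of _ "-1"]) auto
next
  case (Suc k)
  then obtain \<epsilon> where e0: "\<epsilon> \<in> {1, -1}"
    "\<forall>u\<ge>0. s ^ k * u \<le> mesh \<longrightarrow> (T ^^ k) (1 - u) = (T ^^ k) 1 + \<epsilon> * (s ^ k * u)" by blast
  then have e: "\<epsilon> = 1 \<or> \<epsilon> = -1"
    "\<And>u. 0 \<le> u \<Longrightarrow> s ^ k * u \<le> mesh \<Longrightarrow> (T ^^ k) (1 - u) = (T ^^ k) 1 + \<epsilon> * (s ^ k * u)" by blast+
  define w where "w = (T ^^ k) 1"
  have wV: "w \<in> V" unfolding w_def by (rule T_iter_V) simp
  \<comment> \<open>the image lies on the other side exactly if \<open>w\<close> is right of the critical point; at the critical point it lies below \<open>1\<close>\<close>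
  define \<delta> :: real where "\<delta> = (if w < crit s then \<epsilon> else if w = crit s then -1 else - \<epsilon>)"
  show ?case
  proof (rule bexI[of _ \<delta>])
    show "\<delta> \<in> {1, -1}" using e(1) by (auto simp: \<delta>_def)
    show "\<forall>u\<ge>0. s ^ Suc k * u \<le> mesh \<longrightarrow> (T ^^ Suc k) (1 - u) = (T ^^ Suc k) 1 + \<delta> * (s ^ Suc k * u)"
    proof (intro allI impI)
      fix u :: real assume u: "0 \<le> u" "s ^ Suc k * u \<le> mesh"
      define d where "d = s ^ k * u"
      have d0: "0 \<le> d" using u s_bounds by (simp add: d_def)
      have sd: "s * d \<le> mesh" using u by (simp add: d_def algebra_simps)
      have "d \<le> s * d" using d0 s_bounds by (simp add: mult_le_cancel_right1)
      then have dm: "d \<le> mesh" using sd by simp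
      have "(T ^^ k) (1 - u) = w + \<epsilon> * d" using e(2)[OF u(1)] dm by (simp add: d_def w_def)
      then have 1: "(T ^^ Suc k) (1 - u) = 1 - s * \<bar>w + \<epsilon> * d - crit s\<bar>" by (simp add: tent_eq)
      have 2: "(T ^^ Suc k) 1 = 1 - s * \<bar>w - crit s\<bar>" by (simp add: tent_eq w_def)
      have "\<bar>w + \<epsilon> * d - crit s\<bar> = \<bar>w - crit s\<bar> - \<delta> * d"
        using e(1) d0 dm V_gap[OF wV crit_V] V_gap[OF crit_V wV] mesh_pos
        by (auto simp: \<delta>_def abs_if)
      then have "(T ^^ Suc k) (1 - u) = 1 - s * (\<bar>w - crit s\<bar> - \<delta> * d)" by (simp only: 1)
      then have "(T ^^ Suc k) (1 - u) = (T ^^ Suc k) 1 + s * (\<delta> * d)"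
        by (simp only: 2 right_diff_distrib)
      then show "(T ^^ Suc k) (1 - u) = (T ^^ Suc k) 1 + \<delta> * (s ^ Suc k * u)" by (simp add: d_def algebra_simps)
    qed
  qed
qed

lemma T_N_1: "(T ^^ (N * k)) 1 = 1" by (rule T_period_V) simp

lemma mesh_le: "8 * mesh \<le> 1" using V_gap[of 0 1] by simp

lemma s_pos: "0 < s" "s \<noteq> 0" using s_bounds by auto

lemma sN: "1 < s ^ N" using s_bounds crit_period(1) by (simp add: one_less_power)

text \<open>The image of a left neighbourhood of \<open>1\<close> under \<open>T ^^ N\<close> has the end point \<open>1\<close> again, and there is no room to
  the right of \<open>1\<close>.\<close>

lemma germ_N:
  assumes "0 \<le> u" "s ^ N * u \<le> mesh"
  shows "(T ^^ N) (1 - u) = 1 - s ^ N * u"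
proof -
  obtain \<epsilon> where e0: "\<epsilon> \<in> {1, -1}"
    "\<forall>u\<ge>0. s ^ N * u \<le> mesh \<longrightarrow> (T ^^ N) (1 - u) = (T ^^ N) 1 + \<epsilon> * (s ^ N * u)" using germ[of N] by blast
  moreover have "(T ^^ N) 1 = 1" using T_N_1[of 1] by simp
  ultimately have e: "\<epsilon> = 1 \<or> \<epsilon> = -1"
    "\<And>u. 0 \<le> u \<Longrightarrow> s ^ N * u \<le> mesh \<Longrightarrow> (T ^^ N) (1 - u) = 1 + \<epsilon> * (s ^ N * u)" by auto
  define u0 where "u0 = mesh / s ^ N"
  have u0: "0 < u0" "s ^ N * u0 = mesh" using mesh_pos s_pos by (auto simp: u0_def)
  have "u0 \<le> mesh" using sN mesh_pos by (simp add: u0_def divide_le_eq)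
  then have "(T ^^ N) (1 - u0) \<le> 1" using tent_iter_range[of "1 - u0" N] u0 mesh_le by auto
  then have "\<epsilon> = -1" using e(1) e(2)[of u0] u0 mesh_pos by auto
  then show ?thesis using e(2)[OF assms] by simp
qed

lemma germ_iter:
  assumes "0 \<le> u" "u \<le> mesh"
  shows "(T ^^ (N * i)) (1 - u / (s ^ N) ^ i) = 1 - u"
proof (induction i)
  case (Suc i)
  let ?\<rho> = "s ^ N"
  have eq: "?\<rho> * (u / ?\<rho> ^ Suc i) = u / ?\<rho> ^ i" using s_pos by simp
  have "1 \<le> ?\<rho> ^ i" using sN by simp
  then have "u / ?\<rho> ^ i \<le> u / 1" using assms by (intro divide_left_mono) auto
  then have "u / ?\<rho> ^ i \<le> mesh" using assms by simp
  then have "(T ^^ N) (1 - u / ?\<rho> ^ Suc i) = 1 - u / ?\<rho> ^ i"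
    using germ_N[of "u / ?\<rho> ^ Suc i"] eq assms sN by simp
  moreover have "N * Suc i = N * i + N" by simp
  then have "(T ^^ (N * Suc i)) t = (T ^^ (N * i)) ((T ^^ N) t)" for t
    by (simp only: funpow_add comp_apply)
  ultimately show ?case using Suc by simp
qed simp

lemma E_periodic: "e \<in> E \<Longrightarrow> e (k + N * i) = e k"
  using X_iter[of e "N * i" k] T_period_V[of "e (k + N * i)" i] by (auto simp: E_def)

text \<open>Coordinates in \<open>C\<close> near \<open>1\<close> at the levels \<open>k + N * i\<close> are related by the linear germ of \<open>T ^^ N\<close>.
  As \<open>C\<close> projects onto an interval with right end \<open>1\<close> at every such level, it contains threads that agree with
  the linear one up to any prescribed level; compactness does the rest.\<close>

lemma end_thread:
  assumes C: "compact C" "connected C" "C \<subseteq> X" and e: "e \<in> E" "e \<in> C" "e k = 1"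
    and u: "0 < u" "u \<le> mesh" "1 - u \<in> (\<lambda>z. z k) ` C"
  shows "\<exists>z\<in>C. \<forall>i. z (k + N * i) = 1 - u / (s ^ N) ^ i"
proof -
  let ?\<rho> = "s ^ N"
  \<comment> \<open>these sets decrease, since the coordinate at one level determines that at the lower levels\<close>
  define K where "K i = {z \<in> C. z (k + N * i) = 1 - u / ?\<rho> ^ i}" for i
  obtain z0 where z0: "z0 \<in> C" "z0 k = 1 - u" using u by force
  have down: "(T ^^ (N * i)) (z (k + N * i)) = z k" if "z \<in> X" for z i using X_iter[OF that, of "N * i" k] .
  have ne: "K i \<noteq> {}" for i
  proof -
    have con: "connected ((\<lambda>z. z (k + N * i)) ` C)"
      by (rule connected_continuous_image[OF continuous_on_coordinate C(2)])
    have "z0 (k + N * i) \<le> 1 - u / ?\<rho> ^ i"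
    proof (rule ccontr)
      assume neg: "\<not> z0 (k + N * i) \<le> 1 - u / ?\<rho> ^ i"
      define u' where "u' = (1 - z0 (k + N * i)) * ?\<rho> ^ i"
      have pos: "0 < ?\<rho> ^ i" using sN by simp
      have "z0 (k + N * i) = 1 - u' / ?\<rho> ^ i" using s_pos by (simp add: u'_def)
      moreover have "0 \<le> u'" using X_bounds[of z0] z0 C(3) pos by (auto simp: u'_def)
      moreover have "u' < u"
      proof -
        have "1 - z0 (k + N * i) < u / ?\<rho> ^ i" using neg by simp
        then show ?thesis using pos by (simp add: u'_def pos_less_divide_eq)
      qed
      ultimately have "z0 k = 1 - u'" using germ_iter[of u' i] down[of z0 i] z0 C(3) u by auto
      then show False using z0 \<open>u' < u\<close> by simp
    qed
    moreover have "e (k + N * i) = 1" using E_periodic[OF e(1)] e(3) by simp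
    moreover have "1 - u / ?\<rho> ^ i \<le> 1" using u sN by simp
    ultimately have "1 - u / ?\<rho> ^ i \<in> (\<lambda>z. z (k + N * i)) ` C"
      using connected_real_between[OF con, of "z0 (k + N * i)" "e (k + N * i)"] z0 e by auto
    then show ?thesis by (force simp: K_def)
  qed
  have cK: "compact (K i)" for i
  proof -
    have "closed {z :: nat \<Rightarrow> real. z (k + N * i) = 1 - u / ?\<rho> ^ i}"
      by (intro closed_Collect_eq continuous_on_coordinate continuous_on_const)
    moreover have "K i = C \<inter> {z. z (k + N * i) = 1 - u / ?\<rho> ^ i}" by (auto simp: K_def)
    ultimately show ?thesis using C(1) by (simp add: compact_Int_closed)
  qed
  have step: "K (Suc i) \<subseteq> K i" for i
  proof
    fix z assume z: "z \<in> K (Suc i)"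
    have "(T ^^ N) (z (k + N * i + N)) = z (k + N * i)" using X_iter[of z N "k + N * i"] z C(3) by (auto simp: K_def)
    moreover have "z (k + N * i + N) = 1 - u / ?\<rho> ^ Suc i" using z by (simp add: K_def algebra_simps)
    moreover have "?\<rho> * (u / ?\<rho> ^ Suc i) = u / ?\<rho> ^ i" using s_pos by simp
    moreover have "u / ?\<rho> ^ i \<le> mesh"
    proof -
      have "1 \<le> ?\<rho> ^ i" using sN by simp
      then have "u / ?\<rho> ^ i \<le> u" using u by (simp add: divide_le_eq mult_le_cancel_left1)
      then show ?thesis using u by simp
    qed
    ultimately have "z (k + N * i) = 1 - u / ?\<rho> ^ i" using germ_N[of "u / ?\<rho> ^ Suc i"] u sN by simp
    then show "z \<in> K i" using z by (simp add: K_def)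
  qed
  have mono: "K j \<subseteq> K i" if "i \<le> j" for i j using lift_Suc_antimono_le[of K, OF step that] .
  have "C \<inter> (\<Inter>i\<in>UNIV. K i) \<noteq> {}"
  proof (rule compact_imp_fip_image[OF C(1)])
    fix I :: "nat set" assume "finite I"
    then obtain j where j: "\<forall>i\<in>I. i \<le> j" by (metis finite_nat_set_iff_bounded_le)
    obtain z where z: "z \<in> K j" using ne by blast
    then have "z \<in> C" by (simp add: K_def)
    moreover have "z \<in> (\<Inter>i\<in>I. K i)" using z mono j by blast
    ultimately show "C \<inter> (\<Inter>i\<in>I. K i) \<noteq> {}" by blast
  qed (use cK compact_imp_closed in blast)
  then show ?thesis by (auto simp: K_def)
qed

text \<open>Two continua through an end point share the linear threads close to it.\<close>

lemma E_no_cut: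
  assumes e: "e \<in> E" and C: "compact C" "connected C" "C \<subseteq> X" "e \<in> C" "C \<noteq> {e}"
    and D: "compact D" "connected D" "D \<subseteq> X" "e \<in> D" "D \<noteq> {e}"
  shows "C \<inter> D \<noteq> {e}"
proof -
  have diff: "\<exists>z\<in>A. \<exists>k0. \<forall>k\<ge>k0. z k \<noteq> e k" if A: "A \<subseteq> X" "e \<in> A" "A \<noteq> {e}" for A
  proof -
    obtain z where z: "z \<in> A" "z \<noteq> e" using A by auto
    have "\<exists>k0. \<forall>k\<ge>k0. z k \<noteq> e k" using X_eqI[of z e] z A by (metis subsetD)
    then show ?thesis using z by auto
  qed
  obtain z1 k1 where 1: "z1 \<in> C" "\<forall>k\<ge>k1. z1 k \<noteq> e k" using diff[OF C(3-5)] by auto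
  obtain z2 k2 where 2: "z2 \<in> D" "\<forall>k\<ge>k2. z2 k \<noteq> e k" using diff[OF D(3-5)] by auto
  define k0 where "k0 = max k1 k2"
  have "e (k0 + N + 1) \<in> crit_orbit s" using e V_eq by (auto simp: E_def)
  then obtain j where j: "j < N" "e (k0 + N + 1) = (T ^^ j) (crit s)" by (auto simp: orbit_eq)
  \<comment> \<open>chosen such that \<open>k = k0 + N + 1 - b\<close> is a level at which \<open>e\<close> has the coordinate \<open>1\<close>, the image of the critical point\<close>
  define b where "b = N - j + 1"
  define k where "k = k0 + N + 1 - b"
  have kb: "k + b = k0 + N + 1" "k0 \<le> k" using j by (auto simp: k_def b_def)
  have "e k = (T ^^ b) (e (k + b))" using X_iter[of e b k] e by (auto simp: E_def)
  also have "\<dots> = (T ^^ (b + j)) (crit s)" using kb j by (simp add: funpow_add)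
  also have "b + j = 1 + N" using j by (simp add: b_def)
  also have "(T ^^ (1 + N)) (crit s) = 1" using crit_period(2) by simp
  finally have ek: "e k = 1" .
  have "z1 k \<noteq> 1" "z2 k \<noteq> 1" using 1(2) 2(2) kb(2) ek by (auto simp: k0_def)
  moreover have "z1 k \<le> 1" "z2 k \<le> 1" using X_bounds[of z1 k] X_bounds[of z2 k] 1(1) 2(1) C(3) D(3) by auto
  ultimately have "z1 k < 1" "z2 k < 1" by auto
  define u where "u = min mesh (min (1 - z1 k) (1 - z2 k))"
  have u: "0 < u" "u \<le> mesh" "u \<le> 1 - z1 k" "u \<le> 1 - z2 k"
    using mesh_pos \<open>z1 k < 1\<close> \<open>z2 k < 1\<close> by (auto simp: u_def)
  have mem: "1 - u \<in> (\<lambda>z. z k) ` A" if A: "connected A" "e \<in> A" "w \<in> A" "u \<le> 1 - w k" for A w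
    by (rule connected_real_between[of _ "w k" "e k"])
      (use A u ek connected_continuous_image[OF continuous_on_coordinate A(1), of k] in auto)
  obtain y1 where y1: "y1 \<in> C" "\<forall>i. y1 (k + N * i) = 1 - u / (s ^ N) ^ i"
    using end_thread[OF C(1-3) e C(4) ek u(1,2) mem[OF C(2,4) 1(1) u(3)]] by blast
  obtain y2 where y2: "y2 \<in> D" "\<forall>i. y2 (k + N * i) = 1 - u / (s ^ N) ^ i"
    using end_thread[OF D(1-3) e D(4) ek u(1,2) mem[OF D(2,4) 2(1) u(4)]] by blast
  have "y1 = y2"
  proof (rule X_eqI)
    fix i
    have "i \<le> k + N * i" using crit_period(1) by (simp add: trans_le_add2)
    then show "\<exists>j\<ge>i. y1 j = y2 j" using y1(2) y2(2) by (intro exI[of _ "k + N * i"]) auto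
  qed (use y1 y2 C D in auto)
  moreover have "y1 \<noteq> e" using y1(2)[rule_format, of 0] ek u by auto
  ultimately show ?thesis using y1(1) y2(1) by auto
qed

text \<open>Such a thread has a coordinate inside a piece.  The inverse branches chosen by the thread itself lift the whole
  piece to an arc through the thread, which divides this arc into two.\<close>

lemma not_E_cut:
  assumes z: "z \<in> X" "z \<notin> E"
  shows "\<exists>C D. compact C \<and> connected C \<and> C \<subseteq> X \<and> C \<noteq> {z} \<and>
      compact D \<and> connected D \<and> D \<subseteq> X \<and> D \<noteq> {z} \<and> C \<inter> D = {z}"
proof -
  obtain k where k: "z k \<notin> V" using z by (auto simp: E_def)
  then have kV: "z i \<notin> V" if "k \<le> i" for i using X_V[OF z(1) that] by auto
  obtain c where c: "c \<in> {1..n}" "x (c - 1) < z k" "z k < x c"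
    using piece_exists[of "z k"] X_bounds[OF z(1), of k] k by blast
  \<comment> \<open>the coordinates above the level \<open>k\<close> of the lift of \<open>t\<close>, taken on the same side of the critical point as \<open>z\<close>\<close>
  define lf where "lf t i = rec_nat t (\<lambda>i l. if z (k + Suc i) \<le> crit s then (l - 2 + s) / s else (s - l) / s) i" for t i
  have lf0: "lf t 0 = t" for t by (simp add: lf_def)
  have lfS: "lf t (Suc i) = (if z (k + Suc i) \<le> crit s then (lf t i - 2 + s) / s else (s - lf t i) / s)" for t i
    by (simp add: lf_def)
  have Tz: "T (z (k + Suc i)) = z (k + i)" for i using z(1) by (simp add: X_def)
  \<comment> \<open>no vertex separates the lifted coordinate from that of \<open>z\<close>, so the branch chosen by \<open>z\<close> is the right one\<close>
  have B: "\<forall>w\<in>V. (z (k + i) < w \<longrightarrow> lf t i \<le> w) \<and> (w < z (k + i) \<longrightarrow> w \<le> lf t i)" if t: "x (c - 1) \<le> t" "t \<le> x c" for t i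
  proof (induction i)
    case 0
    then show ?case using V_piece[OF _ c(1)] t c by (fastforce simp: lf0)
  next
    case (Suc i)
    let ?y = "z (k + i)" and ?y' = "z (k + Suc i)" and ?l = "lf t i" and ?l' = "lf t (Suc i)"
    have y01: "?y < 1" using X_bounds[OF z(1), of "k + i"] kV[of "k + i"] ends_in_V by (metis le_add1 less_le)
    then have l1: "?l \<le> 1" using Suc ends_in_V by blast
    have yc: "?y' \<noteq> crit s" using kV[of "k + Suc i"] crit_V by auto
    show ?case
    proof
      fix w assume w: "w \<in> V"
      have IH: "?y < T w \<Longrightarrow> ?l \<le> T w" "T w < ?y \<Longrightarrow> T w \<le> ?l" using Suc T_V[OF w] by auto
      show "(?y' < w \<longrightarrow> ?l' \<le> w) \<and> (w < ?y' \<longrightarrow> w \<le> ?l')"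
      proof (cases "?y' < crit s")
        case True
        have l': "s * ?l' = ?l - 2 + s" using True s_bounds by (simp add: lfS)
        have up: "?l' \<le> crit s"
        proof -
          have "s * ?l' \<le> s * crit s" using l' l1 s_crit by simp
          then show ?thesis using s_bounds by simp
        qed
        show ?thesis
        proof (cases "w < crit s")
          case w: True
          have "s * ?l' \<le> s * w" if "?y' < w"
            using IH(1) tent_less_left[OF that] w Tz[of i] l' tent_left[of w] by auto
          moreover have "s * w \<le> s * ?l'" if "w < ?y'"
            using IH(2) tent_less_left[OF that] True Tz[of i] l' tent_left[of w] w by auto
          ultimately show ?thesis using s_bounds by simp
        qed (use up True in auto)
      next
        case False
        then have gt: "crit s < ?y'" using yc by auto
        have l': "s * ?l' = s - ?l" using gt s_bounds by (simp add: lfS)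
        have "s * crit s \<le> s * ?l'" using l' l1 s_crit by simp
        then have lo: "crit s \<le> ?l'" using s_bounds by simp
        show ?thesis
        proof (cases "crit s < w")
          case w: True
          have "s * ?l' \<le> s * w" if "?y' < w"
            using IH(2) tent_less_right[OF _ that] gt Tz[of i] l' tent_right[of w] w by auto
          moreover have "s * w \<le> s * ?l'" if "w < ?y'"
            using IH(1) tent_less_right[OF _ that] w Tz[of i] l' tent_right[of w] by auto
          ultimately show ?thesis using s_bounds by simp
        qed (use lo gt in auto)
      qed
    qed
  qed
  have zpos: "0 < z (k + i)" "z (k + i) < 1" for i
    using X_bounds[OF z(1), of "k + i"] kV[of "k + i"] ends_in_V by (metis le_add1 less_le)+
  have lf01: "0 \<le> lf t i \<and> lf t i \<le> 1" if "x (c - 1) \<le> t" "t \<le> x c" for t i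
    using B[OF that, of i] zpos[of i] ends_in_V by blast
  have lfT: "T (lf t (Suc i)) = lf t i" if t: "x (c - 1) \<le> t" "t \<le> x c" for t i
  proof (cases "z (k + Suc i) < crit s")
    case True
    then have "lf t (Suc i) \<le> crit s" using B[OF t, of "Suc i"] crit_V by auto
    then show ?thesis using True s_bounds by (simp add: tent_left lfS)
  next
    case False
    then have gt: "crit s < z (k + Suc i)" using kV[of "k + Suc i"] crit_V by (metis le_add1 linorder_neqE)
    then have "crit s \<le> lf t (Suc i)" using B[OF t, of "Suc i"] crit_V by auto
    then show ?thesis using gt s_bounds by (simp add: tent_right lfS)
  qed
  have lfz: "lf (z k) i = z (k + i)" for i
  proof (induction i)
    case (Suc i)
    show ?case using Tz[of i] Suc s_bounds
      by (cases "z (k + Suc i) \<le> crit s") (auto simp: lfS tent_left tent_right field_simps)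
  qed (simp add: lf0)
  define M where "M t i = (if i \<le> k then (T ^^ (k - i)) t else lf t (i - k))" for t i
  have MX: "M t \<in> X" if t: "x (c - 1) \<le> t" "t \<le> x c" for t
  proof -
    have t01: "0 \<le> t" "t \<le> 1" using lf01[OF t, of 0] by (auto simp: lf0)
    have "T (M t (Suc i)) = M t i" for i
    proof (cases "Suc i \<le> k")
      case True
      then have "k - i = Suc (k - Suc i)" by simp
      then show ?thesis using True by (simp add: M_def)
    next
      case False
      then have "Suc i - k = Suc (i - k)" by simp
      then show ?thesis using False lfT[OF t, of "i - k"] lf0 by (auto simp: M_def not_le le_less_Suc_eq)
    qed
    then show ?thesis using tent_iter_range[OF t01] lf01[OF t] by (auto simp: X_def M_def)
  qed
  have Mk: "M t k = t" for t by (simp add: M_def)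
  have Mz: "M (z k) = z"
  proof
    fix i show "M (z k) i = z i" using X_iter'[OF z(1), of i k] lfz[of "i - k"] by (auto simp: M_def)
  qed
  have cont: "continuous_on S M" for S
  proof -
    have clf: "continuous_on S (\<lambda>t. lf t i)" for i
    proof (induction i)
      case (Suc i)
      then show ?case unfolding lfS using s_bounds
        by (cases "z (k + Suc i) \<le> crit s") (auto intro!: continuous_intros)
    qed (simp add: lf0 continuous_on_id)
    have "continuous_on S (\<lambda>t. M t i)" for i
      using continuous_on_tent_iter[of S] clf by (cases "i \<le> k") (auto simp: M_def)
    then show ?thesis by (rule continuous_on_coordinatewise_then_product)
  qed
  have inj: "M t = M t' \<Longrightarrow> t = t'" for t t' using Mk by metis
  have sub: "M ` {x (c - 1)..z k} \<subseteq> X" "M ` {z k..x c} \<subseteq> X" using MX c by auto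
  have "M (x (c - 1)) \<noteq> z" "M (x c) \<noteq> z" using inj Mz c by (metis less_irrefl)+
  then have ne: "M ` {x (c - 1)..z k} \<noteq> {z}" "M ` {z k..x c} \<noteq> {z}"
    using c by (metis atLeastAtMost_iff imageI less_imp_le order_refl singletonD)+
  have "M ` {x (c - 1)..z k} \<inter> M ` {z k..x c} = {z}"
  proof
    show "M ` {x (c - 1)..z k} \<inter> M ` {z k..x c} \<subseteq> {z}" using inj Mz by force
    show "{z} \<subseteq> M ` {x (c - 1)..z k} \<inter> M ` {z k..x c}" using Mz c by (auto intro!: image_eqI[of z M "z k"])
  qed
  moreover have "compact (M ` {x (c - 1)..z k})" "compact (M ` {z k..x c})"
    "connected (M ` {x (c - 1)..z k})" "connected (M ` {z k..x c})"
    using cont by (auto intro!: compact_continuous_image connected_continuous_image)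
  ultimately have "compact (M ` {x (c - 1)..z k}) \<and> connected (M ` {x (c - 1)..z k}) \<and> M ` {x (c - 1)..z k} \<subseteq> X \<and>
      M ` {x (c - 1)..z k} \<noteq> {z} \<and> compact (M ` {z k..x c}) \<and> connected (M ` {z k..x c}) \<and> M ` {z k..x c} \<subseteq> X \<and>
      M ` {z k..x c} \<noteq> {z} \<and> M ` {x (c - 1)..z k} \<inter> M ` {z k..x c} = {z}"
    using sub ne by (intro conjI)
  then show ?thesis by (rule exI[of _ "M ` {x (c - 1)..z k}", OF exI[of _ "M ` {z k..x c}"]])
qed

lemma tent_iter_lipschitz: "\<bar>(T ^^ k) t - (T ^^ k) u\<bar> \<le> s ^ k * \<bar>t - u\<bar>"
proof (induction k)
  case (Suc k)
  have "\<bar>T a - T b\<bar> \<le> s * \<bar>a - b\<bar>" for a b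
  proof -
    have "\<bar>T a - T b\<bar> = s * \<bar>\<bar>a - crit s\<bar> - \<bar>b - crit s\<bar>\<bar>"
    proof -
      have "T a - T b = s * (\<bar>b - crit s\<bar> - \<bar>a - crit s\<bar>)" by (simp add: tent_eq algebra_simps)
      then show ?thesis using s_pos by (simp add: abs_mult abs_minus_commute)
    qed
    then show ?thesis using s_bounds by (simp add: mult_left_mono)
  qed
  then have "\<bar>(T ^^ Suc k) t - (T ^^ Suc k) u\<bar> \<le> s * \<bar>(T ^^ k) t - (T ^^ k) u\<bar>" by simp
  also have "\<dots> \<le> s * (s ^ k * \<bar>t - u\<bar>)" using Suc s_bounds by (intro mult_left_mono) auto
  finally show ?case by (simp add: algebra_simps)
qed simp

text \<open>By compactness \<open>f\<close> depends, up to \<open>\<epsilon>\<close>, on finitely many coordinates, and the lower coordinates of a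
  thread are Lipschitz functions of a higher one.\<close>

lemma uniform_levels:
  assumes f: "continuous_on X (f :: (nat \<Rightarrow> real) \<Rightarrow> real)" and eps: "0 < \<epsilon>"
  shows "\<exists>J. \<forall>j\<ge>J. \<exists>\<delta>>0. \<forall>y\<in>X. \<forall>y'\<in>X. \<bar>y j - y' j\<bar> < \<delta> \<longrightarrow> \<bar>f y - f y'\<bar> < \<epsilon>"
proof -
  obtain d where d: "0 < d" "\<And>y y'. y \<in> X \<Longrightarrow> y' \<in> X \<Longrightarrow> dist y y' < d \<Longrightarrow> \<bar>f y - f y'\<bar> < \<epsilon>"
    using compact_uniformly_continuous[OF f compact_X] eps unfolding uniformly_continuous_on_def dist_real_def
    by (metis abs_minus_commute)
  obtain M where M: "(1 / 2 :: real) ^ M < d / 2"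
    using real_arch_pow_inv[of "d / 2" "1 / 2"] d by auto
  \<comment> \<open>the metric of the product enumerates the coordinates by \<open>from_nat\<close>\<close>
  define J where "J = Max ((from_nat :: nat \<Rightarrow> nat) ` {..M})"
  have J: "from_nat m \<le> J" if "m \<le> M" for m unfolding J_def using that by (intro Max_ge) auto
  show ?thesis
  proof (rule exI[of _ J], intro allI impI)
    fix j assume j: "J \<le> j"
    define \<delta> where "\<delta> = d / (8 * s ^ j)"
    have sp: "0 < s ^ k" for k using s_bounds by simp
    have dp: "0 < \<delta>" using d sp by (simp add: \<delta>_def)
    moreover have "\<bar>f y - f y'\<bar> < \<epsilon>" if y: "y \<in> X" "y' \<in> X" "\<bar>y j - y' j\<bar> < \<delta>" for y y'
    proof (rule d(2)[OF y(1,2)])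
      have le: "dist (y (from_nat m)) (y' (from_nat m)) \<le> d / 8" if m: "m \<le> M" for m
      proof -
        let ?l = "from_nat m :: nat"
        have lj: "?l \<le> j" using J[OF m] j by simp
        have "dist (y ?l) (y' ?l) = \<bar>(T ^^ (j - ?l)) (y j) - (T ^^ (j - ?l)) (y' j)\<bar>"
          using X_iter'[OF y(1) lj] X_iter'[OF y(2) lj] by (simp add: dist_real_def)
        also have "\<dots> \<le> s ^ (j - ?l) * \<bar>y j - y' j\<bar>" by (rule tent_iter_lipschitz)
        also have "\<dots> \<le> s ^ j * \<delta>"
          using y(3) s_bounds by (intro mult_mono power_increasing) auto
        also have "\<dots> = d / 8" using s_pos by (simp add: \<delta>_def)
        finally show ?thesis .
      qed
      have "Max {dist (y (from_nat m)) (y' (from_nat m)) |m. m \<le> M} \<le> d / 8"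
      proof (rule Max.boundedI)
        have "{dist (y (from_nat m)) (y' (from_nat m)) |m. m \<le> M} = (\<lambda>m. dist (y (from_nat m)) (y' (from_nat m))) ` {..M}" by auto
        then show "finite {dist (y (from_nat m)) (y' (from_nat m)) |m. m \<le> M}" by simp
      qed (use le in auto)
      then show "dist y y' < d"
        using dist_fun_le_dist_first_terms[of y y' M] M d by linarith
    qed
    ultimately show "\<exists>\<delta>>0. \<forall>y\<in>X. \<forall>y'\<in>X. \<bar>y j - y' j\<bar> < \<delta> \<longrightarrow> \<bar>f y - f y'\<bar> < \<epsilon>" by blast
  qed
qed

end

section \<open>Itineraries of images of arcs\<close>

lemma (in subdivision) itin_letters: "set (itin \<phi> a b) \<subseteq> alphabet n"
proof -
  have "letter_at \<phi> t \<in> alphabet n" if t: "\<phi> t \<in> Mid" for t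
  proof -
    obtain c where c: "c \<in> {1..n}" "\<phi> t = mid c" using t by (auto simp: Mid_def)
    have "(THE c. c \<in> {1..n} \<and> \<phi> t = mid c) = c" using c mid_eq_iff by (intro the_equality) auto
    then show ?thesis using c by (simp add: letter_at_def alphabet_def Let_def)
  qed
  then show ?thesis
    by (cases "finite (crossings \<phi> a b)") (auto simp: itin_def crossings_def)
qed

lemma (in subdivision) near_low:
  assumes "near d y" "c \<in> {1..n}" "d \<le> mesh" "x (c - 1) \<le> y" "y \<le> x c" "y < x (c - 1) + mesh"
  shows "y < x (c - 1) + d"
  using near_piece[OF assms(1,2,4,5)] mesh_piece[OF assms(2)] assms(3,6) mesh_pos by auto

lemma (in subdivision) near_high:
  assumes "near d y" "c \<in> {1..n}" "d \<le> mesh" "x (c - 1) \<le> y" "y \<le> x c" "x c - mesh < y"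
  shows "x c - d < y"
  using near_piece[OF assms(1,2,4,5)] mesh_piece[OF assms(2)] assms(3,6) mesh_pos by auto

locale tent_pair = Y: periodic_tent r + X: periodic_tent s for r s :: real +
  fixes g :: "(nat \<Rightarrow> real) \<Rightarrow> nat \<Rightarrow> real"
  assumes g_cont: "continuous_on Y.X g" and g_inj: "inj_on g Y.X" and g_in: "g ` Y.X \<subseteq> X.X"
begin

abbreviation "m \<equiv> num_pieces r"
abbreviation "y \<equiv> orbit_point r"

text \<open>The level \<open>i\<close> of the image is controlled by the level \<open>j\<close> of the argument: neighbourhoods of the
  vertices are respected, and threads that agree at the level \<open>j\<close> have images that almost agree at the level \<open>i\<close>.\<close>

definition tracks :: "nat \<Rightarrow> real \<Rightarrow> nat \<Rightarrow> real \<Rightarrow> bool" where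
  "tracks j \<delta> i \<epsilon> \<longleftrightarrow> (\<forall>z\<in>Y.X. Y.near \<delta> (z j) \<longrightarrow> X.near \<epsilon> (g z i)) \<and>
     (\<forall>z\<in>Y.X. \<forall>z'\<in>Y.X. z j = z' j \<longrightarrow> \<bar>g z i - g z' i\<bar> < \<epsilon>)"

text \<open>The code of \<open>g\<close> from the level \<open>j\<close> to the level \<open>i\<close>: the itinerary of the image of a particular arc over the piece.
  \<open>itin_leaf_up\<close> shows that every other arc over the piece would do.\<close>

fun \<sigma> :: "nat \<Rightarrow> nat \<Rightarrow> letter \<Rightarrow> letter list" where
  "\<sigma> j i (Plain c) = X.itin (\<lambda>t. g (Y.L j t) i) (y (c - 1)) (y c)"
| "\<sigma> j i (Barred c) = word_bar (X.itin (\<lambda>t. g (Y.L j t) i) (y (c - 1)) (y c))"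

lemma \<sigma>_bar: "\<sigma> j i (bar b) = word_bar (\<sigma> j i b)" by (cases b) auto

lemma arc_g: "Y.arc \<omega> a b \<Longrightarrow> X.arc (\<lambda>t. g (\<omega> t)) a b"
proof -
  assume a: "Y.arc \<omega> a b"
  have "continuous_on {a..b} (\<lambda>t. g (\<omega> t))"
    using a unfolding Y.arc_def by (intro continuous_on_compose2[OF g_cont]) auto
  moreover have "inj_on (\<lambda>t. g (\<omega> t)) {a..b}"
    using comp_inj_on[of \<omega> "{a..b}" g] a g_inj unfolding Y.arc_def by (auto simp: comp_def intro: inj_on_subset)
  ultimately show ?thesis using a g_in unfolding Y.arc_def X.arc_def by auto
qed

text \<open>The arc stays near the vertices, hence so does its image.\<close>

lemma itin_uncrossed:
  assumes tracks: "tracks j \<delta> i \<epsilon>" "0 < \<delta>" "\<delta> \<le> Y.mesh" "\<epsilon> \<le> X.mesh"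
    and arc: "Y.arc \<omega> a b" and ends: "Y.near \<delta> (\<omega> a j)" "Y.near \<delta> (\<omega> b j)"
    and no: "Y.crossings (\<lambda>t. \<omega> t j) a b = {}"
  shows "X.itin (\<lambda>t. g (\<omega> t) i) a b = []"
proof (rule X.itin_eq_NilI)
  fix t assume t: "a \<le> t" "t \<le> b"
  have "Y.near \<delta> (\<omega> t j)"
    using Y.no_crossing_near[OF Y.arc_turning[OF arc, of j] tracks(2,3) ends no t] .
  moreover have "\<omega> t \<in> Y.X" using arc t by (auto simp: Y.arc_def)
  ultimately have "X.near \<epsilon> (g (\<omega> t) i)" using tracks(1) by (auto simp: tracks_def)
  then show "g (\<omega> t) i \<notin> X.Mid" using X.near_not_Mid tracks(4) by blast
qed

text \<open>The arc and the reparametrized section have equal coordinates at the level \<open>j\<close>, so their images are close at the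
  level \<open>i\<close>.  The two ends of the piece that the arc may miss are near vertices and contribute no crossing.\<close>

lemma itin_leaf_up:
  assumes tracks: "tracks j \<delta> i \<epsilon>" "0 < \<delta>" "\<delta> \<le> Y.mesh" "\<epsilon> \<le> X.mesh"
    and c: "c \<in> {1..m}" and arc: "Y.arc \<omega> a b" "a \<le> b"
    and mono: "strict_mono_on {a..b} (\<lambda>t. \<omega> t j)"
    and lo: "y (c - 1) \<le> \<omega> a j" "\<omega> a j < y (c - 1) + \<delta>" and hi: "y c - \<delta> < \<omega> b j" "\<omega> b j \<le> y c"
  shows "X.itin (\<lambda>t. g (\<omega> t) i) a b = \<sigma> j i (Plain c)"
proof -
  define \<phi> where "\<phi> t = \<omega> t j" for t
  define \<psi> where "\<psi> u = g (Y.L j u) i" for u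
  have cV: "y (c - 1) \<in> Y.V" "y c \<in> Y.V" using c by auto
  have y01: "0 \<le> y (c - 1)" "y c \<le> 1" using Y.V_bounds cV by auto
  have ycc: "y (c - 1) < y c" using c by (intro Y.x_less) auto
  have \<phi>le: "\<phi> a \<le> \<phi> t \<and> \<phi> t \<le> \<phi> b" if "a \<le> t" "t \<le> b" for t
    using strict_mono_on_less[OF mono, of a t] strict_mono_on_less[OF mono, of t b] that unfolding \<phi>_def
    by (cases "t = a"; cases "t = b") auto
  have \<phi>01: "0 \<le> \<phi> t \<and> \<phi> t \<le> 1" if "a \<le> t" "t \<le> b" for t
    using \<phi>le[OF that] lo hi y01 by (auto simp: \<phi>_def)
  have \<phi>cont: "continuous_on {a..b} \<phi>"
    using Y.arc_turning[OF arc(1), of j] unfolding \<phi>_def Y.turning_def by auto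
  have nearX: "X.near \<epsilon> (g z i)" if "z \<in> Y.X" "Y.near \<delta> (z j)" for z
    using tracks(1) that by (auto simp: tracks_def)
  have near_lo: "Y.near \<delta> u" if "y (c - 1) \<le> u" "u \<le> \<phi> a" for u
    using that lo cV by (auto simp: Y.near_def \<phi>_def intro!: bexI[of _ "y (c - 1)"])
  have near_hi: "Y.near \<delta> u" if "\<phi> b \<le> u" "u \<le> y c" for u
    using that hi cV by (auto simp: Y.near_def \<phi>_def intro!: bexI[of _ "y c"])
  have arc2: "Y.arc (\<lambda>t. Y.L j (\<phi> t)) a b"
    unfolding Y.arc_def
  proof (intro conjI)
    show "continuous_on {a..b} (\<lambda>t. Y.L j (\<phi> t))"
      by (rule continuous_on_compose2[OF Y.continuous_on_L[of UNIV] \<phi>cont]) auto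
    show "inj_on (\<lambda>t. Y.L j (\<phi> t)) {a..b}"
      using strict_mono_on_imp_inj_on[OF mono] unfolding inj_on_def \<phi>_def by (metis Y.L_self)
    show "(\<lambda>t. Y.L j (\<phi> t)) ` {a..b} \<subseteq> Y.X" using \<phi>01 by (auto intro!: Y.L_in_X)
  qed
  have \<omega>X: "\<omega> t \<in> Y.X" if "a \<le> t" "t \<le> b" for t using arc that by (auto simp: Y.arc_def)
  have near_ends: "X.near X.mesh (g (\<omega> a) i)" "X.near X.mesh (g (\<omega> b) i)"
    "X.near X.mesh (\<psi> (\<phi> a))" "X.near X.mesh (\<psi> (\<phi> b))"
    using nearX[OF \<omega>X[of a]] nearX[OF \<omega>X[of b]] near_lo[of "\<phi> a"] near_hi[of "\<phi> b"] lo hi arc(2)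
      nearX[of "Y.L j (\<phi> a)"] nearX[of "Y.L j (\<phi> b)"] Y.L_in_X \<phi>01
      X.near_mono[OF _ tracks(4)] by (auto simp: \<phi>_def \<psi>_def)
  have tu1: "X.turning (\<lambda>t. g (\<omega> t) i) a b" by (rule X.arc_turning[OF arc_g[OF arc(1)]])
  have tu2: "X.turning (\<lambda>t. \<psi> (\<phi> t)) a b" unfolding \<psi>_def by (rule X.arc_turning[OF arc_g[OF arc2]])
  have tu3: "X.turning \<psi> (y (c - 1)) (y c)"
    unfolding \<psi>_def by (rule X.arc_turning[OF arc_g[OF Y.arc_L]]) (use y01 in auto)
  have lohi: "y (c - 1) \<le> \<phi> a" "\<phi> a \<le> \<phi> b" "\<phi> b \<le> y c" using lo hi \<phi>le[of a] arc(2) by (auto simp: \<phi>_def)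
  have "X.itin (\<lambda>t. g (\<omega> t) i) a b = X.itin (\<lambda>t. \<psi> (\<phi> t)) a b"
  proof (rule X.close_itin_eq[OF tu1 tu2 near_ends])
    fix t assume t: "a \<le> t" "t \<le> b"
    have "\<bar>g (\<omega> t) i - \<psi> (\<phi> t)\<bar> < \<epsilon>"
      using tracks(1) \<omega>X[OF t] Y.L_in_X[of "\<phi> t" j] \<phi>01[OF t] unfolding tracks_def \<psi>_def \<phi>_def by auto
    then show "\<bar>g (\<omega> t) i - \<psi> (\<phi> t)\<bar> < X.mesh" using tracks(4) by simp
  qed
  also have "\<dots> = X.itin \<psi> (\<phi> a) (\<phi> b)"
    by (rule X.itin_compose_mono[OF X.turning_subinterval[OF tu3 lohi(1,3)] near_ends(3,4) \<phi>cont _ arc(2)])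
      (use mono in \<open>simp add: \<phi>_def[abs_def]\<close>)
  also have "\<dots> = X.itin \<psi> (y (c - 1)) (y c)"
  proof -
    have nm: "\<psi> u \<notin> X.Mid" if "Y.near \<delta> u" "0 \<le> u" "u \<le> 1" for u
      using nearX[of "Y.L j u"] that Y.L_in_X X.near_not_Mid[OF _ tracks(4)] by (auto simp: \<psi>_def)
    have "X.itin \<psi> (y (c - 1)) (y c) = X.itin \<psi> (y (c - 1)) (\<phi> a) @ X.itin \<psi> (\<phi> a) (y c)"
      by (rule X.itin_split[OF X.finite_crossings[OF tu3]]) (use lohi nm[of "\<phi> a"] near_lo[of "\<phi> a"] y01 in auto)
    also have "X.itin \<psi> (\<phi> a) (y c) = X.itin \<psi> (\<phi> a) (\<phi> b) @ X.itin \<psi> (\<phi> b) (y c)"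
      by (rule X.itin_split[OF X.finite_crossings[OF X.turning_subinterval[OF tu3]]])
        (use lohi nm[of "\<phi> b"] near_hi[of "\<phi> b"] y01 in auto)
    also have "X.itin \<psi> (y (c - 1)) (\<phi> a) = []"
      by (rule X.itin_eq_NilI) (use nm near_lo lohi y01 in auto)
    also have "X.itin \<psi> (\<phi> b) (y c) = []"
      by (rule X.itin_eq_NilI) (use nm near_hi lohi y01 in auto)
    finally show ?thesis by simp
  qed
  finally show ?thesis by (simp add: \<psi>_def[abs_def])
qed

lemma itin_leaf_down:
  assumes tracks: "tracks j \<delta> i \<epsilon>" "0 < \<delta>" "\<delta> \<le> Y.mesh" "\<epsilon> \<le> X.mesh"
    and c: "c \<in> {1..m}" and arc: "Y.arc \<omega> a b" "a \<le> b"
    and mono: "strict_antimono_on {a..b} (\<lambda>t. \<omega> t j)"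
    and lo: "y (c - 1) \<le> \<omega> b j" "\<omega> b j < y (c - 1) + \<delta>" and hi: "y c - \<delta> < \<omega> a j" "\<omega> a j \<le> y c"
  shows "X.itin (\<lambda>t. g (\<omega> t) i) a b = \<sigma> j i (Barred c)"
proof -
  have "X.itin (\<lambda>t. g (\<omega> (- t)) i) (- b) (- a) = \<sigma> j i (Plain c)"
    by (rule itin_leaf_up[OF tracks c Y.arc_uminus[OF arc(1)]])
      (use arc(2) mono lo hi in \<open>auto simp: monotone_on_def\<close>)
  moreover have "X.near X.mesh (g (\<omega> a) i)" "X.near X.mesh (g (\<omega> b) i)"
  proof -
    have cV: "y (c - 1) \<in> Y.V" "y c \<in> Y.V" using c by auto
    have "Y.near \<delta> (\<omega> b j)" "Y.near \<delta> (\<omega> a j)"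
      using lo hi cV by (auto simp: Y.near_def intro: bexI[of _ "y (c - 1)"] bexI[of _ "y c"])
    moreover have "\<omega> a \<in> Y.X" "\<omega> b \<in> Y.X" using arc by (auto simp: Y.arc_def)
    ultimately show "X.near X.mesh (g (\<omega> a) i)" "X.near X.mesh (g (\<omega> b) i)"
      using tracks X.near_mono[OF _ tracks(4)] by (auto simp: tracks_def)
  qed
  then have "X.itin (\<lambda>t. g (\<omega> (- t)) i) (- b) (- a) = word_bar (X.itin (\<lambda>t. g (\<omega> t) i) a b)"
    by (rule X.itin_uminus[OF X.arc_turning[OF arc_g[OF arc(1)]]])
  ultimately show ?thesis by (metis \<sigma>.simps word_bar_simps(4))
qed

text \<open>Split the arc at the ends of the run through its first crossing.  The part before the run has empty
  itinerary on both sides, the run itself contributes one letter and its substituted word, and the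
  rest is covered by induction on the number of crossings.\<close>

theorem itin_image:
  assumes tracks: "tracks j \<delta> i \<epsilon>" "0 < \<delta>" "\<delta> \<le> Y.mesh" "\<epsilon> \<le> X.mesh"
    and arc: "Y.arc \<omega> a b" "a \<le> b" and ends: "Y.near \<delta> (\<omega> a j)" "Y.near \<delta> (\<omega> b j)"
  shows "X.itin (\<lambda>t. g (\<omega> t) i) a b = extend (\<sigma> j i) (Y.itin (\<lambda>t. \<omega> t j) a b)"
  using arc ends
proof (induction "card (Y.crossings (\<lambda>t. \<omega> t j) a b)" arbitrary: a rule: less_induct)
  case less
  let ?\<phi> = "\<lambda>t. \<omega> t j" and ?\<psi> = "\<lambda>t. g (\<omega> t) i"
  let ?S = "Y.crossings ?\<phi> a b"
  note arc = less.prems(1) and ab = less.prems(2) and ends = less.prems(3,4)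
  have tu: "Y.turning ?\<phi> a b" by (rule Y.arc_turning[OF arc])
  have tuX: "X.turning ?\<psi> a b" by (rule X.arc_turning[OF arc_g[OF arc]])
  have fin: "finite ?S" by (rule Y.finite_crossings[OF tu])
  show ?case
  proof (cases "?S = {}")
    case True
    then show ?thesis using itin_uncrossed[OF tracks arc ends True] Y.itin_Nil[OF fin] by simp
  next
    case False
    define t where "t = Min ?S"
    have t: "t \<in> ?S" "\<And>u. u \<in> ?S \<Longrightarrow> t \<le> u" using fin False by (auto simp: t_def)
    have endsm: "Y.near Y.mesh (?\<phi> a)" "Y.near Y.mesh (?\<phi> b)" using ends tracks(3) Y.near_mono by blast+
    obtain \<alpha> \<beta> c where r: "a \<le> \<alpha>" "\<alpha> < t" "t < \<beta>" "\<beta> \<le> b" "\<alpha> = a \<or> ?\<phi> \<alpha> \<in> Y.V" "\<beta> = b \<or> ?\<phi> \<beta> \<in> Y.V"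
      "c \<in> {1..m}" "?\<phi> t = Y.mid c"
      "\<forall>u\<in>{\<alpha><..<\<beta>}. y (c - 1) < ?\<phi> u \<and> ?\<phi> u < y c"
      "\<forall>u\<in>{\<alpha>..\<beta>}. y (c - 1) \<le> ?\<phi> u \<and> ?\<phi> u \<le> y c"
      "strict_mono_on {\<alpha>..\<beta>} ?\<phi> \<and> ?\<phi> \<alpha> < y (c - 1) + Y.mesh \<and> y c - Y.mesh < ?\<phi> \<beta> \<and> Y.letter_at ?\<phi> t = Plain c \<or>
       strict_antimono_on {\<alpha>..\<beta>} ?\<phi> \<and> ?\<phi> \<beta> < y (c - 1) + Y.mesh \<and> y c - Y.mesh < ?\<phi> \<alpha> \<and> Y.letter_at ?\<phi> t = Barred c"
      by (rule Y.crossing_run[OF tu endsm t(1)]) (rule that)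
    have near\<alpha>\<beta>: "Y.near \<delta> (?\<phi> \<alpha>)" "Y.near \<delta> (?\<phi> \<beta>)" using r(5,6) ends tracks(2) by auto
    have notMid: "?\<phi> \<alpha> \<notin> Y.Mid" "?\<phi> \<beta> \<notin> Y.Mid" using near\<alpha>\<beta> Y.near_not_Mid tracks(3) by blast+
    have arcs: "Y.arc \<omega> a \<alpha>" "Y.arc \<omega> \<alpha> \<beta>" "Y.arc \<omega> \<beta> b"
      using Y.arc_subinterval[OF arc] r(1-4) by auto
    have in\<alpha>\<beta>: "\<omega> \<alpha> \<in> Y.X" "\<omega> \<beta> \<in> Y.X" using arc r(1-4) by (auto simp: Y.arc_def)
    have notMidX: "?\<psi> \<alpha> \<notin> X.Mid" "?\<psi> \<beta> \<notin> X.Mid"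
      using tracks(1) near\<alpha>\<beta> in\<alpha>\<beta> X.near_not_Mid[OF _ tracks(4)] by (auto simp: tracks_def)
    have no: "Y.crossings ?\<phi> a \<alpha> = {}"
    proof -
      have "u \<notin> Y.crossings ?\<phi> a \<alpha>" for u
      proof
        assume u: "u \<in> Y.crossings ?\<phi> a \<alpha>"
        then have "u \<in> ?S" using r(1-4) by (auto simp: Y.crossings_def)
        then show False using t(2)[of u] u r(2) by (auto simp: Y.crossings_def)
      qed
      then show ?thesis by blast
    qed
    have lohi: "y (c - 1) \<le> ?\<phi> \<alpha>" "?\<phi> \<alpha> \<le> y c" "y (c - 1) \<le> ?\<phi> \<beta>" "?\<phi> \<beta> \<le> y c"
      using bspec[OF r(10), of \<alpha>] bspec[OF r(10), of \<beta>] r(2,3) by auto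
    have one: "X.itin ?\<psi> \<alpha> \<beta> = \<sigma> j i (Y.letter_at ?\<phi> t)" and inj: "inj_on ?\<phi> {\<alpha>..\<beta>}"
    proof -
      from r(11) have "X.itin ?\<psi> \<alpha> \<beta> = \<sigma> j i (Y.letter_at ?\<phi> t) \<and> inj_on ?\<phi> {\<alpha>..\<beta>}"
      proof
        assume m: "strict_mono_on {\<alpha>..\<beta>} ?\<phi> \<and> ?\<phi> \<alpha> < y (c - 1) + Y.mesh \<and> y c - Y.mesh < ?\<phi> \<beta> \<and> Y.letter_at ?\<phi> t = Plain c"
        have "X.itin ?\<psi> \<alpha> \<beta> = \<sigma> j i (Plain c)"
          by (rule itin_leaf_up[OF tracks r(7) arcs(2)])
            (use r(2,3) m lohi Y.near_low[OF near\<alpha>\<beta>(1) r(7) tracks(3)] Y.near_high[OF near\<alpha>\<beta>(2) r(7) tracks(3)] in auto)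
        then show ?thesis using m strict_mono_on_imp_inj_on by metis
      next
        assume m: "strict_antimono_on {\<alpha>..\<beta>} ?\<phi> \<and> ?\<phi> \<beta> < y (c - 1) + Y.mesh \<and> y c - Y.mesh < ?\<phi> \<alpha> \<and> Y.letter_at ?\<phi> t = Barred c"
        have "X.itin ?\<psi> \<alpha> \<beta> = \<sigma> j i (Barred c)"
          by (rule itin_leaf_down[OF tracks r(7) arcs(2)])
            (use r(2,3) m lohi Y.near_low[OF near\<alpha>\<beta>(2) r(7) tracks(3)] Y.near_high[OF near\<alpha>\<beta>(1) r(7) tracks(3)] in auto)
        then show ?thesis using m by (metis strict_antimono_iff_antimono)
      qed
      then show "X.itin ?\<psi> \<alpha> \<beta> = \<sigma> j i (Y.letter_at ?\<phi> t)" "inj_on ?\<phi> {\<alpha>..\<beta>}" by auto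
    qed
    have single: "Y.crossings ?\<phi> \<alpha> \<beta> = {t}"
    proof -
      have "u = t" if u: "u \<in> Y.crossings ?\<phi> \<alpha> \<beta>" for u
      proof -
        obtain d where d: "d \<in> {1..m}" "?\<phi> u = Y.mid d" using u by (auto simp: Y.crossings_def Y.Mid_def)
        have "u \<noteq> \<alpha>" "u \<noteq> \<beta>" using u notMid by (auto simp: Y.crossings_def)
        then have ui: "u \<in> {\<alpha><..<\<beta>}" using u by (auto simp: Y.crossings_def)
        have "d = c" using Y.piece_unique[of c d "Y.mid d"] Y.mid_inside[of d] d r(7) bspec[OF r(9) ui] by auto
        then show ?thesis using d r(8) inj_onD[OF inj, of u t] ui r(2,3) by auto
      qed
      moreover have "t \<in> Y.crossings ?\<phi> \<alpha> \<beta>" using t(1) r(2,3) by (auto simp: Y.crossings_def)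
      ultimately show ?thesis by blast
    qed
    have sub: "Y.crossings ?\<phi> \<beta> b \<subseteq> ?S - {t}" using r(1-4) by (auto simp: Y.crossings_def)
    have "card (Y.crossings ?\<phi> \<beta> b) \<le> card (?S - {t})" by (rule card_mono) (use fin sub in auto)
    also have "\<dots> < card ?S" using fin t(1) by (rule card_Diff1_less)
    finally have IH: "X.itin ?\<psi> \<beta> b = extend (\<sigma> j i) (Y.itin ?\<phi> \<beta> b)"
      using less.hyps[of \<beta>] arcs(3) r(4) near\<alpha>\<beta>(2) ends(2) by auto
    have "Y.itin ?\<phi> a b = Y.itin ?\<phi> a \<alpha> @ Y.itin ?\<phi> \<alpha> b"
      by (rule Y.itin_split[OF fin]) (use r(1-4) notMid in auto)
    also have "Y.itin ?\<phi> \<alpha> b = Y.itin ?\<phi> \<alpha> \<beta> @ Y.itin ?\<phi> \<beta> b"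
      by (rule Y.itin_split[OF Y.finite_crossings[OF Y.turning_subinterval[OF tu]]]) (use r(1-4) notMid in auto)
    also have "Y.itin ?\<phi> a \<alpha> = []" using no by (simp add: Y.itin_def)
    also have "Y.itin ?\<phi> \<alpha> \<beta> = [Y.letter_at ?\<phi> t]" by (rule Y.itin_single[OF single])
    finally have itY: "Y.itin ?\<phi> a b = Y.letter_at ?\<phi> t # Y.itin ?\<phi> \<beta> b" by simp
    have "X.itin ?\<psi> a b = X.itin ?\<psi> a \<alpha> @ X.itin ?\<psi> \<alpha> b"
      by (rule X.itin_split[OF X.finite_crossings[OF tuX]]) (use r(1-4) notMidX in auto)
    also have "X.itin ?\<psi> \<alpha> b = X.itin ?\<psi> \<alpha> \<beta> @ X.itin ?\<psi> \<beta> b"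
      by (rule X.itin_split[OF X.finite_crossings[OF X.turning_subinterval[OF tuX]]]) (use r(1-4) notMidX in auto)
    also have "X.itin ?\<psi> a \<alpha> = []"
      by (rule itin_uncrossed[OF tracks arcs(1) ends(1) near\<alpha>\<beta>(1) no])
    finally show ?thesis using one IH itY by simp
  qed
qed

lemma tracks_shrink: "tracks j \<delta> i \<epsilon> \<Longrightarrow> \<delta>' \<le> \<delta> \<Longrightarrow> tracks j \<delta>' i \<epsilon>"
  unfolding tracks_def using Y.near_mono by blast

text \<open>Belonging to \<open>E\<close> is a topological property by \<open>E_no_cut\<close> and \<open>not_E_cut\<close>.\<close>

lemma E_image:
  assumes "homeomorphism Y.X X.X g g'" "e \<in> Y.E"
  shows "g e \<in> X.E"
proof (rule ccontr)
  assume nE: "g e \<notin> X.E"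
  have eX: "e \<in> Y.X" using assms by (auto simp: Y.E_def)
  have gX: "g e \<in> X.X" using g_in eX by auto
  obtain C D where CD: "compact C" "connected C" "C \<subseteq> X.X" "C \<noteq> {g e}"
    "compact D" "connected D" "D \<subseteq> X.X" "D \<noteq> {g e}" "C \<inter> D = {g e}"
    using X.not_E_cut[OF gX nE] by blast
  have hom: "continuous_on X.X g'" "g' ` X.X = Y.X" "\<And>w. w \<in> X.X \<Longrightarrow> g (g' w) = w" "g' (g e) = e"
    using assms(1) eX by (auto simp: homeomorphism_def)
  have img: "compact (g' ` A)" "connected (g' ` A)" "g' ` A \<subseteq> Y.X" "e \<in> g' ` A" "g' ` A \<noteq> {e}"
    if A: "compact A" "connected A" "A \<subseteq> X.X" "A \<noteq> {g e}" "g e \<in> A" for A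
  proof -
    have "continuous_on A g'" using hom(1) A(3) by (rule continuous_on_subset)
    then show "compact (g' ` A)" "connected (g' ` A)" using A by (auto intro: compact_continuous_image connected_continuous_image)
    show "g' ` A \<subseteq> Y.X" using hom(2) A by auto
    show "e \<in> g' ` A" using hom(4) A(5) by force
    show "g' ` A \<noteq> {e}"
    proof
      assume eq: "g' ` A = {e}"
      have "w = g e" if "w \<in> A" for w
      proof -
        have "g' w = e" using eq that by auto
        then show ?thesis using hom(3)[of w] that A(3) by auto
      qed
      then show False using A(4,5) by blast
    qed
  qed
  have "g e \<in> C" "g e \<in> D" using CD by auto
  note iC = img[OF CD(1-4) \<open>g e \<in> C\<close>] and iD = img[OF CD(5-8) \<open>g e \<in> D\<close>]
  have "g' ` C \<inter> g' ` D \<noteq> {e}" by (rule Y.E_no_cut[OF assms(2) iC iD])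
  moreover have "g' ` C \<inter> g' ` D \<subseteq> {e}"
  proof
    fix z assume "z \<in> g' ` C \<inter> g' ` D"
    then obtain u v where uv: "u \<in> C" "v \<in> D" "z = g' u" "z = g' v" by auto
    then have "u = v" using hom(3)[of u] hom(3)[of v] CD by (metis subsetD)
    then have "v \<in> C \<inter> D" using uv by simp
    then show "z \<in> {e}" using uv(4) CD(9) hom(4) by simp
  qed
  ultimately show False using iC(4) iD(4) by auto
qed

text \<open>A thread with a coordinate near a vertex is, at that level, close to an end point, and end
  points are sent to end points.\<close>

lemma tracks_exists:
  assumes E: "\<And>e. e \<in> Y.E \<Longrightarrow> g e \<in> X.E" and eps: "0 < \<epsilon>"
  shows "\<exists>J. \<forall>j\<ge>J. \<exists>\<delta>>0. \<delta> \<le> Y.mesh \<and> tracks j \<delta> i \<epsilon>"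
proof -
  have cont: "continuous_on Y.X (\<lambda>z. g z i)"
    by (rule continuous_on_compose2[OF continuous_on_coordinate g_cont]) auto
  obtain J where J: "\<And>j. J \<le> j \<Longrightarrow> \<exists>\<delta>>0. \<forall>z\<in>Y.X. \<forall>z'\<in>Y.X. \<bar>z j - z' j\<bar> < \<delta> \<longrightarrow> \<bar>g z i - g z' i\<bar> < \<epsilon>"
    using Y.uniform_levels[OF cont eps] by blast
  show ?thesis
  proof (rule exI[of _ J], intro allI impI)
    fix j assume "J \<le> j"
    then obtain \<delta> where d: "0 < \<delta>" "\<And>z z'. z \<in> Y.X \<Longrightarrow> z' \<in> Y.X \<Longrightarrow> \<bar>z j - z' j\<bar> < \<delta> \<Longrightarrow> \<bar>g z i - g z' i\<bar> < \<epsilon>"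
      using J by meson
    have "tracks j \<delta> i \<epsilon>"
      unfolding tracks_def
    proof (intro conjI ballI impI)
      fix z assume z: "z \<in> Y.X" "Y.near \<delta> (z j)"
      then obtain v where v: "v \<in> Y.V" "\<bar>z j - v\<bar> < \<delta>" by (auto simp: Y.near_def)
      obtain e where e: "e \<in> Y.E" "e j = v" using Y.E_exists[OF v(1)] by blast
      have "\<bar>g z i - g e i\<bar> < \<epsilon>" using d(2)[of z e] z e v by (auto simp: Y.E_def)
      moreover have "g e i \<in> X.V" using E[OF e(1)] by (auto simp: X.E_def)
      ultimately show "X.near \<epsilon> (g z i)" by (auto simp: X.near_def)
    next
      fix z z' assume "z \<in> Y.X" "z' \<in> Y.X" "z j = z' j"
      then show "\<bar>g z i - g z' i\<bar> < \<epsilon>" using d by auto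
    qed
    then have "tracks j (min \<delta> Y.mesh) i \<epsilon>" by (rule tracks_shrink) simp
    then show "\<exists>\<delta>>0. \<delta> \<le> Y.mesh \<and> tracks j \<delta> i \<epsilon>"
      using d(1) Y.mesh_pos by (intro exI[of _ "min \<delta> Y.mesh"]) auto
  qed
qed

end

section \<open>Homeomorphic inverse limits have weakly equivalent substitutions\<close>

text \<open>Apply \<open>itin_image\<close> for \<open>g\<close> to the image under \<open>h\<close> of the standard arc over a piece.  Since \<open>g\<close> inverts \<open>h\<close>, the
  result is the itinerary of the arc itself at the level \<open>i\<close>, which is that of \<open>T ^^ (k - i)\<close> on the piece.\<close>

lemma compose_words:
  assumes G: "tent_pair r s g" and H: "tent_pair s r h" and inv: "\<And>z. z \<in> periodic_tent.X s \<Longrightarrow> g (h z) = z"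
    and gG: "tent_pair.tracks r s g j d i \<epsilon>" "0 < d" "d \<le> subdivision.mesh (num_pieces r) (orbit_point r)"
      "\<epsilon> \<le> subdivision.mesh (num_pieces s) (orbit_point s)"
    and gH: "tent_pair.tracks s r h k \<delta> j d" "0 < \<delta>"
    and ik: "i \<le> k" and b: "b \<in> alphabet (num_pieces s)"
  shows "extend (tent_pair.\<sigma> r s g j i) (tent_pair.\<sigma> s r h k j b) = (extend (tent_subst s) ^^ (k - i)) [b]"
proof -
  interpret G: tent_pair r s g by (rule G)
  interpret H: tent_pair s r h by (rule H)
  have P: "extend (G.\<sigma> j i) (H.\<sigma> k j (Plain c)) = (extend (tent_subst s) ^^ (k - i)) [Plain c]"
    if c: "c \<in> {1..num_pieces s}" for c
  proof -
    let ?x = "orbit_point s"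
    let ?a = "?x (c - 1)" and ?b = "?x c"
    have V: "?a \<in> G.X.V" "?b \<in> G.X.V" using c by auto
    have ab: "?a < ?b" using c by (intro G.X.x_less) auto
    have arc: "G.X.arc (G.X.L k) ?a ?b" by (rule G.X.arc_L) (use V G.X.V_bounds in auto)
    have near: "G.Y.near d (h (G.X.L k v) j)" if "v \<in> G.X.V" for v
    proof -
      have "G.X.L k v \<in> G.X.X" "G.X.near \<delta> (G.X.L k v k)"
        using that gH(2) G.X.V_bounds by (auto intro: G.X.L_in_X)
      then show ?thesis using gH(1) by (auto simp: H.tracks_def)
    qed
    have "G.X.itin (\<lambda>t. g (h (G.X.L k t)) i) ?a ?b
        = extend (G.\<sigma> j i) (G.Y.itin (\<lambda>t. h (G.X.L k t) j) ?a ?b)"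
      by (rule G.itin_image[OF gG H.arc_g[OF arc]]) (use ab near V in auto)
    then have 1: "extend (G.\<sigma> j i) (H.\<sigma> k j (Plain c)) = G.X.itin (\<lambda>t. g (h (G.X.L k t)) i) ?a ?b"
      by simp
    have iter: "(\<lambda>t. G.X.L k t i) = (tent s ^^ (k - i))" using G.X.L_low[OF ik] by auto
    have nearX: "G.X.near G.X.mesh (G.X.L k v i)" if "v \<in> G.X.V" for v
      using G.X.T_iter_V[OF that] G.X.L_low[OF ik] G.X.mesh_pos by auto
    have eq: "G.X.L k t i = g (h (G.X.L k t)) i" if "?a \<le> t" "t \<le> ?b" for t
    proof -
      have "0 \<le> t" "t \<le> 1" using that V G.X.V_bounds by force+
      then show ?thesis using inv[OF G.X.L_in_X] by simp
    qed
    have 2: "G.X.itin (\<lambda>t. G.X.L k t i) ?a ?b = G.X.itin (\<lambda>t. g (h (G.X.L k t)) i) ?a ?b"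
      by (rule G.X.itin_cong_turning[OF G.X.arc_turning[OF arc] nearX[OF V(1)] nearX[OF V(2)] eq])
    have pl: "set [Plain c] \<subseteq> alphabet (num_pieces s)" using c by (auto simp: alphabet_def)
    have "G.X.itin (tent s ^^ (k - i)) ?a ?b = (extend (tent_subst s) ^^ (k - i)) [Plain c]"
      using G.X.traverses_itin[OF G.X.tent_power_traverses[OF c]]
        bar_substitution_power(1,2)[OF G.X.tent_bar_substitution pl] by simp
    then show ?thesis using 1 2 iter by simp
  qed
  obtain c where c: "c \<in> {1..num_pieces s}" "b = Plain c \<or> b = bar (Plain c)"
    using b by (auto simp: alphabet_def)
  have pl: "set [Plain c] \<subseteq> alphabet (num_pieces s)" using c by (auto simp: alphabet_def)
  have sub: "set (H.\<sigma> k j (Plain c)) \<subseteq> alphabet (num_pieces r)" using G.Y.itin_letters by simp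
  from c(2) show ?thesis
  proof
    assume bb: "b = bar (Plain c)"
    have "extend (G.\<sigma> j i) (H.\<sigma> k j b) = extend (G.\<sigma> j i) (word_bar (H.\<sigma> k j (Plain c)))"
      by (simp only: bb H.\<sigma>_bar)
    also have "\<dots> = word_bar (extend (G.\<sigma> j i) (H.\<sigma> k j (Plain c)))"
      by (rule extend_word_bar[OF _ sub]) (simp add: G.\<sigma>_bar)
    also have "\<dots> = word_bar ((extend (tent_subst s) ^^ (k - i)) [Plain c])" by (simp only: P[OF c(1)])
    also have "\<dots> = (extend (tent_subst s) ^^ (k - i)) (word_bar [Plain c])"
      by (rule bar_substitution_power(3)[OF G.X.tent_bar_substitution pl, symmetric])
    finally show ?thesis by (simp add: bb)
  qed (use P[OF c(1)] in simp)
qed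

lemma \<sigma>_set:
  assumes "tent_pair r s g"
  shows "set (tent_pair.\<sigma> r s g j i b) \<subseteq> alphabet (num_pieces s)"
proof -
  interpret G: tent_pair r s g by fact
  show ?thesis using G.X.itin_letters by (cases b) auto
qed

text \<open>Levels \<open>k 0 < j 0 < k 1 < j 1 < \<dots>\<close> are chosen alternately in the two inverse limits, each one so high that it
  controls the previous one to the required precision.  The codes that enter the ladder have no empty
  words, because their compositions are powers of substitutions without empty words.\<close>

theorem homeomorphic_imp_weakly_equivalent:
  assumes s: "s1 \<in> periodic_params" "s2 \<in> periodic_params"
    and hom: "periodic_tent.X s1 homeomorphic periodic_tent.X s2"
  shows "weakly_equivalent (num_pieces s1) (tent_subst s1) (num_pieces s2) (tent_subst s2)"
proof -
  interpret A: periodic_tent s1 by unfold_locales (rule s)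
  interpret B: periodic_tent s2 by unfold_locales (rule s)
  obtain h g where hg: "homeomorphism A.X B.X h g" using hom by (auto simp: homeomorphic_def)
  then have gh: "homeomorphism B.X A.X g h" by (rule homeomorphism_symD)
  have inj: "inj_on h A.X" "inj_on g B.X"
    using hg by (auto simp: homeomorphism_def intro: inj_on_inverseI)
  interpret H: tent_pair s1 s2 h
    by unfold_locales (use hg inj in \<open>auto simp: homeomorphism_def\<close>)
  interpret G: tent_pair s2 s1 g
    by unfold_locales (use hg inj in \<open>auto simp: homeomorphism_def\<close>)
  have Gex: "\<exists>J. \<forall>j\<ge>J. \<exists>\<delta>>0. \<delta> \<le> B.mesh \<and> G.tracks j \<delta> i \<epsilon>" if "0 < \<epsilon>" for i \<epsilon>
    by (rule G.tracks_exists[OF _ that]) (rule G.E_image[OF gh])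
  have Hex: "\<exists>J. \<forall>j\<ge>J. \<exists>\<delta>>0. \<delta> \<le> A.mesh \<and> H.tracks j \<delta> i \<epsilon>" if "0 < \<epsilon>" for i \<epsilon>
    by (rule H.tracks_exists[OF _ that]) (rule H.E_image[OF hg])
  \<comment> \<open>a state consists of a level with a tolerance in either inverse limit\<close>
  define P where "P st \<longleftrightarrow> (case st of (k, dX, j, dY) \<Rightarrow> 0 < dX \<and> dX \<le> A.mesh \<and> 0 < dY \<and> dY \<le> B.mesh \<and>
      k < j \<and> G.tracks j dY k dX)" for st :: "nat \<times> real \<times> nat \<times> real"
  define Q where "Q st st' \<longleftrightarrow> (case st of (k, dX, j, dY) \<Rightarrow> case st' of (k', dX', j', dY') \<Rightarrow>
      j < k' \<and> H.tracks k' dX' j dY)" for st st' :: "nat \<times> real \<times> nat \<times> real"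
  have up: "\<exists>j dY. P (k, dX, j, dY)" if d: "0 < dX" "dX \<le> A.mesh" for k dX
  proof -
    obtain J where J: "\<forall>j\<ge>J. \<exists>\<delta>>0. \<delta> \<le> B.mesh \<and> G.tracks j \<delta> k dX" using Gex[OF d(1)] by blast
    then obtain dY where "0 < dY" "dY \<le> B.mesh" "G.tracks (max J (Suc k)) dY k dX" by (meson max.cobounded1)
    then show ?thesis using d unfolding P_def by (intro exI[of _ "max J (Suc k)"] exI[of _ dY]) auto
  qed
  have "\<exists>f. \<forall>i::nat. P (f i) \<and> Q (f i) (f (Suc i))"
  proof (rule dependent_nat_choice)
    show "\<exists>st. P st" using up[of A.mesh 0] A.mesh_pos by blast
    fix st and i :: nat assume "P st"
    obtain k dX j dY where st: "st = (k, dX, j, dY)" by (cases st)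
    have dY: "0 < dY" using \<open>P st\<close> by (simp add: st P_def)
    obtain J where J: "\<forall>k'\<ge>J. \<exists>\<delta>>0. \<delta> \<le> A.mesh \<and> H.tracks k' \<delta> j dY" using Hex[OF dY] by blast
    then obtain dX' where dX': "0 < dX'" "dX' \<le> A.mesh" "H.tracks (max J (Suc j)) dX' j dY" by (meson max.cobounded1)
    obtain j' dY' where "P (max J (Suc j), dX', j', dY')" using up[OF dX'(1,2)] by blast
    moreover have "Q st (max J (Suc j), dX', j', dY')" using dX' by (simp add: Q_def st)
    ultimately show "\<exists>st'. P st' \<and> Q st st'" by blast
  qed
  then obtain f where f: "\<And>i::nat. P (f i)" "\<And>i. Q (f i) (f (Suc i))" by blast
  define k where "k i = fst (f i)" for i
  define dX where "dX i = fst (snd (f i))" for i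
  define j where "j i = fst (snd (snd (f i)))" for i
  define dY where "dY i = snd (snd (snd (f i)))" for i
  have fi: "f i = (k i, dX i, j i, dY i)" for i by (simp add: k_def dX_def j_def dY_def)
  have P: "0 < dX i" "dX i \<le> A.mesh" "0 < dY i" "dY i \<le> B.mesh" "k i < j i" "G.tracks (j i) (dY i) (k i) (dX i)" for i
    using f(1)[of i] by (auto simp: P_def fi)
  have Q: "j i < k (Suc i)" "H.tracks (k (Suc i)) (dX (Suc i)) (j i) (dY i)" for i
    using f(2)[of i] by (auto simp: Q_def fi)
  define \<sigma> where "\<sigma> i = G.\<sigma> (j i) (k i)" for i
  define \<tau> where "\<tau> i = H.\<sigma> (k (Suc i)) (j i)" for i
  define p where "p i = k (Suc i) - k i" for i
  define q where "q i = j (Suc i) - j i" for i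
  have ginv: "g (h z) = z" if "z \<in> A.X" for z using hg that by (simp add: homeomorphism_def)
  have hinv: "h (g z) = z" if "z \<in> B.X" for z using hg that by (simp add: homeomorphism_def)
  have pos: "0 < p i" "0 < q i" for i
    using P(5)[of i] P(5)[of "Suc i"] Q(1)[of i] by (auto simp: p_def q_def)
  have \<sigma>\<tau>: "extend (\<sigma> i) (\<tau> i b) = (extend (tent_subst s1) ^^ p i) [b]" if "b \<in> alphabet (num_pieces s1)" for i b
    unfolding \<sigma>_def \<tau>_def p_def
    by (rule compose_words[OF G.tent_pair_axioms H.tent_pair_axioms ginv P(6,3,4,2) Q(2) P(1) _ that])
      (use P(5)[of i] Q(1)[of i] in auto)
  have \<tau>\<sigma>: "extend (\<tau> i) (\<sigma> (Suc i) c) = (extend (tent_subst s2) ^^ q i) [c]" if "c \<in> alphabet (num_pieces s2)" for i c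
    unfolding \<sigma>_def \<tau>_def q_def
    by (rule compose_words[OF H.tent_pair_axioms G.tent_pair_axioms hinv Q(2) P(1,2,4) P(6,3) _ that])
      (use P(5)[of "Suc i"] Q(1)[of i] in auto)
  have bars: "\<sigma> i (bar b) = word_bar (\<sigma> i b)" "\<tau> i (bar b) = word_bar (\<tau> i b)" for i b
    by (simp_all add: \<sigma>_def \<tau>_def G.\<sigma>_bar H.\<sigma>_bar)
  have sets: "set (\<sigma> i b) \<subseteq> alphabet (num_pieces s1)" "set (\<tau> i b) \<subseteq> alphabet (num_pieces s2)" for i b
    unfolding \<sigma>_def \<tau>_def by (rule \<sigma>_set, unfold_locales)+
  have \<tau>ne: "\<tau> i b \<noteq> []" if "b \<in> alphabet (num_pieces s1)" for i b
  proof
    assume "\<tau> i b = []"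
    then have "(extend (tent_subst s1) ^^ p i) [b] = []" using \<sigma>\<tau>[OF that, of i] by simp
    then show False using bar_substitution_power(2)[OF A.tent_bar_substitution, of "[b]" "p i"] that by simp
  qed
  have \<sigma>ne: "\<sigma> (Suc i) c \<noteq> []" if "c \<in> alphabet (num_pieces s2)" for i c
  proof
    assume "\<sigma> (Suc i) c = []"
    then have "(extend (tent_subst s2) ^^ q i) [c] = []" using \<tau>\<sigma>[OF that, of i] by simp
    then show False using bar_substitution_power(2)[OF B.tent_bar_substitution, of "[c]" "q i"] that by simp
  qed
  have bs: "bar_substitution (num_pieces s2) (num_pieces s1) (\<sigma> i)" if "1 \<le> i" for i
    using \<sigma>ne[of _ "i - 1"] that sets bars by (auto simp: bar_substitution_def words_def)
  have bt: "bar_substitution (num_pieces s1) (num_pieces s2) (\<tau> i)" for i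
    using \<tau>ne[of _ i] sets bars by (auto simp: bar_substitution_def words_def)
  show ?thesis
    unfolding weakly_equivalent_def
    using A.tent_bar_substitution B.tent_bar_substitution pos bs bt \<sigma>\<tau> \<tau>\<sigma>
    by (intro conjI exI[of _ p] exI[of _ q] exI[of _ \<sigma>] exI[of _ \<tau>]) auto
qed

section \<open>Weakly equivalent substitutions have homeomorphic inverse limits\<close>

subsection \<open>Legality of the intertwining substitutions\<close>

lemma extend_power_bar:
  assumes "bar_substitution n n \<phi>" "b \<in> alphabet n"
  shows "(extend \<phi> ^^ k) [bar b] = word_bar ((extend \<phi> ^^ k) [b])"
  using bar_substitution_power(3)[OF assms(1), of "[b]" k] assms(2) by simp

lemma extend_extend_word:
  assumes "\<forall>b\<in>alphabet n. extend \<sigma> (\<tau> b) = (extend \<phi> ^^ k) [b]" "set w \<subseteq> alphabet n"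
  shows "extend \<sigma> (extend \<tau> w) = (extend \<phi> ^^ k) w"
  using assms(2)
proof (induction w)
  case Nil
  show ?case by (induction k) auto
next
  case (Cons b w)
  then have "extend \<sigma> (extend \<tau> (b # w)) = (extend \<phi> ^^ k) [b] @ (extend \<phi> ^^ k) w" using assms(1) by auto
  then show ?case using extend_power_append[where u = "[b]" and v = w] by simp
qed

lemma legal_infix: "legal (u @ w @ v) \<Longrightarrow> legal w"
  by (simp only: legal_simps(3))

text \<open>A factor \<open>w\<close> of \<open>\<sigma> (Suc i)\<close> applied to a word \<open>\<psi> ^^ Q\<close> of a letter has a legal image under \<open>\<tau> i\<close>, since this image is a factor of
  a higher power of \<open>\<psi>\<close> at that letter.  Every letter occurs as such a factor, and so does every junction \<open>[Plain d, Plain (Suc d)]\<close> or its bar, because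
  \<open>\<sigma> (Suc i) \<circ> \<psi> ^^ Q\<close> can be rewritten, along the ladder, as a high power of \<open>\<chi>\<close> after a later \<open>\<sigma>\<close>.\<close>

lemma intertwining_legal:
  fixes \<sigma> \<tau> :: "nat \<Rightarrow> letter \<Rightarrow> letter list"
  assumes s: "s \<in> periodic_params" "r \<in> periodic_params"
    and pos: "\<And>i. 0 < p i"
    and \<sigma>: "\<And>i. bar_substitution (num_pieces r) (num_pieces s) (\<sigma> i)"
    and \<tau>: "\<And>i. bar_substitution (num_pieces s) (num_pieces r) (\<tau> i)"
    and \<sigma>\<tau>: "\<And>i. \<forall>b\<in>alphabet (num_pieces s). extend (\<sigma> i) (\<tau> i b) = (extend (tent_subst s) ^^ p i) [b]"
    and \<tau>\<sigma>: "\<And>i. \<forall>c\<in>alphabet (num_pieces r). extend (\<tau> i) (\<sigma> (Suc i) c) = (extend (tent_subst r) ^^ q i) [c]"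
  shows "\<forall>c\<in>{1..num_pieces s}. legal (\<tau> i (Plain c))"
    "\<forall>c\<in>{1..<num_pieces s}. tgt (last (\<tau> i (Plain c))) = src (hd (\<tau> i (Plain (Suc c))))"
proof -
  interpret A: periodic_tent s by unfold_locales (rule s)
  interpret B: periodic_tent r by unfold_locales (rule s)
  let ?n = "num_pieces s" and ?m = "num_pieces r"
  let ?\<chi> = "extend (tent_subst s)" and ?\<psi> = "extend (tent_subst r)"
  have \<tau>set: "set (\<tau> i b) \<subseteq> alphabet ?m" "\<tau> i b \<noteq> []" if "b \<in> alphabet ?n" for i b
    using \<tau>[of i] that by (auto simp: bar_substitution_def words_def)
  have \<sigma>set: "set (\<sigma> i b) \<subseteq> alphabet ?n" "\<sigma> i b \<noteq> []" if "b \<in> alphabet ?m" for i b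
    using \<sigma>[of i] that by (auto simp: bar_substitution_def words_def)
  have \<tau>bar: "\<tau> i (bar b) = word_bar (\<tau> i b)" if "b \<in> alphabet ?n" for i b
    using \<tau>[of i] that by (auto simp: bar_substitution_def)
  have occurs: "\<exists>c\<in>alphabet ?m. b \<in> set (\<sigma> k c)" if b: "b \<in> alphabet ?n" for b k
  proof -
    obtain d where d: "d \<in> {1..?n}" "b = Plain d \<or> b = bar (Plain d)" using b by (auto simp: alphabet_def)
    obtain b' where b': "b' \<in> alphabet ?n" "Plain d \<in> set ((?\<chi> ^^ p k) [b'])"
      using A.letter_occurs_power[OF d(1)] by blast
    have "\<exists>b'\<in>alphabet ?n. b \<in> set ((?\<chi> ^^ p k) [b'])"
    proof (cases "b = Plain d")
      case False
      then have "b = bar (Plain d)" using d(2) by simp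
      then have "b \<in> set (word_bar ((?\<chi> ^^ p k) [b']))"
        using b'(2) unfolding word_bar_def set_rev set_map by (metis imageI)
      then have "b \<in> set ((?\<chi> ^^ p k) [bar b'])"
        using extend_power_bar[OF A.tent_bar_substitution b'(1)] by simp
      then show ?thesis using b'(1) by (intro bexI[of _ "bar b'"]) auto
    qed (use b' in auto)
    then obtain b'' where "b'' \<in> alphabet ?n" "b \<in> set (extend (\<sigma> k) (\<tau> k b''))" using \<sigma>\<tau> by metis
    then show ?thesis using \<tau>set(1)[of b'' k] by (auto simp: extend_def)
  qed
  \<comment> \<open>descending the ladder by \<open>k\<close> rungs\<close>
  have chain: "\<exists>P\<ge>k. \<exists>Q. \<forall>w. set w \<subseteq> alphabet ?m \<longrightarrow>
      extend (\<sigma> (Suc i)) ((?\<psi> ^^ Q) w) = (?\<chi> ^^ P) (extend (\<sigma> (Suc i + k)) w)" for k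
  proof (induction k)
    case 0
    show ?case by (rule exI[of _ 0], rule conjI, simp, rule exI[of _ 0]) simp
  next
    case (Suc k)
    then obtain P Q where PQ: "k \<le> P" "\<And>w. set w \<subseteq> alphabet ?m \<Longrightarrow>
      extend (\<sigma> (Suc i)) ((?\<psi> ^^ Q) w) = (?\<chi> ^^ P) (extend (\<sigma> (Suc i + k)) w)" by blast
    let ?l = "Suc i + k"
    have "extend (\<sigma> (Suc i)) ((?\<psi> ^^ (Q + q ?l)) w) = (?\<chi> ^^ (P + p ?l)) (extend (\<sigma> (Suc i + Suc k)) w)"
      if w: "set w \<subseteq> alphabet ?m" for w
    proof -
      have sw: "set (extend (\<sigma> (Suc ?l)) w) \<subseteq> alphabet ?n" by (rule bar_substitution_extend[OF \<sigma> w])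
      have "(?\<psi> ^^ q ?l) w = extend (\<tau> ?l) (extend (\<sigma> (Suc ?l)) w)"
        by (rule extend_extend_word[OF \<tau>\<sigma> w, symmetric])
      then have "extend (\<sigma> (Suc i)) ((?\<psi> ^^ (Q + q ?l)) w)
          = extend (\<sigma> (Suc i)) ((?\<psi> ^^ Q) (extend (\<tau> ?l) (extend (\<sigma> (Suc ?l)) w)))"
        by (simp add: funpow_add)
      also have "\<dots> = (?\<chi> ^^ P) (extend (\<sigma> ?l) (extend (\<tau> ?l) (extend (\<sigma> (Suc ?l)) w)))"
        by (rule PQ(2)) (rule bar_substitution_extend[OF \<tau> sw])
      also have "extend (\<sigma> ?l) (extend (\<tau> ?l) (extend (\<sigma> (Suc ?l)) w)) = (?\<chi> ^^ p ?l) (extend (\<sigma> (Suc ?l)) w)"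
        by (rule extend_extend_word[OF \<sigma>\<tau> sw])
      finally show ?thesis by (simp add: funpow_add)
    qed
    moreover have "Suc k \<le> P + p ?l" using PQ(1) pos[of ?l] by simp
    ultimately show ?case by blast
  qed
  have legal_image: "legal (extend (\<tau> i) (extend (\<sigma> (Suc i)) ((?\<psi> ^^ Q) [c])))" if c: "c \<in> alphabet ?m" for c Q
  proof -
    have "set ((?\<psi> ^^ Q) [c]) \<subseteq> alphabet ?m"
      by (rule bar_substitution_power(1)[OF B.tent_bar_substitution]) (use c in auto)
    then have "extend (\<tau> i) (extend (\<sigma> (Suc i)) ((?\<psi> ^^ Q) [c])) = (?\<psi> ^^ (q i + Q)) [c]"
      using extend_extend_word[OF \<tau>\<sigma>] by (simp add: funpow_add)
    then show ?thesis using B.tent_power_legal[OF c] by simp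
  qed
  show "\<forall>c\<in>{1..?n}. legal (\<tau> i (Plain c))"
  proof
    fix d assume d: "d \<in> {1..?n}"
    then have "Plain d \<in> alphabet ?n" by (auto simp: alphabet_def)
    then obtain c where c: "c \<in> alphabet ?m" "Plain d \<in> set (\<sigma> (Suc i) c)" using occurs by blast
    then obtain u v where "\<sigma> (Suc i) c = u @ [Plain d] @ v" by (metis split_list append_Cons append_Nil)
    then show "legal (\<tau> i (Plain d))" using legal_image[OF c(1), of 0] by simp
  qed
  show "\<forall>c\<in>{1..<?n}. tgt (last (\<tau> i (Plain c))) = src (hd (\<tau> i (Plain (Suc c))))"
  proof
    fix d assume d: "d \<in> {1..<?n}"
    obtain K where K: "\<And>M. K \<le> M \<Longrightarrow> \<exists>b\<in>alphabet ?n. A.straight d ((?\<chi> ^^ M) [b])"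
      using A.straight_eventually[of d] d by auto
    obtain P Q where PQ: "K \<le> P" "\<And>w. set w \<subseteq> alphabet ?m \<Longrightarrow>
      extend (\<sigma> (Suc i)) ((?\<psi> ^^ Q) w) = (?\<chi> ^^ P) (extend (\<sigma> (Suc i + K)) w)" using chain[of K] by blast
    obtain b where b: "b \<in> alphabet ?n" "A.straight d ((?\<chi> ^^ P) [b])" using K[OF PQ(1)] by blast
    obtain c where c: "c \<in> alphabet ?m" "b \<in> set (\<sigma> (Suc i + K) c)" using occurs[OF b(1)] by blast
    then obtain u v where uv: "\<sigma> (Suc i + K) c = u @ [b] @ v" by (metis split_list append_Cons append_Nil)
    have "extend (\<sigma> (Suc i)) ((?\<psi> ^^ Q) [c]) = (?\<chi> ^^ P) (\<sigma> (Suc i + K) c)" using PQ(2)[of "[c]"] c(1) by simp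
    also have "\<dots> = (?\<chi> ^^ P) u @ (?\<chi> ^^ P) [b] @ (?\<chi> ^^ P) v" unfolding uv by (simp only: extend_power_append)
    finally have "A.straight d (extend (\<sigma> (Suc i)) ((?\<psi> ^^ Q) [c]))" using A.straight_append[OF b(2)] by simp
    then obtain u' v' where "extend (\<sigma> (Suc i)) ((?\<psi> ^^ Q) [c]) = u' @ [Plain d, Plain (Suc d)] @ v' \<or>
        extend (\<sigma> (Suc i)) ((?\<psi> ^^ Q) [c]) = u' @ [Barred (Suc d), Barred d] @ v'" by (auto simp: A.straight_def)
    then have leg: "legal (\<tau> i (Plain d) @ \<tau> i (Plain (Suc d))) \<or> legal (\<tau> i (Barred (Suc d)) @ \<tau> i (Barred d))"
    proof
      assume "extend (\<sigma> (Suc i)) ((?\<psi> ^^ Q) [c]) = u' @ [Plain d, Plain (Suc d)] @ v'"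
      then have "legal (extend (\<tau> i) u' @ (\<tau> i (Plain d) @ \<tau> i (Plain (Suc d))) @ extend (\<tau> i) v')"
        using legal_image[OF c(1), of Q] by (simp del: legal_simps)
      then show ?thesis using legal_infix by blast
    next
      assume "extend (\<sigma> (Suc i)) ((?\<psi> ^^ Q) [c]) = u' @ [Barred (Suc d), Barred d] @ v'"
      then have "legal (extend (\<tau> i) u' @ (\<tau> i (Barred (Suc d)) @ \<tau> i (Barred d)) @ extend (\<tau> i) v')"
        using legal_image[OF c(1), of Q] by (simp del: legal_simps)
      then show ?thesis using legal_infix by blast
    qed
    have al: "Plain d \<in> alphabet ?n" "Plain (Suc d) \<in> alphabet ?n" using d by (auto simp: alphabet_def)
    have "\<tau> i (Barred (Suc d)) @ \<tau> i (Barred d) = word_bar (\<tau> i (Plain d) @ \<tau> i (Plain (Suc d)))"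
      using \<tau>bar[OF al(1), of i] \<tau>bar[OF al(2), of i] by simp
    then have "legal (\<tau> i (Plain d) @ \<tau> i (Plain (Suc d)))" using leg legal_word_bar by metis
    then show "tgt (last (\<tau> i (Plain d))) = src (hd (\<tau> i (Plain (Suc d))))"
      using \<tau>set(2)[OF al(1)] \<tau>set(2)[OF al(2)] by simp
  qed
qed

subsection \<open>Ladders of interval maps\<close>

lemma (in subdivision) realizes_interval:
  assumes f: "realizes z n x \<sigma> f"
  shows "traverses z f 0 1 (concat (map (\<lambda>c. \<sigma> (Plain c)) [1..<Suc n]))"
proof -
  have "i \<le> n \<Longrightarrow> traverses z f 0 (x i) (concat (map (\<lambda>c. \<sigma> (Plain c)) [1..<Suc i]))" for i
  proof (induction i)
    case (Suc i)
    have "traverses z f (x i) (x (Suc i)) (\<sigma> (Plain (Suc i)))"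
      using f Suc.prems by (auto simp: realizes_def dest: bspec[of _ _ "Suc i"])
    then show ?case using Suc by (auto simp: traverses_append)
  qed (simp add: x_0)
  from this[of n] show ?thesis by (simp add: x_n)
qed

lemma realizes_continuous_range:
  assumes A: "subdivision n x" and B: "subdivision m y" and f: "realizes x m y \<sigma> f"
    and \<sigma>: "bar_substitution m n \<sigma>"
  shows "continuous_on {0..1} f \<and> f ` {0..1} \<subseteq> {0..1}"
proof -
  interpret A: subdivision n x by (rule A)
  interpret B: subdivision m y by (rule B)
  let ?w = "concat (map (\<lambda>c. \<sigma> (Plain c)) [1..<Suc m])"
  have tr: "traverses x f 0 1 ?w" by (rule B.realizes_interval[OF f])
  have "set ?w \<subseteq> alphabet n"
  proof -
    have "set (\<sigma> (Plain c)) \<subseteq> alphabet n" if "c \<in> {1..m}" for c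
    proof -
      have "Plain c \<in> alphabet m" using that by (auto simp: alphabet_def)
      then have "\<sigma> (Plain c) \<in> words n" using \<sigma> unfolding bar_substitution_def by blast
      then show ?thesis by (simp add: words_def)
    qed
    then show ?thesis by (force simp del: upt_Suc)
  qed
  moreover have "?w \<noteq> []" using tr by (metis traverses.simps(1) zero_neq_one)
  ultimately show ?thesis using traverses_continuous[OF tr] A.traverses_itin[OF tr] by blast
qed

context periodic_tent begin

text \<open>A compatible sequence at a cofinal set of levels extends to a thread.\<close>

lemma thread_from_levels:
  assumes b: "b 0 = 0" "\<And>i. b (Suc i) = b i + q i" "\<And>i. 0 < q i"
    and z: "\<And>i. z i \<in> {0..1}" "\<And>i. (T ^^ q i) (z (Suc i)) = z i"
  shows "(\<lambda>l. (T ^^ (b l - l)) (z l)) \<in> X" "(T ^^ (b (b i) - b i)) (z (b i)) = z i"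
proof -
  have ble: "i \<le> b i" for i
  proof (induction i)
    case (Suc i)
    then show ?case using b(2)[of i] b(3)[of i] by simp
  qed simp
  have mono: "b i \<le> b (i + k)" for i k by (induction k) (auto simp: b(2))
  have down: "(T ^^ (b (i + k) - b i)) (z (i + k)) = z i" for i k
  proof (induction k)
    case (Suc k)
    have "b (i + Suc k) - b i = (b (i + k) - b i) + q (i + k)" using mono[of i k] b(2)[of "i + k"] by simp
    then have "(T ^^ (b (i + Suc k) - b i)) (z (i + Suc k)) = (T ^^ (b (i + k) - b i)) ((T ^^ q (i + k)) (z (Suc (i + k))))"
      by (simp add: funpow_add)
    then show ?case using Suc z(2) by simp
  qed simp
  show "(T ^^ (b (b i) - b i)) (z (b i)) = z i" using down[of i "b i - i"] ble[of i] by simp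
  have "T ((T ^^ (b (Suc l) - Suc l)) (z (Suc l))) = (T ^^ (b l - l)) (z l)" for l
  proof -
    have "Suc (b (Suc l) - Suc l) = (b l - l) + q l" using ble[of l] ble[of "Suc l"] b(2)[of l] by simp
    then have "T ((T ^^ (b (Suc l) - Suc l)) (z (Suc l))) = (T ^^ ((b l - l) + q l)) (z (Suc l))"
      by (metis comp_apply funpow.simps(2))
    then show ?thesis using z(2)[of l] by (simp add: funpow_add)
  qed
  then show "(\<lambda>l. (T ^^ (b l - l)) (z l)) \<in> X"
    using z(1) tent_iter_range by (auto simp: X_def)
qed

end

text \<open>The maps \<open>g i\<close> send the level \<open>p 0 + \<dots> + p i\<close> of the first system to the level \<open>q 0 + \<dots> + q (i - 1)\<close> of the second
  one, and the maps \<open>f i\<close> lead back, so the induced maps on threads are inverse to each other.\<close>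

lemma ladder_homeomorphic:
  fixes f g :: "nat \<Rightarrow> real \<Rightarrow> real"
  assumes A: "periodic_tent s" and B: "periodic_tent r"
    and f: "\<And>i. continuous_on {0..1} (f i)" "\<And>i. f i ` {0..1} \<subseteq> {0..1}"
    and g: "\<And>i. continuous_on {0..1} (g i)" "\<And>i. g i ` {0..1} \<subseteq> {0..1}"
    and fg: "\<And>i t. t \<in> {0..1} \<Longrightarrow> f i (g i t) = (tent s ^^ p i) t"
    and gf: "\<And>i t. t \<in> {0..1} \<Longrightarrow> g i (f (Suc i) t) = (tent r ^^ q i) t"
    and pos: "\<And>i. 0 < p i" "\<And>i. 0 < q i"
  shows "periodic_tent.X s homeomorphic periodic_tent.X r"
proof -
  interpret A: periodic_tent s by (rule A)
  interpret B: periodic_tent r by (rule B)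
  define a where "a i = (\<Sum>l<i. p l)" for i
  define b where "b i = (\<Sum>l<i. q l)" for i
  have a: "a 0 = 0" "\<And>i. a (Suc i) = a i + p i" and b: "b 0 = 0" "\<And>i. b (Suc i) = b i + q i"
    by (auto simp: a_def b_def)
  define u where "u z i = g i (z (a (Suc i)))" for z :: "nat \<Rightarrow> real" and i
  define v where "v w i = f i (w (b i))" for w :: "nat \<Rightarrow> real" and i
  have u01: "u z i \<in> {0..1}" if "z \<in> A.X" for z i
    using g(2)[of i] A.X_bounds[OF that] by (auto simp: u_def image_subset_iff)
  have v01: "v w i \<in> {0..1}" if "w \<in> B.X" for w i
    using f(2)[of i] B.X_bounds[OF that] by (auto simp: v_def image_subset_iff)
  have uT: "(tent r ^^ q i) (u z (Suc i)) = u z i" if z: "z \<in> A.X" for z i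
  proof -
    have "(tent r ^^ q i) (u z (Suc i)) = g i (f (Suc i) (g (Suc i) (z (a (Suc (Suc i))))))"
      using gf[OF u01[OF z]] by (simp add: u_def)
    also have "\<dots> = g i ((tent s ^^ p (Suc i)) (z (a (Suc (Suc i)))))" using fg A.X_bounds[OF z] by simp
    also have "(tent s ^^ p (Suc i)) (z (a (Suc (Suc i)))) = z (a (Suc i))"
      using A.X_iter[OF z, of "p (Suc i)" "a (Suc i)"] a(2)[of "Suc i"] by simp
    finally show ?thesis by (simp add: u_def)
  qed
  have vT: "(tent s ^^ p i) (v w (Suc i)) = v w i" if w: "w \<in> B.X" for w i
  proof -
    have "(tent s ^^ p i) (v w (Suc i)) = f i (g i (f (Suc i) (w (b (Suc i)))))"
      using fg[OF v01[OF w]] by (simp add: v_def)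
    also have "\<dots> = f i ((tent r ^^ q i) (w (b (Suc i))))" using gf B.X_bounds[OF w] by simp
    also have "(tent r ^^ q i) (w (b (Suc i))) = w (b i)" using B.X_iter[OF w, of "q i" "b i"] b(2)[of i] by simp
    finally show ?thesis by (simp add: v_def)
  qed
  define H where "H z l = (tent r ^^ (b l - l)) (u z l)" for z l
  define G where "G w l = (tent s ^^ (a l - l)) (v w l)" for w l
  have HB: "H z \<in> B.X" "H z (b i) = u z i" if z: "z \<in> A.X" for z i
    using B.thread_from_levels[of b q "u z", OF b pos(2) u01[OF z] uT[OF z]] by (simp_all add: H_def[abs_def])
  have GA: "G w \<in> A.X" "G w (a i) = v w i" if w: "w \<in> B.X" for w i
    using A.thread_from_levels[of a p "v w", OF a pos(1) v01[OF w] vT[OF w]] by (simp_all add: G_def[abs_def])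
  have cofinal: "\<exists>i. l \<le> a i \<and> l \<le> b i" for l
  proof -
    have "l \<le> a l \<and> l \<le> b l"
    proof (induction l)
      case (Suc l)
      then show ?case using a(2)[of l] b(2)[of l] pos(1)[of l] pos(2)[of l] by simp
    qed simp
    then show ?thesis by blast
  qed
  have GH: "G (H z) = z" if z: "z \<in> A.X" for z
  proof (rule A.X_eqI[OF GA(1)[OF HB(1)[OF z]] z])
    fix l
    obtain i where i: "l \<le> a i" using cofinal by blast
    have "G (H z) (a i) = f i (g i (z (a (Suc i))))"
      using GA(2)[OF HB(1)[OF z]] HB(2)[OF z] by (simp add: u_def v_def)
    also have "\<dots> = (tent s ^^ p i) (z (a (Suc i)))" using fg A.X_bounds[OF z] by simp
    also have "\<dots> = z (a i)" using A.X_iter[OF z, of "p i" "a i"] a(2)[of i] by simp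
    finally show "\<exists>j\<ge>l. G (H z) j = z j" using i by blast
  qed
  have HG: "H (G w) = w" if w: "w \<in> B.X" for w
  proof (rule B.X_eqI[OF HB(1)[OF GA(1)[OF w]] w])
    fix l
    obtain i where i: "l \<le> b i" using cofinal by blast
    have "H (G w) (b i) = g i (f (Suc i) (w (b (Suc i))))"
      using HB(2)[OF GA(1)[OF w]] GA(2)[OF w] by (simp add: u_def v_def)
    also have "\<dots> = (tent r ^^ q i) (w (b (Suc i)))" using gf B.X_bounds[OF w] by simp
    also have "\<dots> = w (b i)" using B.X_iter[OF w, of "q i" "b i"] b(2)[of i] by simp
    finally show "\<exists>j\<ge>l. H (G w) j = w j" using i by blast
  qed
  have contH: "continuous_on A.X H"
  proof (rule continuous_on_coordinatewise_then_product)
    fix l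
    have "continuous_on A.X (\<lambda>z. u z l)" unfolding u_def
      by (rule continuous_on_compose2[OF g(1) continuous_on_coordinate]) (use A.X_bounds in auto)
    then show "continuous_on A.X (\<lambda>z. H z l)" unfolding H_def
      by (intro continuous_on_compose2[OF B.continuous_on_tent_iter[of UNIV]]) auto
  qed
  have contG: "continuous_on B.X G"
  proof (rule continuous_on_coordinatewise_then_product)
    fix l
    have "continuous_on B.X (\<lambda>w. v w l)" unfolding v_def
      by (rule continuous_on_compose2[OF f(1) continuous_on_coordinate]) (use B.X_bounds in auto)
    then show "continuous_on B.X (\<lambda>w. G w l)" unfolding G_def
      by (intro continuous_on_compose2[OF A.continuous_on_tent_iter[of UNIV]]) auto
  qed
  have "homeomorphism A.X B.X H G"
    by (rule homeomorphismI) (use contH contG HB(1) GA(1) GH HG in auto)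
  then show ?thesis by (auto simp: homeomorphic_def)
qed

text \<open>By the hypothesis on \<open>\<sigma>\<close> and \<open>\<tau>\<close>, the iterate of the tent map traverses the \<open>\<sigma>\<close>-image of a word of \<open>\<tau>\<close>
  over each piece, so it lifts through \<open>f\<close> letter by letter.\<close>

lemma tent_lift:
  assumes A: "periodic_tent s" and B: "periodic_tent r"
    and f: "realizes (orbit_point s) (num_pieces r) (orbit_point r) \<sigma> f"
    and \<sigma>: "bar_substitution (num_pieces r) (num_pieces s) \<sigma>"
    and \<tau>: "bar_substitution (num_pieces s) (num_pieces r) \<tau>"
    and \<sigma>\<tau>: "\<forall>b\<in>alphabet (num_pieces s). extend \<sigma> (\<tau> b) = (extend (tent_subst s) ^^ p) [b]"
    and legal: "\<forall>c\<in>{1..num_pieces s}. legal (\<tau> (Plain c))"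
      "\<forall>c\<in>{1..<num_pieces s}. tgt (last (\<tau> (Plain c))) = src (hd (\<tau> (Plain (Suc c))))"
  shows "\<exists>g. realizes (orbit_point r) (num_pieces s) (orbit_point s) \<tau> g \<and>
     (\<forall>t\<in>{0..1}. f (g t) = (tent s ^^ p) t)"
proof -
  interpret A: periodic_tent s by (rule A)
  interpret B: periodic_tent r by (rule B)
  have w: "set (\<tau> (Plain c)) \<subseteq> alphabet (num_pieces r)" "\<tau> (Plain c) \<noteq> []" "legal (\<tau> (Plain c))"
    and tr: "traverses (orbit_point s) (tent s ^^ p) (orbit_point s (c - 1)) (orbit_point s c) (extend \<sigma> (\<tau> (Plain c)))"
    if c: "c \<in> {1..num_pieces s}" for c
  proof -
    have al: "Plain c \<in> alphabet (num_pieces s)" using c by (auto simp: alphabet_def)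
    then have "\<tau> (Plain c) \<in> words (num_pieces r)" using \<tau> unfolding bar_substitution_def by blast
    then show "set (\<tau> (Plain c)) \<subseteq> alphabet (num_pieces r)" "\<tau> (Plain c) \<noteq> []" "legal (\<tau> (Plain c))"
      using legal(1) c by (simp_all add: words_def)
    show "traverses (orbit_point s) (tent s ^^ p) (orbit_point s (c - 1)) (orbit_point s c) (extend \<sigma> (\<tau> (Plain c)))"
      using A.tent_power_traverses[OF c, of p] \<sigma>\<tau> al by simp
  qed
  have bar: "\<forall>b\<in>alphabet (num_pieces r). \<sigma> (bar b) = word_bar (\<sigma> b)" using \<sigma> by (simp add: bar_substitution_def)
  have yy: "\<forall>d\<in>{1..num_pieces r}. orbit_point r (d - 1) < orbit_point r d" by (auto intro: B.x_less)
  have "\<exists>g. realizes (orbit_point r) (num_pieces s) (orbit_point s) \<tau> g \<and>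
     (\<forall>t\<in>{orbit_point s 0..orbit_point s (num_pieces s)}. f (g t) = (tent s ^^ p) t)"
    by (rule realizes_glue[where P = "\<lambda>t u. f u = (tent s ^^ p) t"])
      (use traverses_lift[OF f bar yy tr w(1,3,2)] w(2) legal(2) A.n_pos in auto)
  then show ?thesis by (simp add: A.x_0 A.x_n)
qed

lemma realizing_map_exists:
  assumes A: "subdivision n x" and B: "subdivision m y" and \<sigma>: "bar_substitution m n \<sigma>"
    and legal: "\<forall>c\<in>{1..m}. legal (\<sigma> (Plain c))"
      "\<forall>c\<in>{1..<m}. tgt (last (\<sigma> (Plain c))) = src (hd (\<sigma> (Plain (Suc c))))"
  shows "\<exists>f. realizes x m y \<sigma> f"
proof -
  interpret A: subdivision n x by (rule A)
  interpret B: subdivision m y by (rule B)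
  have xx: "\<forall>d\<in>{1..n}. x (d - 1) < x d" by (auto intro: A.x_less)
  have w: "set (\<sigma> (Plain c)) \<subseteq> alphabet n \<and> \<sigma> (Plain c) \<noteq> [] \<and> legal (\<sigma> (Plain c))" if c: "c \<in> {1..m}" for c
  proof -
    have "Plain c \<in> alphabet m" using c by (auto simp: alphabet_def)
    then have "\<sigma> (Plain c) \<in> words n" using \<sigma> unfolding bar_substitution_def by blast
    then show ?thesis using legal(1) c by (simp add: words_def)
  qed
  have yy: "y (c - 1) < y c" if "c \<in> {1..m}" for c using that by (auto intro: B.x_less)
  have "\<exists>f. realizes x m y \<sigma> f \<and> (\<forall>t\<in>{y 0..y m}. True)"
    by (rule realizes_glue[where P = "\<lambda>t u. True"])
      (use word_traversal_exists[OF xx] w yy legal(2) B.n_pos in auto)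
  then show ?thesis by blast
qed

text \<open>Starting from any map that realizes the first substitution, the remaining maps of the ladder
  are obtained by lifting alternately through the last map found.\<close>

theorem weakly_equivalent_imp_homeomorphic:
  assumes s: "s1 \<in> periodic_params" "s2 \<in> periodic_params"
    and we: "weakly_equivalent (num_pieces s1) (tent_subst s1) (num_pieces s2) (tent_subst s2)"
  shows "periodic_tent.X s1 homeomorphic periodic_tent.X s2"
proof -
  interpret A: periodic_tent s1 by unfold_locales (rule s)
  interpret B: periodic_tent s2 by unfold_locales (rule s)
  let ?n = "num_pieces s1" and ?m = "num_pieces s2"
  obtain p0 q0 :: "nat \<Rightarrow> nat" and \<sigma>0 \<tau>0 :: "nat \<Rightarrow> letter \<Rightarrow> letter list" where w0: "\<forall>i\<ge>1. 0 < p0 i \<and> 0 < q0 i \<and>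
             bar_substitution ?m ?n (\<sigma>0 i) \<and> bar_substitution ?n ?m (\<tau>0 i) \<and>
             (\<forall>b\<in>alphabet ?n. extend (\<sigma>0 i) (\<tau>0 i b) = (extend (tent_subst s1) ^^ p0 i) [b]) \<and>
             (\<forall>c\<in>alphabet ?m. extend (\<tau>0 i) (\<sigma>0 (i + 1) c) = (extend (tent_subst s2) ^^ q0 i) [c])"
    using we unfolding weakly_equivalent_def by (elim conjE exE) (rule that)
  define \<sigma> \<tau> p q where "\<sigma> i = \<sigma>0 (Suc i)" and "\<tau> i = \<tau>0 (Suc i)" and "p i = p0 (Suc i)" and "q i = q0 (Suc i)" for i
  have pos: "0 < p i" "0 < q i" and bs: "bar_substitution ?m ?n (\<sigma> i)" and bt: "bar_substitution ?n ?m (\<tau> i)"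
    and \<sigma>\<tau>: "\<forall>b\<in>alphabet ?n. extend (\<sigma> i) (\<tau> i b) = (extend (tent_subst s1) ^^ p i) [b]"
    and \<tau>\<sigma>: "\<forall>c\<in>alphabet ?m. extend (\<tau> i) (\<sigma> (Suc i) c) = (extend (tent_subst s2) ^^ q i) [c]" for i
    using w0[rule_format, of "Suc i"] by (simp_all add: \<sigma>_def \<tau>_def p_def q_def)
  have legal\<tau>: "\<forall>c\<in>{1..?n}. legal (\<tau> i (Plain c))"
    "\<forall>c\<in>{1..<?n}. tgt (last (\<tau> i (Plain c))) = src (hd (\<tau> i (Plain (Suc c))))" for i
    using intertwining_legal[where \<sigma> = \<sigma> and \<tau> = \<tau> and p = p and q = q, OF s pos(1) bs bt \<sigma>\<tau> \<tau>\<sigma>] by blast+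
  have legal\<sigma>: "\<forall>c\<in>{1..?m}. legal (\<sigma> (Suc i) (Plain c))"
    "\<forall>c\<in>{1..<?m}. tgt (last (\<sigma> (Suc i) (Plain c))) = src (hd (\<sigma> (Suc i) (Plain (Suc c))))" for i
    using intertwining_legal[where \<sigma> = \<tau> and \<tau> = "\<lambda>i. \<sigma> (Suc i)" and p = q and q = "\<lambda>i. p (Suc i)",
        OF s(2,1) pos(2) bt bs \<tau>\<sigma> \<sigma>\<tau>] by blast+
  let ?x = "orbit_point s1" and ?y = "orbit_point s2"
  \<comment> \<open>the maps realize \<open>\<sigma> (Suc i)\<close>: with exchanged roles, \<open>intertwining_legal\<close> speaks of those \<open>\<sigma>\<close> that follow some \<open>\<tau>\<close> in the ladder\<close>
  define Rf where "Rf i f \<longleftrightarrow> realizes ?x ?m ?y (\<sigma> (Suc i)) f" for i f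
  define Rg where "Rg i g \<longleftrightarrow> realizes ?y ?n ?x (\<tau> (Suc i)) g" for i g
  have lift_g: "\<exists>g. Rg i g \<and> (\<forall>t\<in>{0..1}. f (g t) = (tent s1 ^^ p (Suc i)) t)" if "Rf i f" for i f
    using tent_lift[OF A.periodic_tent_axioms B.periodic_tent_axioms _ bs bt \<sigma>\<tau> legal\<tau>] that
    unfolding Rf_def Rg_def by blast
  have lift_f: "\<exists>f. Rf (Suc i) f \<and> (\<forall>t\<in>{0..1}. g (f t) = (tent s2 ^^ q (Suc i)) t)" if "Rg i g" for i g
    using tent_lift[OF B.periodic_tent_axioms A.periodic_tent_axioms _ bt bs \<tau>\<sigma> legal\<sigma>] that
    unfolding Rf_def Rg_def by blast
  have "\<exists>fg. \<forall>i. (Rf i (fst (fg i)) \<and> Rg i (snd (fg i)) \<and> (\<forall>t\<in>{0..1}. fst (fg i) (snd (fg i) t) = (tent s1 ^^ p (Suc i)) t)) \<and>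
      (\<forall>t\<in>{0..1}. snd (fg i) (fst (fg (Suc i)) t) = (tent s2 ^^ q (Suc i)) t)"
  proof (rule dependent_nat_choice)
    obtain f where f: "Rf 0 f"
      using realizing_map_exists[OF A.subdivision_axioms B.subdivision_axioms bs legal\<sigma>] unfolding Rf_def by blast
    then obtain g where "Rg 0 g" "\<forall>t\<in>{0..1}. f (g t) = (tent s1 ^^ p (Suc 0)) t" using lift_g by blast
    then show "\<exists>fg. Rf 0 (fst fg) \<and> Rg 0 (snd fg) \<and> (\<forall>t\<in>{0..1}. fst fg (snd fg t) = (tent s1 ^^ p (Suc 0)) t)"
      using f by (intro exI[of _ "(f, g)"]) simp
  next
    fix fg :: "(real \<Rightarrow> real) \<times> (real \<Rightarrow> real)" and i
    assume "Rf i (fst fg) \<and> Rg i (snd fg) \<and> (\<forall>t\<in>{0..1}. fst fg (snd fg t) = (tent s1 ^^ p (Suc i)) t)"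
    then obtain f where f: "Rf (Suc i) f" "\<forall>t\<in>{0..1}. snd fg (f t) = (tent s2 ^^ q (Suc i)) t" using lift_f by blast
    then obtain g where "Rg (Suc i) g" "\<forall>t\<in>{0..1}. f (g t) = (tent s1 ^^ p (Suc (Suc i))) t" using lift_g by blast
    then show "\<exists>fg'. (Rf (Suc i) (fst fg') \<and> Rg (Suc i) (snd fg') \<and>
        (\<forall>t\<in>{0..1}. fst fg' (snd fg' t) = (tent s1 ^^ p (Suc (Suc i))) t)) \<and>
        (\<forall>t\<in>{0..1}. snd fg (fst fg' t) = (tent s2 ^^ q (Suc i)) t)"
      using f by (intro exI[of _ "(f, g)"]) simp
  qed
  then obtain fg where fg: "\<And>i. Rf i (fst (fg i))" "\<And>i. Rg i (snd (fg i))"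
    "\<And>i t. t \<in> {0..1} \<Longrightarrow> fst (fg i) (snd (fg i) t) = (tent s1 ^^ p (Suc i)) t"
    "\<And>i t. t \<in> {0..1} \<Longrightarrow> snd (fg i) (fst (fg (Suc i)) t) = (tent s2 ^^ q (Suc i)) t" by blast
  have cf: "continuous_on {0..1} (fst (fg i)) \<and> fst (fg i) ` {0..1} \<subseteq> {0..1}" for i
    using realizes_continuous_range[OF A.subdivision_axioms B.subdivision_axioms _ bs] fg(1) unfolding Rf_def by blast
  have cg: "continuous_on {0..1} (snd (fg i)) \<and> snd (fg i) ` {0..1} \<subseteq> {0..1}" for i
    using realizes_continuous_range[OF B.subdivision_axioms A.subdivision_axioms _ bt] fg(2) unfolding Rg_def by blast
  show ?thesis
    by (rule ladder_homeomorphic[where f = "\<lambda>i. fst (fg i)" and g = "\<lambda>i. snd (fg i)" and p = "\<lambda>i. p (Suc i)" and q = "\<lambda>i. q (Suc i)"])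
      (use A.periodic_tent_axioms B.periodic_tent_axioms cf cg fg(3,4) pos in auto)
qed

theorem theorem2p7:
  fixes s1 s2 :: real
  assumes "s1 \<in> periodic_params" and "s2 \<in> periodic_params"
  shows "tent_inverse_limit s1 homeomorphic_space tent_inverse_limit s2 \<longleftrightarrow>
         weakly_equivalent (num_pieces s1) (tent_subst s1) (num_pieces s2) (tent_subst s2)"
proof -
  interpret A: periodic_tent s1 by unfold_locales (rule assms)
  interpret B: periodic_tent s2 by unfold_locales (rule assms)
  have "tent_inverse_limit s1 homeomorphic_space tent_inverse_limit s2 \<longleftrightarrow> A.X homeomorphic B.X"
  proof
    assume "tent_inverse_limit s1 homeomorphic_space tent_inverse_limit s2"
    then obtain f g where "homeomorphic_maps (top_of_set A.X) (top_of_set B.X) f g"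
      unfolding A.tent_inverse_limit_eq B.tent_inverse_limit_eq homeomorphic_space_def by blast
    then have "homeomorphism A.X B.X f g"
      unfolding homeomorphic_maps_def by (intro homeomorphismI) auto
    then show "A.X homeomorphic B.X" unfolding homeomorphic_def by blast
  next
    assume "A.X homeomorphic B.X"
    then obtain f g where "homeomorphism A.X B.X f g" unfolding homeomorphic_def by blast
    then have "homeomorphic_maps (top_of_set A.X) (top_of_set B.X) f g"
      unfolding homeomorphic_maps_def homeomorphism_def by auto
    then show "tent_inverse_limit s1 homeomorphic_space tent_inverse_limit s2"
      unfolding A.tent_inverse_limit_eq B.tent_inverse_limit_eq homeomorphic_space_def by blast
  qed
  then show ?thesis
    using homeomorphic_imp_weakly_equivalent[OF assms] weakly_equivalent_imp_homeomorphic[OF assms] by blast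
qed

end
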